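(* Let $\gamma\ge1$ and suppose that the error densities $f_{\varepsilon_j}$ are symmetric with Fourier transform $f_{\varepsilon_j}^{\mathrm{ft}}(t)=\exp(-\sigma_{j,n}^\gamma|t|^\gamma/2)$, with known, unbounded scaling parameters $\sigma_{j,n}>0$, $1\le j\le n$. Consider the condition $$(\ast)\qquad \sum_{j=1}^n\exp(-\sigma_{j,n}^\gamma\omega^\gamma)\xrightarrow{\,n\to\infty\,}\infty\qquad\text{for any }\omega>0 .$$ (a) If $(\ast)$ holds, then, with a suitable choice of $\omega_n$ and of $K$ such that $K^{\mathrm{ft}}$ is compactly supported and Condition A of the context is satisfied, the estimator $\widehat f_n$ is consistent for $f_X$ without any smoothness assumptions on $f_X$; that is, $\mathrm{E}\|\widehat f_n-f_X\|^2_{L_2(\mathbb{R})}\to0$ as $n\to\infty$ for every density $f_X\in L_2(\mathbb{R})$. (b) If $(\ast)$ does not hold, then for arbitrary $\beta>1/2$ and $C$ large enough there is no consistent estimator for $f_X\in\mathcal{F}_{\beta,C}$; that is, there is no sequence of estimators $\check f_n$ based on $Y_1,\dots,Y_n$ such that $\mathrm{E}\|\check f_n-f_X\|_{L_2(\mathbb{R})}^2\to0$ as $n\to\infty$ for every $f_X\in\mathcal{F}_{\beta,C}$.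
   Context: Model: for each sample size $n$ one observes $Y_j=X_j+\varepsilon_j$, $j=1,\dots,n$, where $X_1,\dots,X_n$ are i.i.d. with unknown density $f_X$ on $\mathbb{R}$, the errors $\varepsilon_1,\dots,\varepsilon_n$ are independent of each other and of the $X_j$'s, and $\varepsilon_j$ has known density $f_{\varepsilon_j}$, which may depend on both $j$ and $n$. For a function $g$, $g^{\mathrm{ft}}(t)=\int e^{\mathrm{i}tx}g(x)\,\mathrm{d}x$ denotes its Fourier transform. Estimator: for a square-integrable kernel $K$ and a smoothing parameter $\omega_n>0$, $$\widehat f_n(x)=\frac1{2\pi}\int e^{-\mathrm{i}tx}K^{\mathrm{ft}}(t/\omega_n)\Psi_n(t)\,\mathrm{d}t,\qquad \Psi_n(t)=\frac{\sum_{j=1}^n f_{\varepsilon_j}^{\mathrm{ft}}(-t)\,e^{\mathrm{i}tY_j}}{\sum_{k=1}^n|f_{\varepsilon_k}^{\mathrm{ft}}(t)|^2}.$$ Class: for $\beta>1/2$ and $C>0$, $\mathcal{F}_{\beta,C}$ is the set of probability densities $f$ on $\mathbb{R}$ with $\int|f^{\mathrm{ft}}(t)|^2(1+t^2)^\beta\,\mathrm{d}t\le C$. Condition A: (A.1) there exists some $j$ such that $|f_{\varepsilon_j}^{\mathrm{ft}}(t)|\ne0$ for all $t\in\mathbb{R}$; (A.2) $K^{\mathrm{ft}}$ is bounded, continuous at $t=0$ and $K^{\mathrm{ft}}(0)=1$; (A.3) $f_{\varepsilon_j}^{\mathrm{ft}}(t\omega_n)K^{\mathrm{ft}}(t)/\big(\sum_{k=1}^n|f_{\varepsilon_k}^{\mathrm{ft}}(t\omega_n)|^2\big)\in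 L_2(\mathbb{R})$, as a function of $t$, for $j=1,\dots,n$. *)

theory Defs
  imports "HOL-Probability.Probability"
begin

definition pdf :: "(real \<Rightarrow> real) \<Rightarrow> bool" where
  "pdf f \<longleftrightarrow> f \<in> borel_measurable borel \<and> (\<forall>x. 0 \<le> f x) \<and>
     (\<integral>\<^sup>+ x. ennreal (f x) \<partial>lborel) = 1"

definition square_integrable :: "(real \<Rightarrow> 'b::{real_normed_vector,second_countable_topology}) \<Rightarrow> bool" where
  "square_integrable g \<longleftrightarrow> g \<in> borel_measurable borel \<and> integrable lborel (\<lambda>x. (norm (g x))\<^sup>2)"

text \<open>The Bochner integral is 0 when \<open>g\<close> is not integrable, and integrability does not depend on
  \<open>t\<close>. Hence \<open>ft g 0 = 1\<close>, as required of kernels below, already forces \<open>g\<close> to be integrable.\<close>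

definition ft :: "(real \<Rightarrow> real) \<Rightarrow> real \<Rightarrow> complex" where
  "ft g t = (CLINT x|lborel. iexp (t * x) * complex_of_real (g x))"

text \<open>Throughout, \<open>n\<close> is the sample size, \<open>fe j\<close> is the density of the \<open>j\<close>-th error for that
  sample size, and \<open>y j\<close> is the \<open>j\<close>-th observation, where \<open>1 \<le> j \<le> n\<close>.\<close>

definition Psi :: "nat \<Rightarrow> (nat \<Rightarrow> real \<Rightarrow> real) \<Rightarrow> (nat \<Rightarrow> real) \<Rightarrow> real \<Rightarrow> complex" where
  "Psi n fe y t = (\<Sum>j=1..n. ft (fe j) (- t) * iexp (t * y j)) /
     complex_of_real (\<Sum>k=1..n. (cmod (ft (fe k) t))\<^sup>2)"

definition fhat :: "(real \<Rightarrow> real) \<Rightarrow> real \<Rightarrow> nat \<Rightarrow> (nat \<Rightarrow> real \<Rightarrow> real) \<Rightarrow> (nat \<Rightarrow> real) \<Rightarrow> real \<Rightarrow> complex" where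
  "fhat K w n fe y x = complex_of_real (1 / (2 * pi)) *
     (CLINT t|lborel. iexp (- (t * x)) * ft K (t / w) * Psi n fe y t)"

definition condition_A :: "(real \<Rightarrow> real) \<Rightarrow> real \<Rightarrow> nat \<Rightarrow> (nat \<Rightarrow> real \<Rightarrow> real) \<Rightarrow> bool" where
  "condition_A K w n fe \<longleftrightarrow>
     (\<exists>j\<in>{1..n}. \<forall>t. ft (fe j) t \<noteq> 0) \<and>
     (bounded (range (ft K)) \<and> isCont (ft K) 0 \<and> ft K 0 = 1) \<and>
     (\<forall>j\<in>{1..n}. square_integrable (\<lambda>t. ft (fe j) (t * w) * ft K t /
        complex_of_real (\<Sum>k=1..n. (cmod (ft (fe k) (t * w)))\<^sup>2)))"

definition sobolev_class :: "real \<Rightarrow> real \<Rightarrow> (real \<Rightarrow> real) set" where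
  "sobolev_class \<beta> C = {f. pdf f \<and>
     (\<integral>\<^sup>+ t. ennreal ((cmod (ft f t))\<^sup>2 * (1 + t\<^sup>2) powr \<beta>) \<partial>lborel) \<le> ennreal C}"

text \<open>The joint law of \<open>(Y\<^sub>1, \<dots>, Y\<^sub>n)\<close>. A sample point \<open>s\<close> of the underlying product space consists
  of the pairs \<open>s j = (X\<^sub>j, \<epsilon>\<^sub>j)\<close>, whose components are all mutually independent.\<close>

definition data_law :: "nat \<Rightarrow> (real \<Rightarrow> real) \<Rightarrow> (nat \<Rightarrow> real \<Rightarrow> real) \<Rightarrow> (nat \<Rightarrow> real) measure" where
  "data_law n fX fe =
     distr (\<Pi>\<^sub>M j\<in>{1..n}. density lborel (\<lambda>x. ennreal (fX x)) \<Otimes>\<^sub>M density lborel (\<lambda>x. ennreal (fe j x)))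
           (\<Pi>\<^sub>M j\<in>{1..n}. borel)
           (\<lambda>s. \<lambda>j\<in>{1..n}. fst (s j) + snd (s j))"

text \<open>Estimators take complex values because \<open>fhat\<close> is given by a complex integral; real-valued
  estimators are the special case of embedded reals. The estimate may depend on the (known) error
  densities, but on the unknown density only through the data \<open>y\<close>.\<close>

definition estimator :: "nat \<Rightarrow> ((nat \<Rightarrow> real) \<Rightarrow> real \<Rightarrow> complex) \<Rightarrow> bool" where
  "estimator n est \<longleftrightarrow>
     (\<lambda>(y, x). est y x) \<in> borel_measurable ((\<Pi>\<^sub>M j\<in>{1..n}. borel) \<Otimes>\<^sub>M borel)"

definition mise :: "nat \<Rightarrow> (real \<Rightarrow> real) \<Rightarrow> (nat \<Rightarrow> real \<Rightarrow> real) \<Rightarrow> ((nat \<Rightarrow> real) \<Rightarrow> real \<Rightarrow> complex) \<Rightarrow> ennreal" where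
  "mise n fX fe est =
     (\<integral>\<^sup>+ y. (\<integral>\<^sup>+ x. ennreal ((cmod (est y x - complex_of_real (fX x)))\<^sup>2) \<partial>lborel) \<partial>data_law n fX fe)"

end

theory Submission
  imports Defs
begin

text \<open>Everything is done on the Fourier side. There the signal enters the data through the product
\<open>ft fX * ft (fe j)\<close>, and the quantity that decides is \<open>S n t\<close>, the sum over \<open>j\<close> of \<open>\<bar>ft (fe j)
t\<bar>\<^sup>2 = exp (- (\<sigma> n j powr \<gamma> * \<bar>t\<bar> powr \<gamma>))\<close>.

Consistency. \<open>Psi n fe y t\<close> is an unbiased estimator of \<open>ft fX t\<close>, and independence makes its
variance at most a constant over \<open>S n t\<close> (\<open>Psi_risk\<close>). As a kernel serves the Fejer kernel: it is
a probability density whose transform is the triangle function on \<open>[-1, 1]\<close>. The estimate differs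
from the Fejer mean of \<open>fX\<close> by the inverse transform of the error of \<open>Psi\<close>, so the Bessel
inequality (\<open>bessel_fourier\<close>) turns the frequency-wise variances into a stochastic error of order
\<open>w / S n w\<close>. The Fejer means of a square integrable density converge to it in mean square
(\<open>fejer_mean_L2\<close>), and since \<open>S n w\<close> diverges for every fixed \<open>w\<close>, the bandwidth can be sent to
infinity slowly enough for the stochastic error to vanish too (\<open>slow_bandwidth\<close>).

Inconsistency. Otherwise \<open>S n \<omega>\<close> is bounded along infinitely many \<open>n\<close> for some \<open>\<omega>\<close>. Compare the
Fejer density with the same density times \<open>1 + cos (b * x) / 2\<close>. The two transforms differ only
near \<open>\<plusminus>b\<close>, at frequencies above \<open>6 * \<omega>\<close>, where the noise has destroyed the signal: the \<open>L\<^sup>1\<close>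
distance between the two densities of the \<open>j\<close>-th observation is at most a constant times \<open>exp (-
(\<sigma> n j powr \<gamma> * \<omega> powr \<gamma>))\<close> (\<open>conv_perturbation_L1_stretched\<close>), and it never exceeds a half. Hence
the product over \<open>j\<close> of the pointwise minima of the two densities keeps a mass that is bounded
away from zero along those \<open>n\<close>. This common part of the two data laws forces every estimator to
err under at least one of them (\<open>two_point_lower_bound\<close>). Both densities have compactly supported
transforms and therefore lie in every Sobolev class of large enough radius.\<close>

section \<open>The Fourier transform and Gaussian summability\<close>

text \<open>The sign convention is that of \<open>ft\<close>, so the inverse transform at \<open>x\<close> is \<open>fourier H (- x) /
(2 * pi)\<close>. Complex arguments are needed because the estimated characteristic functions are
inverted as well.\<close>

definition fourier :: "(real \<Rightarrow> complex) \<Rightarrow> real \<Rightarrow> complex" where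
  "fourier H x = (CLINT t|lborel. iexp (t * x) * H t)"

lemma norm_iexp [simp]: "cmod (iexp x) = 1"
  by (rule norm_exp_i_times)

lemma measurable_iexp [measurable (raw)]:
  "f \<in> borel_measurable M \<Longrightarrow> (\<lambda>x. iexp (f x)) \<in> borel_measurable M"
  by measurable

lemma ft_eq_fourier: "ft g t = fourier (\<lambda>x. complex_of_real (g x)) t"
  unfolding ft_def fourier_def by (simp add: mult.commute)

lemma integrable_iexp_mult:
  assumes "integrable lborel (H :: real \<Rightarrow> complex)" "f \<in> borel_measurable borel"
  shows "integrable lborel (\<lambda>t. iexp (f t) * H t)"
proof -
  have [measurable]: "H \<in> borel_measurable borel" "f \<in> borel_measurable borel" 
    using assms by auto
  show ?thesis
    by (rule Bochner_Integration.integrable_bound[OF integrable_norm[OF assms(1)]])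
       (auto simp: norm_mult simp del: of_real_mult)
qed

lemma fourier_measurable [measurable]:
  assumes [measurable]: "H \<in> borel_measurable borel"
  shows "fourier H \<in> borel_measurable borel"
  unfolding fourier_def[abs_def] by measurable

lemma norm_fourier_le: "cmod (fourier H x) \<le> (\<integral>t. cmod (H t) \<partial>lborel)"
  unfolding fourier_def 
  by (rule order_trans[OF integral_norm_bound]) (simp add: norm_mult del: of_real_mult)

text \<open>A kernel bounded by one leaves the product of two integrable functions integrable on the
plane. The kernels used below are exponentials, for which the two sides are pairings with a
transform.\<close>

lemma fubini_bounded_kernel:
  fixes H g :: "real \<Rightarrow> complex" and k :: "real \<Rightarrow> real \<Rightarrow> complex"
  assumes H: "integrable lborel H" and g: "integrable lborel g"
    and k[measurable]: "(\<lambda>(x, s). k x s) \<in> borel_measurable (borel \<Otimes>\<^sub>M borel)"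
    and k1: "\<And>x s. cmod (k x s) \<le> 1"
  shows "(CLINT x|lborel. g x * (CLINT s|lborel. k x s * H s)) =
         (CLINT s|lborel. H s * (CLINT x|lborel. k x s * g x))"
proof -
  have [measurable]: "H \<in> borel_measurable borel" "g \<in> borel_measurable borel"
    using H g by auto
  have kH: "integrable lborel (\<lambda>s. k x s * H s)" for x
    by (rule Bochner_Integration.integrable_bound[OF integrable_norm[OF H]])
       (auto simp: norm_mult intro!: mult_left_le_one_le k1)
  have kg: "integrable lborel (\<lambda>x. k x s * g x)" for s
    by (rule Bochner_Integration.integrable_bound[OF integrable_norm[OF g]])
       (auto simp: norm_mult intro!: mult_left_le_one_le k1)
  have int: "integrable (lborel \<Otimes>\<^sub>M lborel) (\<lambda>(x, s). g x * (k x s * H s))"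
  proof (rule lborel_pair.Fubini_integrable)
    show "(\<lambda>(x, s). g x * (k x s * H s)) \<in> borel_measurable (lborel \<Otimes>\<^sub>M lborel)"
      by measurable
    show "integrable lborel (\<lambda>x. LINT y|lborel. norm (case (x, y) of (x, s) \<Rightarrow> g x * (k x s * H s)))"
    proof (rule Bochner_Integration.integrable_bound)
      show "integrable lborel (\<lambda>x. cmod (g x) * (LINT s|lborel. cmod (H s)))"
        using g by auto
      show "AE x in lborel. norm (LINT y|lborel. norm (case (x, y) of (x, s) \<Rightarrow> g x * (k x s * H s)))
         \<le> norm (cmod (g x) * (LINT s|lborel. cmod (H s)))"
      proof (rule AE_I2)
        fix x
        have "(LINT y|lborel. cmod (k x y * H y)) \<le> (LINT s|lborel. cmod (H s))"
          by (intro integral_mono integrable_norm kH H)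
             (auto simp: norm_mult intro!: mult_left_le_one_le k1)
        then show "norm (LINT y|lborel. norm (case (x, y) of (x, s) \<Rightarrow> g x * (k x s * H s)))
         \<le> norm (cmod (g x) * (LINT s|lborel. cmod (H s)))"
          by (simp add: norm_mult abs_mult mult_left_mono)
      qed
    qed measurable
    show "AE x in lborel. integrable lborel (\<lambda>y. case (x, y) of (x, s) \<Rightarrow> g x * (k x s * H s))"
      using kH by auto
  qed
  have "(CLINT x|lborel. g x * (CLINT s|lborel. k x s * H s)) =
        (CLINT x|lborel. CLINT s|lborel. g x * (k x s * H s))"
    by simp
  also have "\<dots> = (CLINT s|lborel. CLINT x|lborel. g x * (k x s * H s))"
    by (rule lborel_pair.Fubini_integral[symmetric, OF int])
  also have "\<dots> = (CLINT s|lborel. CLINT x|lborel. H s * (k x s * g x))"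
    by (simp add: mult_ac)
  also have "\<dots> = (CLINT s|lborel. H s * (CLINT x|lborel. k x s * g x))"
    by simp
  finally show ?thesis .
qed

lemma gauss_transform_std: "(CLINT x|lborel. iexp (t * x) * of_real (exp (- x\<^sup>2 / 2))) =
    of_real (sqrt (2 * pi) * exp (- t\<^sup>2 / 2))"
proof -
  have "char std_normal_distribution t = (CLINT x|lborel. complex_of_real (std_normal_density x) *
      iexp (t * x))"
    unfolding char_def by (subst integral_density) (auto simp: scaleR_conv_of_real)
  also have "\<dots> = (CLINT x|lborel. complex_of_real (1 / sqrt (2*pi)) * (iexp (t * x) * of_real (exp
      (- x\<^sup>2 / 2))))"
    by (intro Bochner_Integration.integral_cong refl) (simp add: std_normal_density_def mult_ac)
  also have "\<dots> = complex_of_real (1 / sqrt (2*pi)) * (CLINT x|lborel. (iexp (t * x) * of_real (exp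
      (- x\<^sup>2 / 2))))"
    by (rule integral_mult_right_zero)
  finally have *: "complex_of_real (1 / sqrt (2*pi)) * (CLINT x|lborel. (iexp (t * x) * of_real (exp
      (- x\<^sup>2 / 2)))) = of_real (exp (- t\<^sup>2 / 2))"
    by (simp add: char_std_normal_distribution)
  have "(CLINT x|lborel. (iexp (t * x) * of_real (exp (- x\<^sup>2 / 2)))) =
      complex_of_real (sqrt (2*pi)) * (complex_of_real (1 / sqrt (2*pi)) * (CLINT x|lborel. (iexp (t
      * x) * of_real (exp (- x\<^sup>2 / 2)))))"
    by simp
  then show ?thesis unfolding * by simp
qed

lemma integrable_gauss: "a > 0 \<Longrightarrow> integrable lborel (\<lambda>x::real. exp (- (a * x)\<^sup>2 / 2))"
proof -
  assume a: "a > 0"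
  have "integrable lborel (\<lambda>x. sqrt (2*pi) * std_normal_density (0 + a * x))"
    using a by (intro integrable_mult_right lborel_integrable_real_affine integrable_normal_density)
        auto
  then show ?thesis by (simp add: std_normal_density_def)
qed

lemma gauss_transform:
  assumes a: "a > 0"
  shows "(CLINT x|lborel. iexp (u * x) * of_real (exp (- (a * x)\<^sup>2 / 2))) =
      of_real (2 * pi * normal_density 0 a u)"
proof -
  have "(CLINT x|lborel. iexp ((u/a) * x) * of_real (exp (- x\<^sup>2 / 2))) =
      \<bar>a\<bar> *\<^sub>R (CLINT x|lborel. iexp ((u/a) * (0 + a * x)) * of_real (exp (- (0 + a * x)\<^sup>2 / 2)))"
    using a by (intro lborel_integral_real_affine) auto
  then have "complex_of_real a * (CLINT x|lborel. iexp (u * x) * of_real (exp (- (a * x)\<^sup>2 / 2))) =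
      of_real (sqrt (2 * pi) * exp (- (u/a)\<^sup>2 / 2))"
    using a gauss_transform_std[of "u/a"] by (simp add: scaleR_conv_of_real)
  then have "(CLINT x|lborel. iexp (u * x) * of_real (exp (- (a * x)\<^sup>2 / 2))) =
      of_real (sqrt (2 * pi) * exp (- (u/a)\<^sup>2 / 2)) / of_real a"
    using a by (simp add: field_simps)
  also have "\<dots> = of_real (sqrt (2 * pi) * exp (- (u/a)\<^sup>2 / 2) / a)"
    by simp
  also have "sqrt (2 * pi) * exp (- (u/a)\<^sup>2 / 2) / a = 2 * pi * normal_density 0 a u"
  proof -
    have "normal_density 0 a u = exp (- (u/a)\<^sup>2 / 2) / (sqrt (2 * pi) * a)"
      using a by (simp add: normal_density_def real_sqrt_mult power_divide mult.commute)
    moreover have "sqrt (2 * pi) * E / a = (sqrt (2 * pi) * sqrt (2 * pi)) * (E / (sqrt (2 * pi) *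
        a))" for E
      using a by (simp add: field_simps)
    ultimately show ?thesis by simp
  qed
  finally show ?thesis .
qed

text \<open>Inserting a Gaussian factor makes the double integral absolutely convergent. Fubini then
replaces the factor by its own transform, a normal density that concentrates at \<open>t\<close> as \<open>a\<close> tends
to 0. Both the inversion formula and the Bessel inequality are limits of this identity.\<close>

lemma gauss_inversion:
  fixes H :: "real \<Rightarrow> complex"
  assumes H: "integrable lborel H" and a: "a > 0"
  shows "(CLINT x|lborel. iexp (- (t * x)) * fourier H x * of_real (exp (- (a * x)\<^sup>2 / 2))) =
     2 * pi * (CLINT s|lborel. H s * of_real (normal_density t a s))"
proof -
  define g where "g x = iexp (- (t * x)) * of_real (exp (- (a * x)\<^sup>2 / 2))" for x
  have g: "integrable lborel g" unfolding g_def[abs_def]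
    using integrable_gauss[OF a] by (intro integrable_iexp_mult integrable_of_real) auto
  have "(CLINT x|lborel. iexp (- (t * x)) * fourier H x * of_real (exp (- (a * x)\<^sup>2 / 2))) =
     (CLINT x|lborel. g x * (CLINT s|lborel. iexp (s * x) * H s))"
    by (intro Bochner_Integration.integral_cong refl) (simp add: g_def fourier_def mult_ac)
  also have "\<dots> = (CLINT s|lborel. H s * (CLINT x|lborel. iexp (s * x) * g x))"
    by (rule fubini_bounded_kernel[OF H g]) (auto simp del: of_real_mult)
  also have "\<dots> = (CLINT s|lborel. H s * of_real (2 * pi * normal_density 0 a (s - t)))"
  proof (intro Bochner_Integration.integral_cong refl arg_cong2[where f="(*)"])
    fix s
    have "(CLINT x|lborel. iexp (s * x) * g x) = (CLINT x|lborel. iexp ((s - t) * x) * of_real (exp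
        (- (a * x)\<^sup>2 / 2)))"
      unfolding g_def mult.assoc[symmetric] exp_add[symmetric]
      by (intro Bochner_Integration.integral_cong refl) (simp add: algebra_simps)
    then show "(CLINT x|lborel. iexp (s * x) * g x) = of_real (2 * pi * normal_density 0 a (s - t))"
      using gauss_transform[OF a, of "s - t"] by simp
  qed
  also have "\<dots> = (CLINT s|lborel. (2 * pi) * (H s * of_real (normal_density t a s)))"
    by (intro Bochner_Integration.integral_cong refl) (simp add: normal_density_def mult_ac)
  also have "\<dots> = 2 * pi * (CLINT s|lborel. H s * of_real (normal_density t a s))"
    by (rule integral_mult_right_zero)
  finally show ?thesis .
qed

lemma gauss_approximation:
  fixes H :: "real \<Rightarrow> complex"
  assumes [measurable]: "H \<in> borel_measurable borel" and B: "\<And>s. cmod (H s) \<le> B" and c: "isCont H t"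
  shows "(\<lambda>n. CLINT s|lborel. H s * of_real (normal_density t (1 / Suc n) s)) \<longlonglongrightarrow> H t"
proof -
  have eq: "(CLINT s|lborel. H s * of_real (normal_density t a s)) = (CLINT z|lborel. H (t +
      a * z) * of_real (std_normal_density z))"
    if a: "a > 0" for a
  proof -
    have "(CLINT s|lborel. H s * of_real (normal_density t a s)) = \<bar>a\<bar> *\<^sub>R (CLINT z|lborel. H (t +
        a * z) * of_real (normal_density t a (t + a * z)))"
      using a by (intro lborel_integral_real_affine) auto
    also have "\<dots> = (CLINT z|lborel. \<bar>a\<bar> *\<^sub>R (H (t + a * z) * of_real (normal_density t a (t + a * z))))"
      by (rule integral_scaleR_right[symmetric]) 
    also have "\<dots> = (CLINT z|lborel. H (t + a * z) * of_real (std_normal_density z))"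
    proof (intro Bochner_Integration.integral_cong refl)
      fix z
      have "a * normal_density t a (t + a * z) = std_normal_density z"
        using a by (simp add: normal_density_def real_sqrt_mult field_simps power_mult_distrib)
      then have "complex_of_real a * complex_of_real (normal_density t a (t + a * z)) =
          complex_of_real (std_normal_density z)"
        by (metis of_real_mult)
      then show "\<bar>a\<bar> *\<^sub>R (H (t + a * z) * of_real (normal_density t a (t + a * z))) =
          H (t + a * z) * of_real (std_normal_density z)"
        using a by (simp add: scaleR_conv_of_real mult_ac)
    qed
    finally show ?thesis .
  qed
  have "(\<lambda>n. CLINT z|lborel. H (t + (1 / Suc n) * z) * of_real (std_normal_density z)) \<longlonglongrightarrow>
      (CLINT z|lborel. H t * of_real (std_normal_density z))"
  proof (rule integral_dominated_convergence[where w="\<lambda>z. B * std_normal_density z"])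
    show "integrable lborel (\<lambda>z. B * std_normal_density z)"
      by (intro integrable_mult_right integrable_normal_density) auto
    show "AE z in lborel. (\<lambda>n. H (t + (1 / Suc n) * z) * of_real (std_normal_density z)) \<longlonglongrightarrow>
        H t * of_real (std_normal_density z)"
    proof (intro AE_I2 tendsto_mult tendsto_const isCont_tendsto_compose[OF c])
      fix z
      have "(\<lambda>n. t + inverse (real (Suc n)) * z) \<longlonglongrightarrow> t + 0 * z"
        by (intro tendsto_add tendsto_mult tendsto_const LIMSEQ_inverse_real_of_nat)
      then show "(\<lambda>n. t + 1 / real (Suc n) * z) \<longlonglongrightarrow> t" by (simp add: inverse_eq_divide)
    qed
    show "AE z in lborel. norm (H (t + 1 / real (Suc n) * z) * of_real (std_normal_density z)) \<le>
        B * std_normal_density z" for n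
      by (auto simp: norm_mult intro!: mult_right_mono B)
  qed auto
  also have "(CLINT z|lborel. H t * of_real (std_normal_density z)) = H t"
    using integral_normal_density[of 1 0] by (simp add: integral_mult_right_zero)
  finally show ?thesis by (subst eq) auto
qed

lemma of_nat_Suc_inverse_pos: "0 < 1 / real (Suc n)"
  by simp

text \<open>Let \<open>a = 1 / Suc n\<close> in \<open>gauss_inversion\<close>: the left side converges by domination, the right
side because the normal densities form an approximate identity.\<close>

lemma fourier_inversion:
  fixes H :: "real \<Rightarrow> complex"
  assumes H: "integrable lborel H" and B: "\<And>s. cmod (H s) \<le> B" and c: "isCont H t"
    and F: "integrable lborel (fourier H)"
  shows "(CLINT x|lborel. iexp (- (t * x)) * fourier H x) = 2 * pi * H t"
proof (rule LIMSEQ_unique)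
  have [measurable]: "H \<in> borel_measurable borel" using H by auto
  let ?X = "\<lambda>n. (CLINT x|lborel. iexp (- (t * x)) * fourier H x * of_real (exp (- ((1 / Suc n) *
      x)\<^sup>2 / 2)))"
  show "?X \<longlonglongrightarrow> 2 * pi * H t"
    unfolding gauss_inversion[OF H of_nat_Suc_inverse_pos]
    by (intro tendsto_mult tendsto_const gauss_approximation[OF _ B c]) measurable
  show "?X \<longlonglongrightarrow> (CLINT x|lborel. iexp (- (t * x)) * fourier H x)"
  proof (rule integral_dominated_convergence[where w="\<lambda>x. cmod (fourier H x)"])
    show "integrable lborel (\<lambda>x. cmod (fourier H x))" using F by auto
    show "AE x in lborel. (\<lambda>n. iexp (- (t * x)) * fourier H x * of_real (exp (- (1 / Suc n * x)\<^sup>2 / 2)))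
       \<longlonglongrightarrow> iexp (- (t * x)) * fourier H x"
    proof (rule AE_I2)
      fix x
      have "(\<lambda>n. iexp (- (t * x)) * fourier H x * of_real (exp (- (inverse (real (Suc n)) * x)\<^sup>2 / 2)))
       \<longlonglongrightarrow> iexp (- (t * x)) * fourier H x * of_real (exp (- (0 * x)\<^sup>2 / 2))"
        by (intro tendsto_mult tendsto_const tendsto_of_real tendsto_exp tendsto_divide
            tendsto_minus tendsto_power LIMSEQ_inverse_real_of_nat) auto
      then show "(\<lambda>n. iexp (- (t * x)) * fourier H x * of_real (exp (- (1 / Suc n * x)\<^sup>2 / 2)))
       \<longlonglongrightarrow> iexp (- (t * x)) * fourier H x" by (simp add: inverse_eq_divide)
    qed
    show "AE x in lborel. norm (iexp (- (t * x)) * fourier H x * of_real (exp (- (1 / Suc n *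
        x)\<^sup>2 / 2))) \<le> cmod (fourier H x)" for n
    proof (rule AE_I2)
      fix x
      have "cmod (fourier H x) * exp (- (1 / Suc n * x)\<^sup>2 / 2) \<le> cmod (fourier H x) * 1"
        by (intro mult_left_mono) auto
      then show "norm (iexp (- (t * x)) * fourier H x * of_real (exp (- (1 / Suc n * x)\<^sup>2 / 2))) \<le>
          cmod (fourier H x)"
        unfolding norm_mult norm_iexp norm_of_real by simp
    qed
  qed (measurable)
qed

section \<open>The triangle function and the Fejer kernel\<close>

text \<open>Up to normalisation the triangle function and the Fejer kernel below are Fourier transforms
of each other.\<close>

definition tri :: "real \<Rightarrow> real" where
  "tri t = max 0 (1 - \<bar>t\<bar>)"

definition fejer :: "real \<Rightarrow> real" where
  "fejer x = (if x = 0 then 1 / (2 * pi) else (1 - cos x) / (pi * x\<^sup>2))"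

lemma tri_measurable [measurable]: "tri \<in> borel_measurable borel"
  unfolding tri_def[abs_def] by measurable

lemma tri_nonneg: "0 \<le> tri t" and tri_le_1: "tri t \<le> 1" and tri_0 [simp]: "tri 0 = 1"
  and tri_minus [simp]: "tri (- t) = tri t"
  and tri_eq_0: "\<bar>t\<bar> \<ge> 1 \<Longrightarrow> tri t = 0"
  by (auto simp: tri_def)

lemma isCont_tri: "isCont tri t"
  unfolding tri_def[abs_def] by (intro continuous_intros)

lemma has_integral_tri: "has_bochner_integral lborel tri 1"
proof -
  have 1: "has_bochner_integral lborel (\<lambda>t. indicator {-1..0} t *\<^sub>R (1 + t)) ((0 + 0\<^sup>2/2) - (-1 +
      (-1)\<^sup>2/2 :: real))"
    by (rule has_bochner_integral_FTC_Icc[where F="\<lambda>t. t + t\<^sup>2/2"])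
       (auto intro!: derivative_eq_intros continuous_intros simp:
           has_real_derivative_iff_has_vector_derivative[symmetric])
  have 2: "has_bochner_integral lborel (\<lambda>t. indicator {0..1} t *\<^sub>R (1 - t)) ((1 - 1\<^sup>2/2) - (0 -
      0\<^sup>2/2 :: real))"
    by (rule has_bochner_integral_FTC_Icc[where F="\<lambda>t. t - t\<^sup>2/2"])
       (auto intro!: derivative_eq_intros continuous_intros simp:
           has_real_derivative_iff_has_vector_derivative[symmetric])
  from has_bochner_integral_add[OF 1 2]
  have "has_bochner_integral lborel (\<lambda>t. indicator {-1..0} t *\<^sub>R (1 + t) + indicator {0..1} t *\<^sub>R (1
      - t)) (1::real)"
    by simp
  then show ?thesis
  proof (subst has_bochner_integral_cong_AE)
    show "AE t in lborel. tri t = indicator {-1..0} t *\<^sub>R (1 + t) + indicator {0..1} t *\<^sub>R (1 - t)"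
      using AE_lborel_singleton[of 0] by eventually_elim (auto simp: tri_def indicator_def)
  qed auto
qed

lemma integrable_tri: "integrable lborel tri" and integral_tri: "integral\<^sup>L lborel tri = 1"
  using has_integral_tri by (auto simp: has_bochner_integral_iff)

text \<open>On each half of the support the integrand is a linear function times an exponential and has
an elementary antiderivative.\<close>

lemma fourier_tri: "fourier (\<lambda>t. complex_of_real (tri t)) x = of_real (2 * pi * fejer x)"
proof (cases "x = 0")
  case True
  then show ?thesis by (simp add: fourier_def fejer_def integral_tri)
next
  case False
  let ?c = "\<i> * complex_of_real x"
  let ?e = "\<lambda>z. exp (?c * z)"
  have c: "?c \<noteq> 0" using False by simp
  let ?F = "\<lambda>z. (1 + z) * ?e z / ?c - ?e z / ?c\<^sup>2" and ?G = "\<lambda>z. (1 - z) * ?e z / ?c + ?e z / ?c\<^sup>2"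
  have F: "(?F has_field_derivative (1 + z) * ?e z) (at z)" for z
    using c by (auto intro!: derivative_eq_intros simp: field_simps power2_eq_square)
  have G: "(?G has_field_derivative (1 - z) * ?e z) (at z)" for z
    using c by (auto intro!: derivative_eq_intros simp: field_simps power2_eq_square)
  have 1: "has_bochner_integral lborel (\<lambda>t. indicator {-1..0} t *\<^sub>R ((1 + complex_of_real t) *
      ?e t)) (?F (of_real 0) - ?F (of_real (-1)))"
    by (rule has_bochner_integral_FTC_Icc[where F="\<lambda>t. ?F (of_real t)"])
       (auto intro!: continuous_intros has_vector_derivative_real_field[OF F])
  have 2: "has_bochner_integral lborel (\<lambda>t. indicator {0..1} t *\<^sub>R ((1 - complex_of_real t) *
      ?e t)) (?G (of_real 1) - ?G (of_real 0))"
    by (rule has_bochner_integral_FTC_Icc[where F="\<lambda>t. ?G (of_real t)"])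
       (auto intro!: continuous_intros has_vector_derivative_real_field[OF G])
  have val: "?F (of_real 0) - ?F (of_real (-1)) + (?G (of_real 1) - ?G (of_real 0)) =
      of_real (2 * pi * fejer x)"
  proof -
    have "exp ?c + exp (- ?c) = 2 * of_real (cos x)"
      using cos_exp_eq[of "of_real x"] by (simp add: cos_of_real mult.commute)
    moreover have "?F (of_real 0) - ?F (of_real (-1)) + (?G (of_real 1) - ?G (of_real 0)) =
        (exp ?c + exp (- ?c) - 2) / ?c\<^sup>2"
      by (simp add: add_divide_distrib diff_divide_distrib)
    ultimately have "?F (of_real 0) - ?F (of_real (-1)) + (?G (of_real 1) - ?G (of_real 0)) =
        (2 * of_real (cos x) - 2) / ?c\<^sup>2"
      by simp
    also have "\<dots> = of_real ((2 - 2 * cos x) / x\<^sup>2)"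
      using False by (simp add: power_mult_distrib field_simps)
    also have "(2 - 2 * cos x) / x\<^sup>2 = 2 * pi * fejer x"
      using False by (simp add: fejer_def field_simps)
    finally show ?thesis .
  qed
  have "has_bochner_integral lborel (\<lambda>t. iexp (t * x) * complex_of_real (tri t)) (of_real (2 * pi *
      fejer x))"
    using has_bochner_integral_add[OF 1 2, unfolded val]
  proof (subst has_bochner_integral_cong_AE)
    show "AE t in lborel. iexp (t * x) * complex_of_real (tri t) = indicator {-1..0} t *\<^sub>R ((1 +
        complex_of_real t) * ?e t) + indicator {0..1} t *\<^sub>R ((1 - complex_of_real t) * ?e t)"
      using AE_lborel_singleton[of 0] 
      by eventually_elim (auto simp: tri_def indicator_def mult_ac)
  qed auto
  then show ?thesis by (simp add: fourier_def has_bochner_integral_iff)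
qed

lemma fejer_measurable [measurable]: "fejer \<in> borel_measurable borel"
  unfolding fejer_def[abs_def] by measurable

lemma fejer_nonneg: "0 \<le> fejer x"
  by (simp add: fejer_def)

lemma fejer_minus [simp]: "fejer (- x) = fejer x"
  by (simp add: fejer_def)

lemma fejer_le: "fejer x \<le> 1 / (2 * pi)"
proof -
  have "2 * pi * fejer x = cmod (fourier (\<lambda>t. complex_of_real (tri t)) x)"
    unfolding fourier_tri norm_of_real by (simp add: fejer_nonneg)
  also have "\<dots> \<le> (\<integral>t. cmod (complex_of_real (tri t)) \<partial>lborel)"
    by (rule norm_fourier_le)
  also have "\<dots> = 1" by (simp add: tri_nonneg integral_tri)
  finally show ?thesis by (simp add: field_simps)
qed

lemma fejer_decay: "x \<noteq> 0 \<Longrightarrow> fejer x \<le> 2 / (pi * x\<^sup>2)"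
  using cos_ge_minus_one[of x] by (auto simp: fejer_def intro!: divide_right_mono)

lemma integrable_fejer: "integrable lborel fejer"
proof -
  have "integrable lborel (\<lambda>x::real. inverse (1 + x\<^sup>2))"
    using integrable_inverse_1_plus_square by (simp add: set_integrable_def)
  then show ?thesis
  proof (rule Bochner_Integration.integrable_bound[OF integrable_mult_right[where c=2]])
    show "AE x in lborel. norm (fejer x) \<le> norm (2 * inverse (1 + x\<^sup>2))"
    proof (rule AE_I2)
      fix x :: real
      have "fejer x * 1 \<le> 1 / (2 * pi) * 1" using fejer_le by simp
      moreover have "fejer x * x\<^sup>2 \<le> 2 / pi"
        using fejer_decay[of x] by (cases "x = 0") (auto simp: field_simps)
      moreover have "1 / (2 * pi) \<le> 1" "2 / pi \<le> 1"
        using pi_gt3 by (auto simp: field_simps)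
      ultimately have "fejer x * (1 + x\<^sup>2) \<le> 2" unfolding distrib_left by linarith
      then show "norm (fejer x) \<le> norm (2 * inverse (1 + x\<^sup>2))"
        using fejer_nonneg[of x] by (simp add: field_simps add_pos_nonneg)
    qed
  qed auto
qed

text \<open>The transform of \<open>fejer\<close> is not computed directly: \<open>fejer\<close> is the transform of \<open>tri\<close> up to a
constant and integrable, so the inversion formula gives \<open>tri\<close> back.\<close>

lemma ft_fejer: "ft fejer t = of_real (tri t)"
proof -
  have "(CLINT x|lborel. iexp (- (- t * x)) * fourier (\<lambda>t. complex_of_real (tri t)) x) =
      complex_of_real (2 * pi) * complex_of_real (tri (- t))"
    by (rule fourier_inversion[where B=1])
       (auto simp: integrable_tri tri_nonneg tri_le_1 fourier_tri[abs_def] integrable_fejer intro!: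
           continuous_of_real isCont_tri)
  then have "(CLINT x|lborel. (2 * pi) * (iexp (t * x) * of_real (fejer x))) = 2 * pi * of_real (tri t)"
    unfolding fourier_tri by (simp add: mult_ac)
  moreover have "(CLINT x|lborel. (2 * pi) * (iexp (t * x) * of_real (fejer x))) =
      (2 * pi) * (CLINT x|lborel. iexp (t * x) * of_real (fejer x))"
    by (rule integral_mult_right_zero)
  ultimately show ?thesis unfolding ft_def by simp
qed

lemma integral_fejer: "integral\<^sup>L lborel fejer = 1"
proof -
  have "complex_of_real (integral\<^sup>L lborel fejer) = ft fejer 0"
    by (simp add: ft_def)
  then show ?thesis by (simp add: ft_fejer)
qed

lemma pdf_integrable: "pdf f \<Longrightarrow> integrable lborel f" and pdf_integral: "pdf f \<Longrightarrow> integral\<^sup>L lborel f = 1"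
proof -
  assume f: "pdf f"
  then show "integrable lborel f"
    by (intro integrableI_nonneg) (auto simp: pdf_def)
  from f show "integral\<^sup>L lborel f = 1"
    by (subst integral_eq_nn_integral) (auto simp: pdf_def)
qed

lemma pdfI: 
  assumes "integrable lborel f" "\<And>x. 0 \<le> f x" "integral\<^sup>L lborel f = 1"
  shows "pdf f"
  using assms nn_integral_eq_integral[of lborel f] by (auto simp: pdf_def)

lemma pdf_measurable: "pdf f \<Longrightarrow> f \<in> borel_measurable borel"
  and pdf_nonneg: "pdf f \<Longrightarrow> 0 \<le> f x"
  by (auto simp: pdf_def)

lemma norm_ft_pdf: "pdf f \<Longrightarrow> cmod (ft f t) \<le> 1"
  unfolding ft_eq_fourier
  by (rule order_trans[OF norm_fourier_le]) (simp add: pdf_nonneg pdf_integral)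

lemma pdf_fejer: "pdf fejer"
  by (intro pdfI integrable_fejer fejer_nonneg integral_fejer)

lemma ft_measurable [measurable]: "g \<in> borel_measurable borel \<Longrightarrow> ft g \<in> borel_measurable borel"
  unfolding ft_eq_fourier[abs_def] by measurable

text \<open>The left side is the convolution of \<open>f\<close> with the inverse transform of \<open>G\<close>, up to \<open>2 * pi\<close>.
It is used for the mean of the estimator and for the effect of the noise on a band-limited
perturbation.\<close>

lemma convolution_inverse_fourier:
  assumes f: "pdf f" and G: "integrable lborel G"
  shows "(CLINT y|lborel. of_real (f y) * fourier G (y - x)) =
      (CLINT t|lborel. iexp (- (t * x)) * G t * ft f t)"
proof -
  have fc: "integrable lborel (\<lambda>y. complex_of_real (f y))" using pdf_integrable[OF f] by simp
  have "(CLINT y|lborel. of_real (f y) * fourier G (y - x)) =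
      (CLINT y|lborel. of_real (f y) * (CLINT t|lborel. iexp (y * t) * (iexp (- (t * x)) * G t)))"
    unfolding fourier_def by (simp add: algebra_simps exp_add[symmetric] mult_exp_exp)
  also have "\<dots> = (CLINT t|lborel. (iexp (- (t * x)) * G t) * (CLINT y|lborel. iexp (y * t) * of_real
      (f y)))"
    by (intro fubini_bounded_kernel integrable_iexp_mult G fc) (auto simp del: of_real_mult)
  finally show ?thesis by (simp add: ft_def mult_ac)
qed

section \<open>The Bessel inequality and mean square convergence of Fejer means\<close>

text \<open>If \<open>f\<close> is not integrable, the left side is 0 by the convention for the Bochner integral.\<close>

lemma norm_integral_le_nn_integral:
  fixes f :: "'a \<Rightarrow> 'b :: {banach, second_countable_topology}"
  shows "ennreal (norm (integral\<^sup>L M f)) \<le> (\<integral>\<^sup>+x. ennreal (norm (f x)) \<partial>M)"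
  by (cases "integrable M f") (auto simp: integral_norm_bound_ennreal not_integrable_integral_eq)

lemma normal_density_swap: "normal_density s a r = normal_density r a s"
  by (simp add: normal_density_def power2_commute)

lemma nn_integral_normal_density: "a > 0 \<Longrightarrow> (\<integral>\<^sup>+s. ennreal (normal_density r a s) \<partial>lborel) = 1"
  by (subst nn_integral_eq_integral) auto

text \<open>By \<open>gauss_inversion\<close> the damped energy is a quadratic form in \<open>H\<close> whose kernel is the normal
density. Since this kernel is symmetric with unit mass, bounding \<open>2 * \<bar>H s\<bar> * \<bar>H r\<bar>\<close> by the sum of
the squares yields the energy of \<open>H\<close>, with a constant that does not depend on the damping.\<close>

lemma damped_bessel:
  fixes H :: "real \<Rightarrow> complex"
  assumes H: "integrable lborel H" and a: "a > 0"
  shows "(\<integral>\<^sup>+x. ennreal ((cmod (fourier H x))\<^sup>2 * exp (- (a * x)\<^sup>2 / 2)) \<partial>lborel) \<le>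
      2 * pi * (\<integral>\<^sup>+t. ennreal ((cmod (H t))\<^sup>2) \<partial>lborel)"
proof -
  have [measurable]: "H \<in> borel_measurable borel" using H by auto
  define g where "g x = exp (- (a * x)\<^sup>2 / 2)" for x :: real
  have g: "integrable lborel g" unfolding g_def[abs_def] by (rule integrable_gauss[OF a])
  have [measurable]: "g \<in> borel_measurable borel" using g by auto
  define L where "L = (\<integral>t. cmod (H t) \<partial>lborel)"
  have L: "cmod (fourier H x) \<le> L" for x unfolding L_def by (rule norm_fourier_le)
  have L0: "L \<ge> 0" unfolding L_def by simp
  define c where "c x = cnj (fourier H x) * complex_of_real (g x)" for x
  have c: "integrable lborel c"
  proof (rule Bochner_Integration.integrable_bound[OF integrable_mult_right[OF g, of L]])
    show "c \<in> borel_measurable lborel" unfolding c_def[abs_def]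
      by (intro borel_measurable_times measurable_compose[OF _ borel_measurable_continuous_onI[OF
          continuous_on_cnj[OF continuous_on_id]]]) measurable
    show "AE x in lborel. norm (c x) \<le> norm (L * g x)"
      using L L0 by (auto simp: c_def norm_mult abs_mult intro!: mult_right_mono)
  qed
  have g0: "g x \<ge> 0" for x by (simp add: g_def)
  have "integrable lborel (\<lambda>x. (cmod (fourier H x))\<^sup>2 * g x)"
  proof (rule Bochner_Integration.integrable_bound[OF integrable_mult_right[OF g, of "L\<^sup>2"]])
    show "AE x in lborel. norm ((cmod (fourier H x))\<^sup>2 * g x) \<le> norm (L\<^sup>2 * g x)"
      using L by (auto simp: g0 abs_mult intro!: mult_right_mono power_mono)
  qed measurable
  then have "(\<integral>\<^sup>+x. ennreal ((cmod (fourier H x))\<^sup>2 * g x) \<partial>lborel) =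
      ennreal (\<integral>x. (cmod (fourier H x))\<^sup>2 * g x \<partial>lborel)"
    by (rule nn_integral_eq_integral) (simp add: g0)
  also have "(\<integral>x. (cmod (fourier H x))\<^sup>2 * g x \<partial>lborel) = cmod (CLINT x|lborel. c x * fourier H x)"
  proof -
    have "c x * fourier H x = complex_of_real ((cmod (fourier H x))\<^sup>2 * g x)" for x
      unfolding c_def of_real_mult complex_norm_square by (simp add: mult_ac)
    then have "(CLINT x|lborel. c x * fourier H x) = complex_of_real (\<integral>x. (cmod (fourier H x))\<^sup>2 *
        g x \<partial>lborel)"
      by (simp only: integral_complex_of_real)
    moreover have "0 \<le> (\<integral>x. (cmod (fourier H x))\<^sup>2 * g x \<partial>lborel)"
      by (simp add: g0)
    ultimately show ?thesis by simp
  qed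
  also have "(CLINT x|lborel. c x * fourier H x) = (CLINT s|lborel. H s * (CLINT x|lborel. iexp (s *
      x) * c x))"
    unfolding fourier_def by (intro fubini_bounded_kernel H c) (auto simp del: of_real_mult)
  also have "\<dots> = (CLINT s|lborel. H s * cnj (2 * pi * (CLINT r|lborel. H r * of_real (normal_density
      s a r))))"
  proof (intro Bochner_Integration.integral_cong refl arg_cong2[where f="(*)"])
    fix s
    have "(CLINT x|lborel. iexp (s * x) * c x) = (CLINT x|lborel. cnj (iexp (- (s * x)) * fourier H
        x * of_real (g x)))"
      by (intro Bochner_Integration.integral_cong refl) (simp add: c_def exp_cnj)
    also have "\<dots> = cnj (CLINT x|lborel. iexp (- (s * x)) * fourier H x * of_real (g x))"
      by (rule Bochner_Integration.integral_cnj)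
    finally show "(CLINT x|lborel. iexp (s * x) * c x) = cnj (2 * pi * (CLINT r|lborel. H r *
        of_real (normal_density s a r)))"
      unfolding g_def gauss_inversion[OF H a] by simp
  qed
  also have "ennreal (cmod \<dots>) \<le> (\<integral>\<^sup>+s. ennreal (cmod (H s * cnj (2 * pi * (CLINT r|lborel. H r *
      of_real (normal_density s a r))))) \<partial>lborel)"
    by (rule norm_integral_le_nn_integral)
  also have "\<dots> \<le> (\<integral>\<^sup>+s. (\<integral>\<^sup>+r. ennreal (pi * (cmod (H s))\<^sup>2 * normal_density s a r) +
      ennreal (pi * (cmod (H r))\<^sup>2 * normal_density r a s) \<partial>lborel) \<partial>lborel)"
  proof (intro nn_integral_mono)
    fix s
    have "ennreal (cmod (H s * cnj (2 * pi * (CLINT r|lborel. H r * of_real (normal_density s a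
        r))))) = 
       ennreal (2 * pi * cmod (H s)) * ennreal (cmod (CLINT r|lborel. H r * of_real (normal_density
           s a r)))"
      by (subst ennreal_mult'[symmetric]) (auto simp: norm_mult mult_ac)
    also have "\<dots> \<le> ennreal (2 * pi * cmod (H s)) * (\<integral>\<^sup>+r. ennreal (cmod (H r * of_real
        (normal_density s a r))) \<partial>lborel)"
      by (intro mult_left_mono norm_integral_le_nn_integral) simp
    also have "\<dots> = (\<integral>\<^sup>+r. ennreal (2 * pi * cmod (H s)) * ennreal (cmod (H r * of_real
        (normal_density s a r))) \<partial>lborel)"
      by (rule nn_integral_cmult[symmetric]) measurable
    also have "\<dots> \<le> (\<integral>\<^sup>+r. ennreal (pi * (cmod (H s))\<^sup>2 * normal_density s a r) +
        ennreal (pi * (cmod (H r))\<^sup>2 * normal_density r a s) \<partial>lborel)"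
    proof (intro nn_integral_mono)
      fix r
      have "2 * cmod (H s) * cmod (H r) \<le> (cmod (H s))\<^sup>2 + (cmod (H r))\<^sup>2"
        by (rule sum_squares_bound)
      then have "(2 * cmod (H s) * cmod (H r)) * (pi * normal_density s a r) \<le>
          ((cmod (H s))\<^sup>2 + (cmod (H r))\<^sup>2) * (pi * normal_density s a r)"
        by (intro mult_right_mono) auto
      then show "ennreal (2 * pi * cmod (H s)) * ennreal (cmod (H r * of_real (normal_density s a
          r))) \<le> ennreal (pi * (cmod (H s))\<^sup>2 * normal_density s a r) + ennreal (pi * (cmod (H r))\<^sup>2
          * normal_density r a s)"
        unfolding normal_density_swap[of r a s]
        by (subst ennreal_mult'[symmetric], simp, subst ennreal_plus[symmetric])
           (auto simp: norm_mult algebra_simps intro!: ennreal_leI simp del: ennreal_plus)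
    qed
    finally show "ennreal (cmod (H s * cnj (2 * pi * (CLINT r|lborel. H r * of_real (normal_density
        s a r))))) \<le> (\<integral>\<^sup>+r. ennreal (pi * (cmod (H s))\<^sup>2 * normal_density s a r) +
        ennreal (pi * (cmod (H r))\<^sup>2 * normal_density r a s) \<partial>lborel)" .
  qed
  also have "\<dots> = (\<integral>\<^sup>+s. (\<integral>\<^sup>+r. ennreal (pi * (cmod (H s))\<^sup>2 * normal_density s a r) \<partial>lborel)
      \<partial>lborel) + (\<integral>\<^sup>+s. (\<integral>\<^sup>+r. ennreal (pi * (cmod (H r))\<^sup>2 * normal_density r a s) \<partial>lborel) \<partial>lborel)"
    unfolding normal_density_def by (simp add: nn_integral_add)
  also have "(\<integral>\<^sup>+s. (\<integral>\<^sup>+r. ennreal (pi * (cmod (H r))\<^sup>2 * normal_density r a s) \<partial>lborel) \<partial>lborel) =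
      (\<integral>\<^sup>+r. (\<integral>\<^sup>+s. ennreal (pi * (cmod (H r))\<^sup>2 * normal_density r a s) \<partial>lborel) \<partial>lborel)"
    unfolding normal_density_def by (rule lborel_pair.Fubini') measurable
  also have "(\<integral>\<^sup>+s. (\<integral>\<^sup>+r. ennreal (pi * (cmod (H s))\<^sup>2 * normal_density s a r) \<partial>lborel) \<partial>lborel) =
      pi * (\<integral>\<^sup>+t. ennreal ((cmod (H t))\<^sup>2) \<partial>lborel)"
  proof -
    have "(\<integral>\<^sup>+r. ennreal (pi * (cmod (H s))\<^sup>2 * normal_density s a r) \<partial>lborel) =
        ennreal (pi * (cmod (H s))\<^sup>2)" for s
      by (simp add: ennreal_mult' nn_integral_cmult nn_integral_normal_density[OF a])
    then show ?thesis by (simp add: ennreal_mult' nn_integral_cmult)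
  qed
  also have "ennreal pi * (\<integral>\<^sup>+t. ennreal ((cmod (H t))\<^sup>2) \<partial>lborel) + ennreal pi * (\<integral>\<^sup>+t. ennreal
      ((cmod (H t))\<^sup>2) \<partial>lborel) = ennreal (2 * pi) * (\<integral>\<^sup>+t. ennreal ((cmod (H t))\<^sup>2) \<partial>lborel)"
    by (simp add: distrib_right[symmetric] ennreal_plus[symmetric] del: ennreal_plus)
  finally show ?thesis by (simp add: g_def)
qed

text \<open>Fatou's lemma removes the damping.\<close>

lemma bessel_fourier:
  fixes H :: "real \<Rightarrow> complex"
  assumes H: "integrable lborel H"
  shows "(\<integral>\<^sup>+x. ennreal ((cmod (fourier H x))\<^sup>2) \<partial>lborel) \<le>
      2 * pi * (\<integral>\<^sup>+t. ennreal ((cmod (H t))\<^sup>2) \<partial>lborel)"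
proof -
  have [measurable]: "H \<in> borel_measurable borel" using H by auto
  let ?G = "\<lambda>n x. ennreal ((cmod (fourier H x))\<^sup>2 * exp (- (1 / Suc n * x)\<^sup>2 / 2))"
  have lim: "(\<lambda>n. ?G n x) \<longlonglongrightarrow> ennreal ((cmod (fourier H x))\<^sup>2)" for x
  proof -
    have "(\<lambda>n. ennreal ((cmod (fourier H x))\<^sup>2 * exp (- (inverse (real (Suc n)) * x)\<^sup>2 / 2))) \<longlonglongrightarrow>
        ennreal ((cmod (fourier H x))\<^sup>2 * exp (- (0 * x)\<^sup>2 / 2))"
      by (intro tendsto_ennrealI tendsto_mult tendsto_const tendsto_exp tendsto_divide tendsto_minus
          tendsto_power LIMSEQ_inverse_real_of_nat) auto
    then show ?thesis by (simp add: inverse_eq_divide)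
  qed
  have "(\<integral>\<^sup>+x. ennreal ((cmod (fourier H x))\<^sup>2) \<partial>lborel) = (\<integral>\<^sup>+x. liminf (\<lambda>n. ?G n x) \<partial>lborel)"
    by (intro nn_integral_cong lim_imp_Liminf[symmetric] lim) auto
  also have "\<dots> \<le> liminf (\<lambda>n. \<integral>\<^sup>+x. ?G n x \<partial>lborel)"
    by (rule nn_integral_liminf) measurable
  also have "\<dots> \<le> liminf (\<lambda>n::nat. 2 * pi * (\<integral>\<^sup>+t. ennreal ((cmod (H t))\<^sup>2) \<partial>lborel))"
    by (intro Liminf_mono always_eventually allI damped_bessel[OF H] of_nat_Suc_inverse_pos)
  also have "\<dots> = 2 * pi * (\<integral>\<^sup>+t. ennreal ((cmod (H t))\<^sup>2) \<partial>lborel)"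
    by (simp add: Liminf_const)
  finally show ?thesis .
qed

lemma integral_shift: 
  fixes f :: "real \<Rightarrow> 'b :: {banach, second_countable_topology}"
  shows "(\<integral>x. f (x + y) \<partial>lborel) = integral\<^sup>L lborel f"
  using lborel_integral_real_affine[of 1 f y] by (simp add: add.commute)

lemma integrable_shift: 
  fixes f :: "real \<Rightarrow> 'b :: {banach, second_countable_topology}"
  shows "integrable lborel f \<Longrightarrow> integrable lborel (\<lambda>x. f (x + y))"
  using lborel_integrable_real_affine[of f 1 y] by (simp add: add.commute)

text \<open>For an open set the points lost by a small translation tend to the empty set pointwise.
Translation preserves the measure, so as much is gained as is lost.\<close>

lemma translation_continuous_open:
  fixes U :: "real set"
  assumes U: "open U" and fin: "emeasure lborel U < \<infinity>" and y: "y \<longlonglongrightarrow> 0"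
  shows "(\<lambda>n. \<integral>x. \<bar>indicator U (x + y n) - indicator U x\<bar> \<partial>lborel) \<longlonglongrightarrow> (0::real)"
proof -
  have [measurable]: "U \<in> sets borel" using U by auto
  have int: "integrable lborel (indicator U :: real \<Rightarrow> real)"
    using fin by (simp add: integrable_indicator_iff)
  let ?P = "\<lambda>n x. max 0 (indicator U x - indicator U (x + y n)) :: real"
  have ints: "integrable lborel (\<lambda>x. indicator U (x + y n) :: real)" for n
    by (rule integrable_shift[OF int])
  have intP: "integrable lborel (?P n)" for n
    using int ints[of n] by (intro integrable_max) auto
  have "(\<lambda>n. integral\<^sup>L lborel (?P n)) \<longlonglongrightarrow> (\<integral>x. 0 \<partial>(lborel :: real measure))"
  proof (rule integral_dominated_convergence[where w="indicator U :: real \<Rightarrow> real"])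
    show "AE x in lborel. (\<lambda>n. ?P n x) \<longlonglongrightarrow> 0"
    proof (rule AE_I2)
      fix x
      show "(\<lambda>n. ?P n x) \<longlonglongrightarrow> 0"
      proof (cases "x \<in> U")
        case True
        have "(\<lambda>n. x + y n) \<longlonglongrightarrow> x" using tendsto_add[OF tendsto_const y, of x] by simp
        then have "eventually (\<lambda>n. x + y n \<in> U) sequentially" using U True by (rule
            topological_tendstoD)
        then have "eventually (\<lambda>n. ?P n x = 0) sequentially" by eventually_elim (simp add: True)
        then show ?thesis by (rule tendsto_eventually)
      next
        case False
        then have "?P n x = 0" for n by (simp add: indicator_def)
        then show ?thesis by simp
      qed
    qed
    show "AE x in lborel. norm (?P n x) \<le> indicator U x" for n
      by (auto simp: indicator_def)
  qed (use int in auto)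
  then have "(\<lambda>n. 2 * integral\<^sup>L lborel (?P n)) \<longlonglongrightarrow> 2 * 0" by (intro tendsto_mult) auto
  moreover have "(\<integral>x. \<bar>indicator U (x + y n) - indicator U x\<bar> \<partial>lborel) =
      2 * integral\<^sup>L lborel (?P n)" for n
  proof -
    have "(\<integral>x. \<bar>indicator U (x + y n) - indicator U x :: real\<bar> \<partial>lborel) =
        (\<integral>x. 2 * ?P n x + (indicator U (x + y n) - indicator U x) \<partial>lborel)"
      by (intro Bochner_Integration.integral_cong) (auto simp: indicator_def)
    also have "\<dots> = 2 * integral\<^sup>L lborel (?P n) + ((\<integral>x. indicator U (x +
        y n) \<partial>lborel) - (\<integral>x. indicator U x \<partial>lborel))"
      using int ints[of n] intP[of n] by simp
    also have "(\<integral>x. indicator U (x + y n) \<partial>lborel) = (\<integral>x. indicator U x \<partial>lborel :: real)"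
      by (rule integral_shift)
    finally show ?thesis by simp
  qed
  ultimately show ?thesis by simp
qed

lemma translation_diff_triangle:
  fixes f g :: "real \<Rightarrow> real"
  assumes f: "integrable lborel f" and g: "integrable lborel g"
  shows "(\<integral>x. \<bar>f (x + y) - f x\<bar> \<partial>lborel) \<le> (\<integral>x. \<bar>g (x + y) - g x\<bar> \<partial>lborel) +
      2 * (\<integral>x. \<bar>f x - g x\<bar> \<partial>lborel)"
proof -
  have fg: "integrable lborel (\<lambda>x. \<bar>f x - g x\<bar>)" using f g by auto
  note s = integrable_shift[OF f] integrable_shift[OF g] integrable_shift[OF fg]
  have "(\<integral>x. \<bar>f (x + y) - f x\<bar> \<partial>lborel) \<le> (\<integral>x. \<bar>g (x + y) - g x\<bar> + \<bar>f (x + y) - g (x + y)\<bar> +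
      \<bar>f x - g x\<bar> \<partial>lborel)"
    using s f g fg by (intro integral_mono) auto
  also have "\<dots> = (\<integral>x. \<bar>g (x + y) - g x\<bar> \<partial>lborel) + (\<integral>x. \<bar>f (x + y) - g (x + y)\<bar> \<partial>lborel) +
      (\<integral>x. \<bar>f x - g x\<bar> \<partial>lborel)"
    using s f g fg by simp
  also have "(\<integral>x. \<bar>f (x + y) - g (x + y)\<bar> \<partial>lborel) = (\<integral>x. \<bar>f x - g x\<bar> \<partial>lborel)"
    by (rule integral_shift)
  finally show ?thesis by simp
qed

lemma translation_continuous_approx:
  fixes f :: "real \<Rightarrow> real"
  assumes f: "integrable lborel f"
    and "\<And>e. e > 0 \<Longrightarrow> \<exists>g. integrable lborel g \<and> (\<integral>x. \<bar>f x - g x\<bar> \<partial>lborel) < e \<and> 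
       (\<lambda>n. \<integral>x. \<bar>g (x + y n) - g x\<bar> \<partial>lborel) \<longlonglongrightarrow> 0"
  shows "(\<lambda>n. \<integral>x. \<bar>f (x + y n) - f x\<bar> \<partial>lborel) \<longlonglongrightarrow> 0"
proof (rule tendstoI)
  fix e :: real assume "e > 0"
  then obtain g where g: "integrable lborel g" "(\<integral>x. \<bar>f x - g x\<bar> \<partial>lborel) < e / 4"
       "(\<lambda>n. \<integral>x. \<bar>g (x + y n) - g x\<bar> \<partial>lborel) \<longlonglongrightarrow> 0" using assms(2)[of "e/4"] by auto
  from tendstoD[OF g(3), of "e/2"] \<open>e > 0\<close>
  have "eventually (\<lambda>n. (\<integral>x. \<bar>g (x + y n) - g x\<bar> \<partial>lborel) <
      e/2) sequentially" by (simp add: dist_real_def)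
  then show "eventually (\<lambda>n. dist (\<integral>x. \<bar>f (x + y n) - f x\<bar> \<partial>lborel) 0 < e) sequentially"
  proof eventually_elim
    case (elim n)
    then show ?case using translation_diff_triangle[OF f g(1), of "y n"] g(2) by (simp add:
        dist_real_def)
  qed
qed

text \<open>Translation is continuous in \<open>L\<^sup>1\<close>: open sets are dealt with above, Borel sets of finite
measure are reached by outer regularity, and integrable functions by approximation.\<close>

lemma translation_continuous_L1:
  fixes f :: "real \<Rightarrow> real"
  assumes "integrable lborel f" and y: "y \<longlonglongrightarrow> 0"
  shows "(\<lambda>n. \<integral>x. \<bar>f (x + y n) - f x\<bar> \<partial>lborel) \<longlonglongrightarrow> 0"
  using assms(1)
proof (induction f rule: integrable_induct)
  case (base A c)
  then have [measurable]: "A \<in> sets borel" by simp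
  have A: "integrable lborel (indicator A :: real \<Rightarrow> real)"
    using base by (simp add: integrable_indicator_iff)
  have "(\<lambda>n. \<integral>x. \<bar>indicator A (x + y n) - indicator A x :: real\<bar> \<partial>lborel) \<longlonglongrightarrow> 0"
  proof (rule translation_continuous_approx[OF A])
    fix e :: real assume e: "e > 0"
    obtain U where U: "open U" "A \<subseteq> U" "emeasure lborel (U - A) < ennreal e"
      using outer_regular_lborel[OF \<open>A \<in> sets borel\<close> e] by blast
    have [measurable]: "U \<in> sets borel" using U by auto
    have "emeasure lborel U = emeasure lborel A + emeasure lborel (U - A)"
      using U by (subst plus_emeasure) (auto intro!: arg_cong2[where f=emeasure])
    also have "\<dots> < \<infinity>" using base U(3) by (simp add: less_top[symmetric]) (metis ennreal_less_top
        less_trans neq_iff)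
    finally have fin: "emeasure lborel U < \<infinity>" .
    have "(\<integral>x. \<bar>indicator A x - indicator U x :: real\<bar> \<partial>lborel) = (\<integral>x. indicator (U - A) x \<partial>lborel)"
      using U(2) by (intro Bochner_Integration.integral_cong) (auto simp: indicator_def)
    also have "\<dots> = measure lborel (U - A)" by simp
    also have "\<dots> < e" using U(3) e less_trans[OF U(3) ennreal_less_top] by (subst (asm)
        emeasure_eq_ennreal_measure) (auto simp: ennreal_less_iff less_top[symmetric])
    finally show "\<exists>g. integrable lborel g \<and> (\<integral>x. \<bar>indicator A x - g x\<bar> \<partial>lborel) <
        e \<and> (\<lambda>n. \<integral>x. \<bar>g (x + y n) - g x\<bar> \<partial>lborel) \<longlonglongrightarrow> 0"
      using translation_continuous_open[OF U(1) fin y] fin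
      by (intro exI[of _ "indicator U :: real \<Rightarrow> real"]) (auto simp: integrable_indicator_iff)
  qed
  then have "(\<lambda>n. (\<integral>x. \<bar>indicator A (x + y n) - indicator A x :: real\<bar> \<partial>lborel) * \<bar>c\<bar>) \<longlonglongrightarrow> 0 * \<bar>c\<bar>"
    by (intro tendsto_mult tendsto_const)
  moreover have "(\<integral>x. \<bar>indicator A (x + z) *\<^sub>R c - indicator A x *\<^sub>R c\<bar> \<partial>lborel) =
      (\<integral>x. \<bar>indicator A (x + z) - indicator A x :: real\<bar> \<partial>lborel) * \<bar>c\<bar>" for z
    by (simp add: left_diff_distrib[symmetric] abs_mult)
  ultimately show ?case by simp
next
  case (add f g)
  show ?case
  proof (rule Lim_null_comparison[OF _ tendsto_add_zero[OF add.IH]])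
    show "eventually (\<lambda>n. norm (\<integral>x. \<bar>f (x + y n) + g (x + y n) - (f x + g x)\<bar> \<partial>lborel) \<le>
        (\<integral>x. \<bar>f (x + y n) - f x\<bar> \<partial>lborel) + (\<integral>x. \<bar>g (x + y n) - g x\<bar> \<partial>lborel)) sequentially"
    proof (rule always_eventually, rule allI)
      fix n
      note s = integrable_shift[OF add.hyps(1)] integrable_shift[OF add.hyps(2)]
      have "(\<integral>x. \<bar>f (x + y n) + g (x + y n) - (f x + g x)\<bar> \<partial>lborel) \<le> (\<integral>x. \<bar>f (x + y n) - f x\<bar> +
          \<bar>g (x + y n) - g x\<bar> \<partial>lborel)"
        using s add.hyps by (intro integral_mono) auto
      also have "\<dots> = (\<integral>x. \<bar>f (x + y n) - f x\<bar> \<partial>lborel) + (\<integral>x. \<bar>g (x + y n) - g x\<bar> \<partial>lborel)"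
        using s add.hyps by simp
      finally show "norm (\<integral>x. \<bar>f (x + y n) + g (x + y n) - (f x + g x)\<bar> \<partial>lborel) \<le>
          (\<integral>x. \<bar>f (x + y n) - f x\<bar> \<partial>lborel) + (\<integral>x. \<bar>g (x + y n) - g x\<bar> \<partial>lborel)"
        by simp
    qed
  qed
next
  case (lim f s)
  have [measurable]: "f \<in> borel_measurable borel" "\<And>i. s i \<in> borel_measurable borel" using lim by auto
  have "(\<lambda>i. \<integral>x. \<bar>f x - s i x\<bar> \<partial>lborel) \<longlonglongrightarrow> (\<integral>x. 0 \<partial>(lborel :: real measure))"
  proof (rule integral_dominated_convergence[where w="\<lambda>x. 3 * \<bar>f x\<bar>"])
    show "AE x in lborel. (\<lambda>i. \<bar>f x - s i x\<bar>) \<longlonglongrightarrow> 0"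
    proof (rule AE_I2)
      fix x
      have "(\<lambda>i. \<bar>f x - s i x\<bar>) \<longlonglongrightarrow> \<bar>f x - f x\<bar>"
        by (intro tendsto_rabs tendsto_diff tendsto_const lim.hyps(2)) simp
      then show "(\<lambda>i. \<bar>f x - s i x\<bar>) \<longlonglongrightarrow> 0" by simp
    qed
    show "AE x in lborel. norm \<bar>f x - s i x\<bar> \<le> 3 * \<bar>f x\<bar>" for i
    proof (rule AE_I2)
      fix x
      show "norm \<bar>f x - s i x\<bar> \<le> 3 * \<bar>f x\<bar>" using lim.hyps(3)[of x i] by simp
    qed
  qed (use lim.hyps in auto)
  then have A: "(\<lambda>i. \<integral>x. \<bar>f x - s i x\<bar> \<partial>lborel) \<longlonglongrightarrow> 0" by simp
  show ?case
  proof (rule translation_continuous_approx[OF lim.hyps(4)])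
    fix e :: real assume "e > 0"
    from tendstoD[OF A this] obtain i where "(\<integral>x. \<bar>f x - s i x\<bar> \<partial>lborel) < e"
      by (auto simp: dist_real_def eventually_sequentially)
    then show "\<exists>g. integrable lborel g \<and> (\<integral>x. \<bar>f x - g x\<bar> \<partial>lborel) < e \<and> (\<lambda>n. \<integral>x. \<bar>g (x +
        y n) - g x\<bar> \<partial>lborel) \<longlonglongrightarrow> 0"
      using lim.hyps(1) lim.IH by blast
  qed
qed


text \<open>The convolution of \<open>f\<close> with the Fejer kernel rescaled to bandwidth \<open>w\<close>, which is the
expectation of the estimator. In the variable \<open>z\<close> the mass of the kernel stays fixed and the shift
of \<open>f\<close> tends to 0.\<close>

definition fejer_mean :: "(real \<Rightarrow> real) \<Rightarrow> real \<Rightarrow> real \<Rightarrow> real" where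
  "fejer_mean f w x = (\<integral>z. f (x + z / w) * fejer z \<partial>lborel)"

lemma nn_jensen_square:
  fixes g k :: "real \<Rightarrow> real"
  assumes k: "pdf k" and g: "integrable lborel (\<lambda>z. g z * k z)" and [measurable]: "g \<in>
      borel_measurable borel"
  shows "ennreal ((\<integral>z. g z * k z \<partial>lborel)\<^sup>2) \<le> (\<integral>\<^sup>+z. ennreal (k z * (g z)\<^sup>2) \<partial>lborel)"
proof -
  have [measurable]: "k \<in> borel_measurable borel" and k0: "\<And>z. k z \<ge> 0" using k by (auto simp: pdf_def)
  have "ennreal ((\<integral>z. g z * k z \<partial>lborel)\<^sup>2) = (ennreal (norm (\<integral>z. g z * k z \<partial>lborel)))\<^sup>2"
    by (simp add: ennreal_power)
  also have "\<dots> \<le> (\<integral>\<^sup>+z. ennreal (norm (g z * k z)) \<partial>lborel)\<^sup>2"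
    by (intro power_mono norm_integral_le_nn_integral) simp
  also have "(\<integral>\<^sup>+z. ennreal (norm (g z * k z)) \<partial>lborel) = (\<integral>\<^sup>+z. ennreal (\<bar>g z\<bar> * sqrt (k z)) *
      ennreal (sqrt (k z)) \<partial>lborel)"
    by (intro nn_integral_cong) (simp add: ennreal_mult'[symmetric] k0 abs_mult mult.assoc)
  also have "\<dots>\<^sup>2 \<le> (\<integral>\<^sup>+z. (ennreal (\<bar>g z\<bar> * sqrt (k z)))\<^sup>2 \<partial>lborel) * (\<integral>\<^sup>+z. (ennreal (sqrt (k
      z)))\<^sup>2 \<partial>lborel)"
    by (rule Cauchy_Schwarz_nn_integral) measurable
  also have "(\<integral>\<^sup>+z. (ennreal (sqrt (k z)))\<^sup>2 \<partial>lborel) = 1"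
    using k by (simp add: ennreal_power k0 pdf_def)
  also have "(\<integral>\<^sup>+z. (ennreal (\<bar>g z\<bar> * sqrt (k z)))\<^sup>2 \<partial>lborel) = (\<integral>\<^sup>+z. ennreal (k z * (g z)\<^sup>2) \<partial>lborel)"
    by (simp add: ennreal_power k0 power_mult_distrib mult.commute)
  finally show ?thesis by simp
qed

lemma fejer_mean_fourier:
  assumes f: "pdf f" and w: "w > 0"
  shows "complex_of_real (fejer_mean f w x) = of_real (1 / (2 * pi)) * (CLINT t|lborel. iexp (- (t *
      x)) * of_real (tri (t / w)) * ft f t)"
proof -
  have G: "integrable lborel (\<lambda>t. complex_of_real (tri (t / w)))"
    using lborel_integrable_real_affine[OF integrable_tri, of "1/w" 0] w by simp
  have Gf: "fourier (\<lambda>t. complex_of_real (tri (t / w))) u =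
      of_real (w * (2 * pi * fejer (w * u)))" for u
  proof -
    have "fourier (\<lambda>t. complex_of_real (tri (t / w))) u = w *\<^sub>R (CLINT t|lborel. iexp (t * (w *
        u)) * complex_of_real (tri t))"
      unfolding fourier_def using w lborel_integral_real_affine[of w "\<lambda>t. iexp (t * u) *
          complex_of_real (tri (t / w))" 0]
      by (simp add: mult_ac)
    then show ?thesis using fourier_tri[of "w * u"] w by (simp add: fourier_def scaleR_conv_of_real)
  qed
  have "(CLINT t|lborel. iexp (- (t * x)) * of_real (tri (t / w)) * ft f t) =
      (CLINT y|lborel. of_real (f y) * of_real (w * (2 * pi * fejer (w * (y - x)))))"
    unfolding convolution_inverse_fourier[OF f G, symmetric] Gf ..
  also have "\<dots> = (CLINT y|lborel. of_real (2 * pi * w * (f y * fejer (w * (y - x)))))"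
    by (intro Bochner_Integration.integral_cong refl) simp
  also have "\<dots> = of_real (2 * pi * w * (\<integral>y. f y * fejer (w * (y - x)) \<partial>lborel))"
    by (simp only: integral_complex_of_real integral_mult_right_zero)
  also have "(\<integral>y. f y * fejer (w * (y - x)) \<partial>lborel) = (1 / w) * (\<integral>z. f (x + z / w) * fejer z \<partial>lborel)"
    using w lborel_integral_real_affine[of "1/w" "\<lambda>y. f y * fejer (w * (y - x))" x] by simp
  finally show ?thesis using w by (simp add: fejer_mean_def)
qed

text \<open>By Jensen's inequality the squared error is at most the average over \<open>z\<close> of the squared
distance between \<open>f\<close> and its translate by \<open>z / w\<close>. For nonnegative reals \<open>(a - b)\<^sup>2 \<le> \<bar>a\<^sup>2 -
b\<^sup>2\<bar>\<close>, so continuity of translation in \<open>L\<^sup>1\<close>, applied to \<open>f\<^sup>2\<close>, suffices.\<close>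

lemma fejer_mean_L2:
  assumes f: "pdf f" and f2: "square_integrable f" and w: "filterlim w at_top sequentially"
  shows "(\<lambda>n. \<integral>\<^sup>+x. ennreal ((fejer_mean f (w n) x - f x)\<^sup>2) \<partial>lborel) \<longlonglongrightarrow> 0"
proof -
  have [measurable]: "f \<in> borel_measurable borel" and f0: "\<And>x. f x \<ge> 0" using f by (auto simp: pdf_def)
  have fi: "integrable lborel f" by (rule pdf_integrable[OF f])
  have f2i: "integrable lborel (\<lambda>x. (f x)\<^sup>2)" using f2 by (simp add: square_integrable_def)
  define D where "D y = (\<integral>x. \<bar>(f (x + y))\<^sup>2 - (f x)\<^sup>2\<bar> \<partial>lborel)" for y
  have [measurable]: "D \<in> borel_measurable borel" unfolding D_def[abs_def] by measurable
  have iD: "integrable lborel (\<lambda>x. \<bar>(f (x + y))\<^sup>2 - (f x)\<^sup>2\<bar>)" for y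
    using integrable_shift[OF f2i] f2i by auto
  have D0: "D y \<ge> 0" for y by (simp add: D_def)
  have Dle: "D y \<le> 2 * (\<integral>x. (f x)\<^sup>2 \<partial>lborel)" for y
  proof -
    have "D y \<le> (\<integral>x. (f (x + y))\<^sup>2 + (f x)\<^sup>2 \<partial>lborel)" unfolding D_def
      using integrable_shift[OF f2i, of y] f2i iD[of y] by (intro integral_mono) (auto simp: abs_le_iff)
    also have "\<dots> = (\<integral>x. (f (x + y))\<^sup>2 \<partial>lborel) + (\<integral>x. (f x)\<^sup>2 \<partial>lborel)"
      using integrable_shift[OF f2i, of y] f2i by simp
    also have "(\<integral>x. (f (x + y))\<^sup>2 \<partial>lborel) = (\<integral>x. (f x)\<^sup>2 \<partial>lborel)"
      by (rule integral_shift)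
    finally show ?thesis by simp
  qed
  have bound: "(\<integral>\<^sup>+x. ennreal ((fejer_mean f v x - f x)\<^sup>2) \<partial>lborel) \<le>
      ennreal (\<integral>z. fejer z * D (z / v) \<partial>lborel)" if v: "v > 0" for v
  proof -
    have i1: "integrable lborel (\<lambda>z. f (x + z / v) * fejer z)" for x
    proof (rule Bochner_Integration.integrable_bound)
      show "integrable lborel (\<lambda>z. f (x + z / v) * (1 / (2 * pi)))"
        using lborel_integrable_real_affine[OF fi, of "1 / v" x] v by simp
      show "AE z in lborel. norm (f (x + z / v) * fejer z) \<le> norm (f (x + z / v) * (1 / (2 * pi)))"
        unfolding real_norm_def abs_mult using fejer_le by (intro AE_I2 mult_left_mono) (auto simp:
            fejer_nonneg f0)
    qed measurable
    have i2: "integrable lborel (\<lambda>z. (f (x + z / v) - f x) * fejer z)" for x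
      using i1[of x] integrable_fejer by (simp add: left_diff_distrib)
    have "fejer_mean f v x - f x = (\<integral>z. (f (x + z / v) - f x) * fejer z \<partial>lborel)" for x
      using i1[of x] integrable_fejer by (simp add: left_diff_distrib fejer_mean_def integral_fejer)
    then have "(\<integral>\<^sup>+x. ennreal ((fejer_mean f v x - f x)\<^sup>2) \<partial>lborel) \<le>
        (\<integral>\<^sup>+x. (\<integral>\<^sup>+z. ennreal (fejer z * (f (x + z / v) - f x)\<^sup>2) \<partial>lborel) \<partial>lborel)"
      by (intro nn_integral_mono) (auto intro!: nn_jensen_square pdf_fejer i2)
    also have "\<dots> = (\<integral>\<^sup>+z. (\<integral>\<^sup>+x. ennreal (fejer z * (f (x + z / v) - f x)\<^sup>2) \<partial>lborel) \<partial>lborel)"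
      by (rule lborel_pair.Fubini') measurable
    also have "\<dots> \<le> (\<integral>\<^sup>+z. ennreal (fejer z * D (z / v)) \<partial>lborel)"
    proof (intro nn_integral_mono)
      fix z
      have "(\<integral>\<^sup>+x. ennreal (fejer z * (f (x + z / v) - f x)\<^sup>2) \<partial>lborel) \<le>
          (\<integral>\<^sup>+x. ennreal (fejer z * \<bar>(f (x + z / v))\<^sup>2 - (f x)\<^sup>2\<bar>) \<partial>lborel)"
      proof (intro nn_integral_mono ennreal_leI mult_left_mono fejer_nonneg)
        fix x
        have "(a - b)\<^sup>2 \<le> \<bar>a\<^sup>2 - b\<^sup>2\<bar>" if "a \<ge> 0" "b \<ge> 0" for a b :: real
        proof -
          have "(a - b)\<^sup>2 = \<bar>a - b\<bar> * \<bar>a - b\<bar>" by (simp add: power2_eq_square flip: abs_mult)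
          also have "\<dots> \<le> \<bar>a - b\<bar> * (a + b)" using that by (intro mult_left_mono) auto
          also have "\<dots> = \<bar>(a - b) * (a + b)\<bar>" using that by (simp add: abs_mult)
          also have "(a - b) * (a + b) = a\<^sup>2 - b\<^sup>2" by (simp add: algebra_simps power2_eq_square)
          finally show ?thesis .
        qed
        then show "(f (x + z / v) - f x)\<^sup>2 \<le> \<bar>(f (x + z / v))\<^sup>2 - (f x)\<^sup>2\<bar>" using f0 by auto
      qed
      also have "\<dots> = ennreal (fejer z * D (z / v))"
        unfolding D_def by (subst nn_integral_eq_integral) (use iD[of "z/v"] in \<open>auto simp:
            fejer_nonneg\<close>)
      finally show "(\<integral>\<^sup>+x. ennreal (fejer z * (f (x + z / v) - f x)\<^sup>2) \<partial>lborel) \<le>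
          ennreal (fejer z * D (z / v))" .
    qed
    also have "\<dots> = ennreal (\<integral>z. fejer z * D (z / v) \<partial>lborel)"
    proof (rule nn_integral_eq_integral)
      show "integrable lborel (\<lambda>z. fejer z * D (z / v))"
      proof (rule Bochner_Integration.integrable_bound)
        show "integrable lborel (\<lambda>z. fejer z * (2 * (\<integral>x. (f x)\<^sup>2 \<partial>lborel)))" using integrable_fejer
            by auto
        show "AE z in lborel. norm (fejer z * D (z / v)) \<le> norm (fejer z * (2 * (\<integral>x. (f x)\<^sup>2 \<partial>lborel)))"
          unfolding real_norm_def abs_mult[of "fejer _"] using Dle D0 order_trans[OF D0 Dle]
          by (intro AE_I2 mult_left_mono) (auto simp: abs_le_iff)
      qed measurable
    qed (simp add: fejer_nonneg D0)
    finally show ?thesis .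
  qed
  have "(\<lambda>n. \<integral>z. fejer z * D (z / w n) \<partial>lborel) \<longlonglongrightarrow> (\<integral>z. 0 \<partial>(lborel :: real measure))"
  proof (rule integral_dominated_convergence[where w="\<lambda>z. fejer z * (2 * (\<integral>x. (f x)\<^sup>2 \<partial>lborel))"])
    show "integrable lborel (\<lambda>z. fejer z * (2 * (\<integral>x. (f x)\<^sup>2 \<partial>lborel)))" using integrable_fejer by auto
    show "AE z in lborel. (\<lambda>n. fejer z * D (z / w n)) \<longlonglongrightarrow> 0"
    proof (rule AE_I2)
      fix z
      have "(\<lambda>n. z / w n) \<longlonglongrightarrow> 0"
        by (rule tendsto_divide_0[OF tendsto_const filterlim_at_top_imp_at_infinity[OF w]])
      from translation_continuous_L1[OF f2i this] have "(\<lambda>n. D (z / w n)) \<longlonglongrightarrow> 0" by (simp add: D_def)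
      then show "(\<lambda>n. fejer z * D (z / w n)) \<longlonglongrightarrow> 0" by (rule tendsto_mult_right_zero)
    qed
    show "AE z in lborel. norm (fejer z * D (z / w n)) \<le> fejer z * (2 * (\<integral>x. (f x)\<^sup>2 \<partial>lborel))" for n
      by (intro AE_I2) (simp add: abs_mult fejer_nonneg D0 Dle mult_left_mono)
  qed auto
  then have "(\<lambda>n. \<integral>z. fejer z * D (z / w n) \<partial>lborel) \<longlonglongrightarrow> 0" by simp
  then have lim: "(\<lambda>n. ennreal (\<integral>z. fejer z * D (z / w n) \<partial>lborel)) \<longlonglongrightarrow> 0"
    using tendsto_ennrealI by fastforce
  have "eventually (\<lambda>n. w n > 0) sequentially"
    using w by (auto simp: filterlim_at_top_dense)
  then have "eventually (\<lambda>n. (\<integral>\<^sup>+x. ennreal ((fejer_mean f (w n) x - f x)\<^sup>2) \<partial>lborel) \<le>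
      ennreal (\<integral>z. fejer z * D (z / w n) \<partial>lborel)) sequentially"
    by eventually_elim (rule bound)
  then show ?thesis
    by (intro tendsto_sandwich[OF _ _ tendsto_const lim]) auto
qed

section \<open>The law of the data and the risk of the kernel estimator\<close>

definition obs_law :: "(real \<Rightarrow> real) \<Rightarrow> (real \<Rightarrow> real) \<Rightarrow> real measure" where
  "obs_law f g = distr (density lborel (\<lambda>x. ennreal (f x)) \<Otimes>\<^sub>M density lborel (\<lambda>x. ennreal (g x)))
      borel (\<lambda>p. fst p + snd p)"

lemma prob_space_pdf: "pdf f \<Longrightarrow> prob_space (density lborel (\<lambda>x. ennreal (f x)))"
  by (auto intro!: prob_spaceI simp: pdf_def emeasure_density cong: nn_integral_cong)

lemma prob_space_pdf_pair:
  assumes "pdf f" "pdf g"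
  shows "prob_space (density lborel (\<lambda>x. ennreal (f x)) \<Otimes>\<^sub>M density lborel (\<lambda>x. ennreal (g x)))"
proof -
  interpret F: prob_space "density lborel (\<lambda>x. ennreal (f x))" by (rule prob_space_pdf) fact
  interpret G: prob_space "density lborel (\<lambda>x. ennreal (g x))" by (rule prob_space_pdf) fact
  interpret P: pair_prob_space "density lborel (\<lambda>x. ennreal (f x))" "density lborel (\<lambda>x. ennreal (g
      x))" ..
  show ?thesis by (rule P.P.prob_space_axioms)
qed

lemma add_pair_measurable [measurable]:
  "(\<lambda>p. fst p + snd p) \<in> borel_measurable (density lborel (f :: real \<Rightarrow> ennreal) \<Otimes>\<^sub>M density lborel g)"
proof -
  have "sets (density lborel f \<Otimes>\<^sub>M density lborel g) = sets (borel \<Otimes>\<^sub>M borel)"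
    by (intro sets_pair_measure_cong) auto
  then show ?thesis by (subst measurable_cong_sets[OF _ refl]) auto
qed

lemma prob_space_obs_law: "pdf f \<Longrightarrow> pdf g \<Longrightarrow> prob_space (obs_law f g)"
  unfolding obs_law_def by (rule prob_space.prob_space_distr[OF prob_space_pdf_pair]) auto

lemma sets_obs_law [simp, measurable_cong]: "sets (obs_law f g) = sets borel"
  by (simp add: obs_law_def)

lemma data_law_eq_PiM:
  assumes f: "pdf f" and fe: "\<And>j. j \<in> {1..n} \<Longrightarrow> pdf (fe j)"
  shows "data_law n f fe = (\<Pi>\<^sub>M j\<in>{1..n}. obs_law f (fe j))"
proof -
  let ?M = "\<lambda>j. density lborel (\<lambda>x. ennreal (f x)) \<Otimes>\<^sub>M density lborel (\<lambda>x. ennreal (fe j x))"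
  let ?B = "\<lambda>j::nat. return borel (0::real)"
  have "data_law n f fe = distr (PiM {1..n} ?M) (PiM {1..n} ?B) (compose {1..n} (\<lambda>p. fst p + snd p))"
    unfolding data_law_def by (intro distr_cong sets_PiM_cong) (auto simp: compose_def)
  also have "\<dots> = PiM {1..n} (\<lambda>j. distr (?M j) (?B j) (\<lambda>p. fst p + snd p))"
    by (intro distr_PiM_finite_prob_space') (auto intro!: prob_space_pdf_pair f fe prob_space_return)
  also have "\<dots> = (\<Pi>\<^sub>M j\<in>{1..n}. obs_law f (fe j))"
    unfolding obs_law_def by (intro PiM_cong distr_cong) auto
  finally show ?thesis .
qed

lemma obs_law_density:
  assumes f: "pdf f" and g: "pdf g"
  shows "obs_law f g = density lborel (\<lambda>x. \<integral>\<^sup>+y. ennreal (f (x - y)) * ennreal (g y) \<partial>lborel)"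
proof -
  have "obs_law f g = convolution (density lborel (\<lambda>x. ennreal (f x))) (density lborel (\<lambda>x. ennreal
      (g x)))"
    by (simp add: obs_law_def convolution_def case_prod_unfold)
  also have "\<dots> = density lborel (\<lambda>x. \<integral>\<^sup>+y. ennreal (f (x - y)) * ennreal (g y) \<partial>lborel)"
    using prob_space_pdf[OF f] prob_space_pdf[OF g] pdf_measurable[OF f] pdf_measurable[OF g]
    by (intro convolution_density) (auto intro: prob_space.finite_measure)
  finally show ?thesis .
qed

lemma integral_iexp_pdf: 
  assumes "pdf g" 
  shows "(CLINT y|density lborel (\<lambda>x. ennreal (g x)). iexp (t * y)) = ft g t"
  unfolding ft_def using pdf_measurable[OF assms] pdf_nonneg[OF assms]
  by (subst integral_density) (auto simp: scaleR_conv_of_real mult.commute)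

lemma char_obs_law:
  assumes f: "pdf f" and g: "pdf g"
  shows "(CLINT y|obs_law f g. iexp (t * y)) = ft f t * ft g t"
proof -
  interpret F: prob_space "density lborel (\<lambda>x. ennreal (f x))" by (rule prob_space_pdf) fact
  interpret G: prob_space "density lborel (\<lambda>x. ennreal (g x))" by (rule prob_space_pdf) fact
  interpret P: pair_prob_space "density lborel (\<lambda>x. ennreal (f x))" "density lborel (\<lambda>x. ennreal (g
      x))" ..
  have int: "integrable (density lborel (\<lambda>x. ennreal (f x)) \<Otimes>\<^sub>M density lborel (\<lambda>x. ennreal (g x)))
      (\<lambda>(x, y). iexp (t * (x + y)))"
  proof (rule P.P.integrable_const_bound[where B=1])
    have "(\<lambda>p. iexp (t * (fst p + snd p))) \<in> borel_measurable (density lborel (\<lambda>x. ennreal (f x))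
        \<Otimes>\<^sub>M density lborel (\<lambda>x. ennreal (g x)))"
      by (intro measurable_iexp borel_measurable_times borel_measurable_const add_pair_measurable)
    then show "(\<lambda>(x, y). iexp (t * (x + y))) \<in> borel_measurable (density lborel (\<lambda>x. ennreal (f x))
        \<Otimes>\<^sub>M density lborel (\<lambda>x. ennreal (g x)))"
      by (simp only: case_prod_unfold)
  qed (auto simp del: of_real_mult of_real_add)
  have "(CLINT y|obs_law f g. iexp (t * y)) = (CLINT p|density lborel (\<lambda>x. ennreal (f x)) \<Otimes>\<^sub>M
      density lborel (\<lambda>x. ennreal (g x)). (case p of (x, y) \<Rightarrow> iexp (t * (x + y))))"
    unfolding obs_law_def by (subst integral_distr) (auto simp: case_prod_unfold)
  also have "\<dots> = (CLINT x|density lborel (\<lambda>x. ennreal (f x)). CLINT y|density lborel (\<lambda>x. ennreal (g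
      x)). iexp (t * (x + y)))"
    by (rule P.integral_fst[OF int, symmetric])
  also have "\<dots> = (CLINT x|density lborel (\<lambda>x. ennreal (f x)). iexp (t * x) * (CLINT y|density lborel
      (\<lambda>x. ennreal (g x)). iexp (t * y)))"
    by (simp add: distrib_left exp_add)
  also have "\<dots> = ft f t * ft g t"
    using f g by (simp only: integral_mult_left_zero integral_iexp_pdf)
  finally show ?thesis .
qed

lemma ft_minus: "ft g (- t) = cnj (ft g t)"
proof -
  have "ft g (- t) = (CLINT x|lborel. cnj (iexp (t * x) * complex_of_real (g x)))"
    unfolding ft_def by (intro Bochner_Integration.integral_cong refl) (simp add: exp_cnj)
  then show ?thesis unfolding ft_def by (simp only: Bochner_Integration.integral_cnj)
qed

text \<open>Expanding the square, the mixed terms vanish because centred factors are integrated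
separately. Each diagonal term is bounded crudely by the squared sup norm.\<close>

lemma second_moment_independent_sum:
  fixes Z :: "'i \<Rightarrow> real \<Rightarrow> complex"
  assumes I: "finite I" and M: "\<And>i. i \<in> I \<Longrightarrow> prob_space (M i)"
    and [simp]: "\<And>i. i \<in> I \<Longrightarrow> sets (M i) = sets borel"
    and Zm: "\<And>i. i \<in> I \<Longrightarrow> Z i \<in> borel_measurable borel"
    and Zb: "\<And>i y. i \<in> I \<Longrightarrow> cmod (Z i y) \<le> b i"
    and Z0: "\<And>i. i \<in> I \<Longrightarrow> (CLINT y|M i. Z i y) = 0"
  shows "(\<integral>\<^sup>+y. ennreal ((cmod (\<Sum>i\<in>I. Z i (y i)))\<^sup>2) \<partial>PiM I M) \<le> ennreal (\<Sum>i\<in>I. (b i)\<^sup>2)"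
proof -
  \<comment> \<open>Outside \<open>I\<close> the family \<open>M\<close> is unconstrained, while the product locales quantify over all
    indices.\<close>
  define N where "N i = (if i \<in> I then M i else return borel 0)" for i
  have PN: "prob_space (N i)" for i unfolding N_def using M by (auto intro: prob_space_return)
  note bounded_integrable = finite_measure.integrable_const_bound[OF prob_space.finite_measure[OF PN]]
  have sN: "sets (N i) = sets borel" for i unfolding N_def by auto
  interpret product_prob_space N by (rule product_prob_spaceI) (rule PN)
  have eqN: "PiM I M = PiM I N" by (intro PiM_cong) (auto simp: N_def)
  interpret P: prob_space "PiM I N" by (intro prob_space_PiM PN)
  \<comment> \<open>The mixed moment of \<open>i\<close> and \<open>j\<close> is the integral of a product over all coordinates \<open>k\<close>,
    with factor 1 at the other coordinates, so the product formula applies to all pairs alike.\<close>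
  define h where "h i j k y = (if k = i then Z i y else 1) * (if k =
      j then cnj (Z j y) else 1)" for i j k y
  have Zm': "Z i \<in> borel_measurable (N k)" if "i \<in> I" for i k
    using Zm[OF that] measurable_cong_sets[OF sN refl] by blast
  have cm: "(\<lambda>y. cnj (Z i y)) \<in> borel_measurable (N k)" if "i \<in> I" for i k
    by (intro measurable_compose[OF Zm'[OF that] borel_measurable_continuous_onI[OF
        continuous_on_cnj[OF continuous_on_id]]])
  have intZ: "integrable (N k) (Z i)" if "i \<in> I" for i k
  proof -
    show ?thesis by (rule bounded_integrable[where B="b i"]) (auto simp: Zb Zm' that)
  qed
  have inth: "integrable (N k) (h i j k)" if "i \<in> I" "j \<in> I" for i j k
  proof -
    have b0: "b i \<ge> 0" if "i \<in> I" for i using Zb[OF that, of 0] norm_ge_zero order_trans by blast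
    show ?thesis 
    proof (rule bounded_integrable[where B="max 1 (b i) * max 1 (b j)"])
      show "AE y in N k. cmod (h i j k y) \<le> max 1 (b i) * max 1 (b j)"
        unfolding h_def norm_mult 
        by (intro AE_I2 mult_mono) (auto simp: le_max_iff_disj Zb that)
      show "h i j k \<in> borel_measurable (N k)"
        unfolding h_def[abs_def] using Zm' cm that by (intro borel_measurable_times) auto
    qed
  qed
  have prodh: "(\<Prod>k\<in>I. h i j k (y k)) = Z i (y i) * cnj (Z j (y j))" if "i \<in> I" "j \<in> I" for i j y
    unfolding h_def prod.distrib using that I by (simp add: prod.delta)
  have intprod: "integrable (PiM I N) (\<lambda>y. Z i (y i) * cnj (Z j (y j)))" if "i \<in> I" "j \<in> I" for i j
    using product_integrable_prod[OF I inth[OF that]] by (simp only: prodh[OF that])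
  have E: "(CLINT y|PiM I N. Z i (y i) * cnj (Z j (y j))) = (if i =
      j then complex_of_real (\<integral>y. (cmod (Z i y))\<^sup>2 \<partial>N i) else 0)"
    if ij: "i \<in> I" "j \<in> I" for i j
  proof -
    have "(CLINT y|PiM I N. Z i (y i) * cnj (Z j (y j))) = (\<Prod>k\<in>I. integral\<^sup>L (N k) (h i j k))"
      using product_integral_prod[OF I inth[OF that]] by (simp only: prodh[OF that])
    also have "\<dots> = (if i = j then complex_of_real (\<integral>y. (cmod (Z i y))\<^sup>2 \<partial>N i) else 0)"
    proof (cases "i = j")
      case False
      then have "integral\<^sup>L (N i) (h i j i) = 0" using Z0[OF ij(1)] ij by (simp add: h_def[abs_def]
          N_def)
      then show ?thesis using False ij I by (auto intro: prod_zero)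
    next
      case True
      have "integral\<^sup>L (N k) (h i j k) = (if k = i then complex_of_real (\<integral>y. (cmod (Z i y))\<^sup>2 \<partial>N i)
          else 1)" for k
      proof -
            show ?thesis using True
          by (auto simp: h_def[abs_def] prob_space.prob_space[OF PN] complex_norm_square[symmetric]
              simp del: of_real_power)
      qed
      then show ?thesis using True ij I by (simp add: prod.delta)
    qed
    finally show ?thesis .
  qed
  have sq: "complex_of_real ((cmod (\<Sum>i\<in>I. Z i (y i)))\<^sup>2) =
      (\<Sum>i\<in>I. \<Sum>j\<in>I. Z i (y i) * cnj (Z j (y j)))" for y
    unfolding complex_norm_square cnj_sum sum_product ..
  have int: "integrable (PiM I N) (\<lambda>y. (cmod (\<Sum>i\<in>I. Z i (y i)))\<^sup>2)"
  proof -
    have "integrable (PiM I N) (\<lambda>y. complex_of_real ((cmod (\<Sum>i\<in>I. Z i (y i)))\<^sup>2))"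
      unfolding sq by (intro Bochner_Integration.integrable_sum intprod)
    then show ?thesis by (simp only: complex_of_real_integrable_eq)
  qed
  have "complex_of_real (\<integral>y. (cmod (\<Sum>i\<in>I. Z i (y i)))\<^sup>2 \<partial>PiM I N) =
      (CLINT y|PiM I N. \<Sum>i\<in>I. \<Sum>j\<in>I. Z i (y i) * cnj (Z j (y j)))"
    by (simp only: integral_complex_of_real[symmetric] sq)
  also have "\<dots> = (\<Sum>i\<in>I. \<Sum>j\<in>I. CLINT y|PiM I N. Z i (y i) * cnj (Z j (y j)))"
    by (subst Bochner_Integration.integral_sum, intro Bochner_Integration.integrable_sum intprod,
        assumption+)
       (intro sum.cong refl Bochner_Integration.integral_sum intprod)
  also have "\<dots> = (\<Sum>i\<in>I. complex_of_real (\<integral>y. (cmod (Z i y))\<^sup>2 \<partial>N i))"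
    using I by (intro sum.cong refl) (simp add: E sum.delta)
  also have "\<dots> = complex_of_real (\<Sum>i\<in>I. \<integral>y. (cmod (Z i y))\<^sup>2 \<partial>N i)"
    by (simp only: of_real_sum)
  finally have "(\<integral>y. (cmod (\<Sum>i\<in>I. Z i (y i)))\<^sup>2 \<partial>PiM I N) = (\<Sum>i\<in>I. \<integral>y. (cmod (Z i y))\<^sup>2 \<partial>N i)"
    by (simp only: of_real_eq_iff)
  also have "\<dots> \<le> (\<Sum>i\<in>I. (b i)\<^sup>2)"
  proof (intro sum_mono)
    fix i assume i: "i \<in> I"
    have le: "(cmod (Z i y))\<^sup>2 \<le> (b i)\<^sup>2" for y by (intro power_mono Zb i) simp
    have "integrable (N i) (\<lambda>y. (cmod (Z i y))\<^sup>2)"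
      using Zm'[OF i] le by (intro bounded_integrable[where B="(b i)\<^sup>2"]) auto
    then have "(\<integral>y. (cmod (Z i y))\<^sup>2 \<partial>N i) \<le> (\<integral>y. (b i)\<^sup>2 \<partial>N i)"
      using le by (intro integral_mono) auto
    then show "(\<integral>y. (cmod (Z i y))\<^sup>2 \<partial>N i) \<le> (b i)\<^sup>2" by (simp add: prob_space.prob_space[OF PN])
  qed
  finally have "ennreal (\<integral>y. (cmod (\<Sum>i\<in>I. Z i (y i)))\<^sup>2 \<partial>PiM I N) \<le>
      ennreal (\<Sum>i\<in>I. (b i)\<^sup>2)" by (rule ennreal_leI)
  then show ?thesis unfolding eqN using nn_integral_eq_integral[OF int] by simp
qed

text \<open>\<open>Psi n fe y t - ft f t\<close> is a sum of independent centred terms. The weights \<open>ft (fe j) (- t)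
/ S\<close> are the ones for which the mean is exactly \<open>ft f t\<close>, and their squared moduli add up to \<open>1 /
S\<close>.\<close>

lemma Psi_risk:
  assumes f: "pdf f" and fe: "\<And>j. j \<in> {1..n} \<Longrightarrow> pdf (fe j)"
    and S: "(\<Sum>k=1..n. (cmod (ft (fe k) t))\<^sup>2) > 0"
  shows "(\<integral>\<^sup>+y. ennreal ((cmod (Psi n fe y t - ft f t))\<^sup>2) \<partial>data_law n f fe) \<le>
      ennreal (4 / (\<Sum>k=1..n. (cmod (ft (fe k) t))\<^sup>2))"
proof -
  define S where "S = (\<Sum>k=1..n. (cmod (ft (fe k) t))\<^sup>2)"
  have S0: "S > 0" using assms(3) by (simp add: S_def)
  define a where "a j = ft (fe j) (- t) / complex_of_real S" for j
  define Z where "Z j y = a j * (iexp (t * y) - ft f t * ft (fe j) t)" for j y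
  have na: "cmod (a j) = cmod (ft (fe j) t) / S" for j
    using S0 by (simp add: a_def norm_divide ft_minus)
  have "(\<Sum>j=1..n. a j * (ft f t * ft (fe j) t)) = ft f t * (\<Sum>j=1..n. ft (fe j) t * cnj (ft (fe j)
      t)) / S"
    by (simp add: a_def sum_distrib_left sum_divide_distrib ft_minus mult_ac)
  also have "(\<Sum>j=1..n. ft (fe j) t * cnj (ft (fe j) t)) = complex_of_real S"
    unfolding S_def of_real_sum complex_norm_square ..
  finally have "(\<Sum>j=1..n. a j * (ft f t * ft (fe j) t)) = ft f t" using S0 by simp
  then have eq: "Psi n fe y t - ft f t = (\<Sum>j=1..n. Z j (y j))" for y
  proof -
    have "Psi n fe y t = (\<Sum>j=1..n. ft (fe j) (- t) * iexp (t * y j)) / complex_of_real S"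
      by (simp only: Psi_def S_def)
    also have "\<dots> = (\<Sum>j=1..n. a j * iexp (t * y j))"
      by (simp add: a_def sum_divide_distrib)
    finally show ?thesis
      using \<open>(\<Sum>j=1..n. a j * (ft f t * ft (fe j) t)) = ft f t\<close>
      unfolding Z_def right_diff_distrib sum_subtractf by simp
  qed
  have "(\<integral>\<^sup>+y. ennreal ((cmod (\<Sum>j\<in>{1..n}. Z j (y j)))\<^sup>2) \<partial>PiM {1..n} (\<lambda>j. obs_law f (fe j))) \<le>
      ennreal (\<Sum>j\<in>{1..n}. (cmod (a j) * 2)\<^sup>2)"
  proof (rule second_moment_independent_sum)
    fix j assume j: "j \<in> {1..n}"
    show "prob_space (obs_law f (fe j))" by (intro prob_space_obs_law f fe j)
    then interpret K: prob_space "obs_law f (fe j)" .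
    show "Z j \<in> borel_measurable borel" unfolding Z_def[abs_def] by measurable
    show "cmod (Z j y) \<le> cmod (a j) * 2" for y
    proof -
      have "cmod (ft f t * ft (fe j) t) \<le> 1 * 1" 
        unfolding norm_mult by (intro mult_mono norm_ft_pdf f fe j) auto
      then have "cmod (iexp (t * y) - ft f t * ft (fe j) t) \<le> 2"
        using norm_triangle_ineq4[of "iexp (t * y)" "ft f t * ft (fe j) t"] unfolding norm_iexp by
            linarith
      then show ?thesis unfolding Z_def norm_mult[of "a j"] by (intro mult_left_mono) auto
    qed
    have "integrable (obs_law f (fe j)) (\<lambda>y. iexp (t * y))"
      by (rule K.integrable_const_bound[where B=1]) (auto simp del: of_real_mult)
    then have "(CLINT y|obs_law f (fe j). iexp (t * y) - ft f t * ft (fe j) t) = 0"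
      by (subst Bochner_Integration.integral_diff) (auto simp: char_obs_law[OF f fe[OF j]]
          K.prob_space simp del: of_real_mult)
    then show "(CLINT y|obs_law f (fe j). Z j y) = 0" unfolding Z_def by simp
  qed auto
  also have "(\<Sum>j\<in>{1..n}. (cmod (a j) * 2)\<^sup>2) = 4 * S / S\<^sup>2"
    unfolding na by (simp add: S_def power_mult_distrib power_divide sum_distrib_left
        sum_divide_distrib mult_ac)
  also have "\<dots> = 4 / S" using S0 by (simp add: power2_eq_square)
  finally show ?thesis unfolding eq S_def[symmetric] using data_law_eq_PiM[OF f fe] by simp
qed


lemma norm_Psi_le:
  assumes fe: "\<And>j. j \<in> {1..n} \<Longrightarrow> pdf (fe j)" and M: "M > 0" "M \<le> (\<Sum>k=1..n. (cmod (ft (fe k) t))\<^sup>2)"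
  shows "cmod (Psi n fe y t) \<le> real n / M"
proof -
  have "cmod (\<Sum>j=1..n. ft (fe j) (- t) * iexp (t * y j)) \<le> (\<Sum>j=1..n. 1)"
    by (intro sum_norm_le) (auto simp: norm_mult norm_ft_pdf fe simp del: of_real_mult)
  then have "cmod (Psi n fe y t) \<le> real n / (\<Sum>k=1..n. (cmod (ft (fe k) t))\<^sup>2)"
    unfolding Psi_def norm_divide norm_of_real using M by (auto intro!: divide_right_mono)
  also have "\<dots> \<le> real n / M" using M by (intro divide_left_mono) auto
  finally show ?thesis .
qed

lemma sets_data_law: "sets (data_law n f fe) = sets (\<Pi>\<^sub>M j\<in>{1..n}. (borel :: real measure))"
  by (simp add: data_law_def)

lemma prob_space_data_law:
  assumes f: "pdf f" and fe: "\<And>j. j \<in> {1..n} \<Longrightarrow> pdf (fe j)"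
  shows "prob_space (data_law n f fe)"
proof -
  define N where "N j = (if j \<in> {1..n} then obs_law f (fe j) else return borel 0)" for j
  have "data_law n f fe = PiM {1..n} N"
    by (subst data_law_eq_PiM[OF f fe]) (auto simp: N_def intro!: PiM_cong)
  moreover have "prob_space (N j)" for j
    unfolding N_def by (auto intro!: prob_space_obs_law f fe prob_space_return)
  ultimately show ?thesis by (simp add: prob_space_PiM)
qed

lemma Psi_measurable:
  assumes fe: "\<And>j. j \<in> {1..n} \<Longrightarrow> fe j \<in> borel_measurable borel"
  shows "(\<lambda>(y, t). Psi n fe y t) \<in> borel_measurable (data_law n f fe0 \<Otimes>\<^sub>M lborel)"
proof -
  have s: "sets (data_law n f fe0 \<Otimes>\<^sub>M lborel) = sets ((\<Pi>\<^sub>M j\<in>{1..n}. (borel :: real measure)) \<Otimes>\<^sub>M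
      (borel :: real measure))"
    by (intro sets_pair_measure_cong) (auto simp: sets_data_law)
  have c: "(\<lambda>p. fst p j) \<in> borel_measurable ((\<Pi>\<^sub>M j\<in>{1..n}. (borel :: real measure)) \<Otimes>\<^sub>M (borel ::
      real measure))" if "j \<in> {1..n}" for j
    using that by (intro measurable_compose[OF measurable_fst measurable_component_singleton])
  have d: "(\<lambda>p. ft (fe j) (snd p)) \<in> borel_measurable ((\<Pi>\<^sub>M j\<in>{1..n}. (borel :: real measure)) \<Otimes>\<^sub>M
      (borel :: real measure))"
      "(\<lambda>p. ft (fe j) (- snd p)) \<in> borel_measurable ((\<Pi>\<^sub>M j\<in>{1..n}. (borel :: real measure)) \<Otimes>\<^sub>M
          (borel :: real measure))" if "j \<in> {1..n}" for j
    using ft_measurable[OF fe[OF that]] by measurable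
  have "(\<lambda>p. Psi n fe (fst p) (snd p)) \<in> borel_measurable ((\<Pi>\<^sub>M j\<in>{1..n}. (borel :: real measure))
      \<Otimes>\<^sub>M (borel :: real measure))"
    unfolding Psi_def
    by (intro borel_measurable_divide borel_measurable_sum borel_measurable_times
        measurable_compose[OF _ borel_measurable_of_real] 
          borel_measurable_power measurable_compose[OF _ borel_measurable_norm] measurable_iexp c d
              measurable_snd)
  then show ?thesis by (simp add: case_prod_unfold measurable_cong_sets[OF s refl])
qed

text \<open>The first term is the stochastic error and the second the squared bias. The difference of
the estimate and the Fejer mean is the inverse transform of \<open>H y\<close> below; its energy is bounded by
the Bessel inequality and then averaged over the data frequency by frequency.\<close>

lemma mise_upper_bound:
  assumes f: "pdf f" and fe: "\<And>j. j \<in> {1..n} \<Longrightarrow> pdf (fe j)" and w: "w > 0" and M: "M > 0"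
    and S: "\<And>t. \<bar>t\<bar> \<le> w \<Longrightarrow> M \<le> (\<Sum>k=1..n. (cmod (ft (fe k) t))\<^sup>2)"
  shows "mise n f fe (fhat fejer w n fe) \<le> ennreal (4 * w / M) + 2 * (\<integral>\<^sup>+x. ennreal ((fejer_mean f w
      x - f x)\<^sup>2) \<partial>lborel)"
proof -
  note [measurable] = pdf_measurable[OF f]
  let ?D = "data_law n f fe"
  interpret D: prob_space ?D by (rule prob_space_data_law[OF f fe])
  interpret DL: pair_sigma_finite ?D lborel ..
  define H where "H y t = complex_of_real (tri (t / w)) * (Psi n fe y t - ft f t)" for y t
  have Psim: "(\<lambda>(y, t). Psi n fe y t) \<in> borel_measurable (?D \<Otimes>\<^sub>M lborel)"
    using fe by (intro Psi_measurable pdf_measurable) auto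
  have Hm: "(\<lambda>(y, t). H y t) \<in> borel_measurable (?D \<Otimes>\<^sub>M lborel)"
  proof -
    have "(\<lambda>p. ft f (snd p)) \<in> borel_measurable (?D \<Otimes>\<^sub>M lborel)" "(\<lambda>p. tri (snd p / w)) \<in>
        borel_measurable (?D \<Otimes>\<^sub>M lborel)"
      by (auto intro!: measurable_compose[OF measurable_snd])
    then show ?thesis using Psim unfolding H_def case_prod_unfold by measurable
  qed
  have int0: "integrable lborel (\<lambda>t. complex_of_real (tri (t / w)))"
    using lborel_integrable_real_affine[OF integrable_tri, of "1/w" 0] w by simp
  have itri: "has_bochner_integral lborel (\<lambda>t. tri (t / w)) w"
    using lborel_integrable_real_affine[OF integrable_tri, of "1/w" 0] w
      lborel_integral_real_affine[of "1/w" tri 0]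
    by (simp add: has_bochner_integral_iff integral_tri field_simps)
  have intP: "integrable lborel (\<lambda>t. iexp (- (t * x)) * of_real (tri (t / w)) * Psi n fe y t)" for x y
  proof (rule Bochner_Integration.integrable_bound[OF integrable_mult_right[OF integrable_norm[OF
      int0], of "real n / M"]])
    have [measurable]: "Psi n fe y \<in> borel_measurable borel"
      using pdf_measurable[OF fe] unfolding Psi_def[abs_def]
      by (intro borel_measurable_divide borel_measurable_sum borel_measurable_times
          measurable_compose[OF _ borel_measurable_of_real] 
          borel_measurable_power measurable_compose[OF _ borel_measurable_norm] measurable_iexp
              measurable_compose[OF _ ft_measurable]) auto
    show "(\<lambda>t. iexp (- (t * x)) * of_real (tri (t / w)) * Psi n fe y t) \<in> borel_measurable lborel"
      by measurable
    show "AE t in lborel. cmod (iexp (- (t * x)) * of_real (tri (t / w)) * Psi n fe y t) \<le>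
        norm (real n / M * cmod (of_real (tri (t / w))))"
    proof (rule AE_I2)
      fix t
      show "cmod (iexp (- (t * x)) * of_real (tri (t / w)) * Psi n fe y t) \<le>
          norm (real n / M * cmod (of_real (tri (t / w))))"
      proof (cases "\<bar>t\<bar> \<le> w")
        case True
        have "tri (t / w) * cmod (Psi n fe y t) \<le> tri (t / w) * (real n / M)"
          by (intro mult_left_mono norm_Psi_le fe M S True tri_nonneg)
        then show ?thesis using M unfolding norm_mult norm_iexp norm_of_real
          by (simp add: abs_mult tri_nonneg mult_ac)
      next
        case False
        then have "tri (t / w) = 0" using w by (intro tri_eq_0) (simp add: field_simps)
        then show ?thesis by simp
      qed
    qed
  qed
  have intf: "integrable lborel (\<lambda>t. iexp (- (t * x)) * of_real (tri (t / w)) * ft f t)" for x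
  proof (rule Bochner_Integration.integrable_bound[OF int0])
    show "AE t in lborel. cmod (iexp (- (t * x)) * of_real (tri (t / w)) * ft f t) \<le>
        cmod (of_real (tri (t / w)))"
      unfolding norm_mult norm_iexp by (auto intro!: AE_I2 mult_right_le_one_le norm_ft_pdf f)
  qed measurable
  have HI: "integrable lborel (H y)" for y
    using Bochner_Integration.integrable_diff[OF intP[of 0 y] intf[of 0]] by (simp add:
        H_def[abs_def] right_diff_distrib)
  have diff: "fhat fejer w n fe y x - of_real (fejer_mean f w x) =
      of_real (1 / (2 * pi)) * fourier (H y) (- x)" for x y
  proof -
    have "fhat fejer w n fe y x - of_real (fejer_mean f w x) = of_real (1 / (2 * pi)) *
      ((CLINT t|lborel. iexp (- (t * x)) * of_real (tri (t / w)) * Psi n fe y t) - (CLINT t|lborel.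
          iexp (- (t * x)) * of_real (tri (t / w)) * ft f t))"
      unfolding fhat_def fejer_mean_fourier[OF f w] ft_fejer by (simp only: right_diff_distrib)
    also have "\<dots> = of_real (1 / (2 * pi)) * (CLINT t|lborel. iexp (- (t * x)) * of_real (tri (t /
        w)) * Psi n fe y t - iexp (- (t * x)) * of_real (tri (t / w)) * ft f t)"
      by (simp only: Bochner_Integration.integral_diff[OF intP intf])
    also have "\<dots> = of_real (1 / (2 * pi)) * fourier (H y) (- x)"
      unfolding fourier_def H_def by (simp add: algebra_simps)
    finally show ?thesis .
  qed
  have point: "(\<integral>\<^sup>+x. ennreal ((cmod (fhat fejer w n fe y x - of_real (f x)))\<^sup>2) \<partial>lborel) \<le>
      (\<integral>\<^sup>+t. ennreal ((cmod (H y t))\<^sup>2) \<partial>lborel) + 2 * (\<integral>\<^sup>+x. ennreal ((fejer_mean f w x - f x)\<^sup>2)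
          \<partial>lborel)" for y
  proof -
    have [measurable]: "H y \<in> borel_measurable borel" using HI[of y] by auto
    have [measurable]: "fejer_mean f w \<in> borel_measurable borel" unfolding fejer_mean_def[abs_def]
        by measurable
    have "(\<integral>\<^sup>+x. ennreal ((cmod (fhat fejer w n fe y x - of_real (f x)))\<^sup>2) \<partial>lborel) \<le>
      (\<integral>\<^sup>+x. ennreal (1 / (2 * pi\<^sup>2)) * ennreal ((cmod (fourier (H y) (- x)))\<^sup>2) +
          2 * ennreal ((fejer_mean f w x - f x)\<^sup>2) \<partial>lborel)"
    proof (intro nn_integral_mono)
      fix x
      let ?a = "of_real (1 / (2 * pi)) * fourier (H y) (- x)" and ?b = "fejer_mean f w x - f x"
      have "fhat fejer w n fe y x - of_real (f x) = ?a + of_real ?b"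
        using diff[of y x] by (simp add: algebra_simps)
      then have "cmod (fhat fejer w n fe y x - of_real (f x)) \<le> cmod ?a + \<bar>?b\<bar>"
        by (metis norm_triangle_ineq norm_of_real)
      then have "(cmod (fhat fejer w n fe y x - of_real (f x)))\<^sup>2 \<le> (cmod ?a + \<bar>?b\<bar>)\<^sup>2"
        by (intro power_mono) auto
      also have "\<dots> \<le> 2 * (cmod ?a)\<^sup>2 + 2 * ?b\<^sup>2"
        using sum_squares_bound[of "cmod ?a" "\<bar>?b\<bar>"] by (simp add: power2_sum)
      also have "2 * (cmod ?a)\<^sup>2 = 1 / (2 * pi\<^sup>2) * (cmod (fourier (H y) (- x)))\<^sup>2"
        unfolding norm_mult norm_of_real by (simp add: power_mult_distrib power_divide)
      finally show "ennreal ((cmod (fhat fejer w n fe y x - of_real (f x)))\<^sup>2) \<le>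
          ennreal (1 / (2 * pi\<^sup>2)) * ennreal ((cmod (fourier (H y) (- x)))\<^sup>2) + 2 * ennreal (?b\<^sup>2)"
        by (subst ennreal_mult'[symmetric], simp, subst ennreal_numeral[symmetric],
            subst ennreal_mult'[symmetric], simp, subst ennreal_plus[symmetric])
           (auto intro!: ennreal_leI simp del: ennreal_plus)
    qed
    also have "\<dots> = ennreal (1 / (2 * pi\<^sup>2)) * (\<integral>\<^sup>+x. ennreal ((cmod (fourier (H y) (- x)))\<^sup>2)
        \<partial>lborel) + 2 * (\<integral>\<^sup>+x. ennreal ((fejer_mean f w x - f x)\<^sup>2) \<partial>lborel)"
      by (subst nn_integral_add) (auto simp: nn_integral_cmult)
    also have "(\<integral>\<^sup>+x. ennreal ((cmod (fourier (H y) (- x)))\<^sup>2) \<partial>lborel) =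
        (\<integral>\<^sup>+x. ennreal ((cmod (fourier (H y) x))\<^sup>2) \<partial>lborel)"
      using nn_integral_real_affine[of "\<lambda>x. ennreal ((cmod (fourier (H y) x))\<^sup>2)" "-1" 0] by (simp
          add: one_ennreal_def[symmetric])
    also have "ennreal (1 / (2 * pi\<^sup>2)) * (\<integral>\<^sup>+x. ennreal ((cmod (fourier (H y) x))\<^sup>2) \<partial>lborel) \<le>
        ennreal (1 / (2 * pi\<^sup>2)) * (2 * pi * (\<integral>\<^sup>+t. ennreal ((cmod (H y t))\<^sup>2) \<partial>lborel))"
      by (intro mult_left_mono bessel_fourier HI) simp
    also have "\<dots> = ennreal (1 / (2 * pi\<^sup>2) * (2 * pi)) * (\<integral>\<^sup>+t. ennreal ((cmod (H y t))\<^sup>2) \<partial>lborel)"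
      unfolding mult.assoc[symmetric] by (subst ennreal_mult'[symmetric]) auto
    also have "1 / (2 * pi\<^sup>2) * (2 * pi) = 1 / pi" by (simp add: power2_eq_square)
    also have "ennreal (1 / pi) * (\<integral>\<^sup>+t. ennreal ((cmod (H y t))\<^sup>2) \<partial>lborel) \<le>
        1 * (\<integral>\<^sup>+t. ennreal ((cmod (H y t))\<^sup>2) \<partial>lborel)"
      using pi_gt3 by (intro mult_right_mono) (auto simp: ennreal_le_1)
    finally show ?thesis by (simp add: add_mono)
  qed
  have "mise n f fe (fhat fejer w n fe) \<le> (\<integral>\<^sup>+y. (\<integral>\<^sup>+t. ennreal ((cmod (H y t))\<^sup>2) \<partial>lborel) +
      2 * (\<integral>\<^sup>+x. ennreal ((fejer_mean f w x - f x)\<^sup>2) \<partial>lborel) \<partial>?D)"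
    unfolding mise_def by (intro nn_integral_mono point)
  also have "\<dots> = (\<integral>\<^sup>+y. (\<integral>\<^sup>+t. ennreal ((cmod (H y t))\<^sup>2) \<partial>lborel) \<partial>?D) +
      2 * (\<integral>\<^sup>+x. ennreal ((fejer_mean f w x - f x)\<^sup>2) \<partial>lborel)"
    using Hm by (subst nn_integral_add) (auto simp: D.emeasure_space_1)
  also have "(\<integral>\<^sup>+y. (\<integral>\<^sup>+t. ennreal ((cmod (H y t))\<^sup>2) \<partial>lborel) \<partial>?D) =
      (\<integral>\<^sup>+t. (\<integral>\<^sup>+y. ennreal ((cmod (H y t))\<^sup>2) \<partial>?D) \<partial>lborel)"
    using Hm by (intro DL.Fubini'[symmetric]) (simp add: case_prod_unfold)
  also have "\<dots> \<le> (\<integral>\<^sup>+t. ennreal (4 / M * tri (t / w)) \<partial>lborel)"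
  proof (intro nn_integral_mono)
    fix t
    show "(\<integral>\<^sup>+y. ennreal ((cmod (H y t))\<^sup>2) \<partial>?D) \<le> ennreal (4 / M * tri (t / w))"
    proof (cases "\<bar>t\<bar> \<le> w")
      case True
      note St = S[OF True]
      have Pm: "(\<lambda>y. Psi n fe y t) \<in> borel_measurable ?D"
        using measurable_compose[OF measurable_Pair2' Psim, of t] by simp
      have "(\<integral>\<^sup>+y. ennreal ((cmod (H y t))\<^sup>2) \<partial>?D) =
          (\<integral>\<^sup>+y. ennreal ((tri (t / w))\<^sup>2) * ennreal ((cmod (Psi n fe y t - ft f t))\<^sup>2) \<partial>?D)"
        by (intro nn_integral_cong) (simp add: H_def norm_mult power_mult_distrib ennreal_mult')
      also have "\<dots> = ennreal ((tri (t / w))\<^sup>2) * (\<integral>\<^sup>+y. ennreal ((cmod (Psi n fe y t - ft f t))\<^sup>2) \<partial>?D)"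
        using Pm by (intro nn_integral_cmult) auto
      also have "\<dots> \<le> ennreal ((tri (t / w))\<^sup>2) * ennreal (4 / (\<Sum>k=1..n. (cmod (ft (fe k) t))\<^sup>2))"
        using St M by (intro mult_left_mono Psi_risk f fe) auto
      also have "\<dots> = ennreal ((tri (t / w))\<^sup>2 * (4 / (\<Sum>k=1..n. (cmod (ft (fe k) t))\<^sup>2)))"
        by (rule ennreal_mult'[symmetric]) simp
      also have "\<dots> \<le> ennreal (tri (t / w) * (4 / M))"
        using St M tri_nonneg tri_le_1
        by (intro ennreal_leI mult_mono divide_left_mono) (auto simp: power2_eq_square mult_left_le)
      finally show ?thesis by (simp add: mult.commute)
    next
      case False
      then have "tri (t / w) = 0" using w by (intro tri_eq_0) (simp add: field_simps)
      then show ?thesis by (simp add: H_def)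
    qed
  qed
  also have "\<dots> = ennreal (4 / M * w)"
    using has_bochner_integral_mult_right[OF itri, of "4 / M"] M
    by (subst nn_integral_eq_integral) (auto simp: has_bochner_integral_iff tri_nonneg)
  finally show ?thesis by (simp add: add_mono)
qed

text \<open>A diagonal argument: at time \<open>n\<close> take the largest integer \<open>m \<le> n\<close> such that the bound at
bandwidth \<open>m\<close> holds from time \<open>n\<close> on.\<close>

lemma slow_bandwidth:
  fixes S :: "nat \<Rightarrow> real \<Rightarrow> real"
  assumes "\<And>\<omega>. \<omega> > 0 \<Longrightarrow> filterlim (\<lambda>n. S n \<omega>) at_top sequentially"
  obtains w :: "nat \<Rightarrow> real" where "\<And>n. w n > 0" "filterlim w at_top sequentially" 
    "eventually (\<lambda>n. S n (w n) \<ge> (w n)\<^sup>2) sequentially"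
proof -
  define P where "P m n \<longleftrightarrow> (\<forall>k\<ge>n. S k (real m) \<ge> (real m)\<^sup>2)" for m n
  \<comment> \<open>The element 1 only keeps the set nonempty; it satisfies \<open>P\<close> once \<open>n\<close> is large.\<close>
  define A where "A n = insert 1 {m\<in>{1..n}. P m n}" for n
  define w where "w n = real (Max (A n))" for n
  have fin: "finite (A n)" for n by (simp add: A_def)
  have Pe: "eventually (P m) sequentially" if "m \<ge> 1" for m
  proof -
    have "eventually (\<lambda>n. S n (real m) \<ge> (real m)\<^sup>2) sequentially"
      using assms[of "real m"] that by (auto simp: filterlim_at_top)
    then obtain N where "\<forall>n\<ge>N. S n (real m) \<ge> (real m)\<^sup>2" by (auto simp: eventually_sequentially)
    then show ?thesis by (auto simp: eventually_sequentially P_def intro!: exI[of _ N])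
  qed
  have MA: "Max (A n) \<in> A n" for n by (intro Max_in fin) (simp add: A_def)
  show thesis
  proof (rule that[of w])
    have "m \<in> A n \<Longrightarrow> m \<ge> 1" for m n by (auto simp: A_def)
    from this[OF MA] show "w n > 0" for n by (simp add: w_def Suc_le_eq)
    show "filterlim w at_top sequentially"
      unfolding filterlim_at_top
    proof
      fix Z :: real
      define m where "m = nat \<lceil>\<bar>Z\<bar>\<rceil> + 1"
      have mZ: "real m \<ge> Z" "m \<ge> 1" unfolding m_def by linarith+
      have "eventually (\<lambda>n. P m n \<and> n \<ge> m) sequentially"
        using Pe[OF mZ(2)] eventually_ge_at_top[of m] by (rule eventually_conj)
      then show "eventually (\<lambda>n. Z \<le> w n) sequentially"
      proof eventually_elim
        case (elim n)
        then have "m \<in> A n" using mZ by (auto simp: A_def)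
        then have "m \<le> Max (A n)" by (intro Max_ge fin)
        then show ?case using mZ by (simp add: w_def)
      qed
    qed
    show "eventually (\<lambda>n. S n (w n) \<ge> (w n)\<^sup>2) sequentially"
      using Pe[OF order_refl]
    proof eventually_elim
      case (elim n)
      then have "P (Max (A n)) n" using MA[of n] by (auto simp: A_def)
      then show ?case by (simp add: P_def w_def)
    qed
  qed
qed

lemma square_integrable_fejer: "square_integrable fejer"
proof -
  have "integrable lborel (\<lambda>x. (norm (fejer x))\<^sup>2)"
  proof (rule Bochner_Integration.integrable_bound[OF integrable_fejer])
    show "AE x in lborel. norm ((norm (fejer x))\<^sup>2) \<le> norm (fejer x)"
    proof (rule AE_I2)
      fix x
      have "fejer x \<le> 1" by (rule order_trans[OF fejer_le]) (use pi_gt3 in simp)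
      then show "norm ((norm (fejer x))\<^sup>2) \<le> norm (fejer x)"
        using fejer_nonneg[of x] by (simp add: power2_eq_square mult_left_le)
    qed
  qed measurable
  then show ?thesis by (simp add: square_integrable_def)
qed

lemma compact_support_ft_fejer: "compact (closure {t. ft fejer t \<noteq> 0})"
proof -
  have "{t. ft fejer t \<noteq> 0} \<subseteq> {-1..1}" by (auto simp: ft_fejer tri_def)
  then show ?thesis using bounded_subset[OF bounded_closed_interval] by (simp add: compact_closure)
      blast
qed

lemma condition_A_fejer:
  assumes n: "n \<ge> 1" and fe: "\<And>j. j \<in> {1..n} \<Longrightarrow> pdf (fe j)" and nz: "\<And>j t. j \<in> {1..n} \<Longrightarrow> ft (fe j) t \<noteq> 0"
    and w: "w > 0" and M: "M > 0"
    and S: "\<And>t. \<bar>t\<bar> \<le> w \<Longrightarrow> M \<le> (\<Sum>k=1..n. (cmod (ft (fe k) t))\<^sup>2)"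
  shows "condition_A fejer w n fe"
  unfolding condition_A_def
proof (intro conjI ballI)
  show "\<exists>j\<in>{1..n}. \<forall>t. ft (fe j) t \<noteq> 0" using n nz by (intro bexI[of _ 1]) auto
  show "bounded (range (ft fejer))"
    by (rule boundedI[of _ 1]) (auto simp: ft_fejer tri_nonneg tri_le_1)
  show "isCont (ft fejer) 0" unfolding ft_fejer[abs_def] by (intro continuous_of_real isCont_tri)
  show "ft fejer 0 = 1" by (simp add: ft_fejer)
  fix j assume j: "j \<in> {1..n}"
  let ?q = "\<lambda>t. ft (fe j) (t * w) * ft fejer t / complex_of_real (\<Sum>k=1..n. (cmod (ft (fe k) (t *
      w)))\<^sup>2)"
  have qm: "?q \<in> borel_measurable borel"
  proof -
    have [measurable]: "(\<lambda>t. ft (fe k) (t * w)) \<in> borel_measurable borel" if "k \<in> {1..n}" for k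
      by (rule measurable_compose[OF _ ft_measurable[OF pdf_measurable[OF fe[OF that]]]]) measurable
    have "(\<lambda>t. \<Sum>k=1..n. (cmod (ft (fe k) (t * w)))\<^sup>2) \<in> borel_measurable borel"
      by (intro borel_measurable_sum borel_measurable_power measurable_compose[OF _
          borel_measurable_norm]) measurable
    moreover have "(\<lambda>t. ft (fe j) (t * w)) \<in> borel_measurable borel" using j by measurable
    moreover have "ft fejer \<in> borel_measurable borel" by (rule ft_measurable) measurable
    ultimately show ?thesis by measurable
  qed
  have "integrable lborel (\<lambda>t. (cmod (?q t))\<^sup>2)"
  proof (rule Bochner_Integration.integrable_bound[OF integrable_mult_right[OF integrable_tri,
      of "(1 / M)\<^sup>2"]])
    show "(\<lambda>t. (cmod (?q t))\<^sup>2) \<in> borel_measurable lborel" using qm by measurable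
    show "AE t in lborel. norm ((cmod (?q t))\<^sup>2) \<le> norm ((1 / M)\<^sup>2 * tri t)"
    proof (rule AE_I2)
      fix t
      show "norm ((cmod (?q t))\<^sup>2) \<le> norm ((1 / M)\<^sup>2 * tri t)"
      proof (cases "\<bar>t\<bar> \<le> 1")
        case True
        then have "\<bar>t * w\<bar> \<le> w" using w by (simp add: abs_mult)
        note St = S[OF this]
        have "cmod (?q t) = cmod (ft (fe j) (t * w)) * tri t / (\<Sum>k=1..n. (cmod (ft (fe k) (t * w)))\<^sup>2)"
          using St M unfolding norm_divide norm_mult ft_fejer norm_of_real by (simp add: tri_nonneg)
        also have "\<dots> \<le> 1 * tri t / M"
          using St M by (intro frac_le mult_mono norm_ft_pdf fe j) (auto simp: tri_nonneg)
        finally have "(cmod (?q t))\<^sup>2 \<le> (1 / M * tri t)\<^sup>2" by (intro power_mono) auto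
        also have "\<dots> \<le> (1 / M)\<^sup>2 * tri t"
          using tri_nonneg[of t] tri_le_1[of t] unfolding power_mult_distrib
          by (intro mult_left_mono) (auto simp: power2_eq_square mult_left_le)
        finally show ?thesis using tri_nonneg[of t] by simp
      next
        case False
        then have "tri t = 0" by (intro tri_eq_0) simp
        then show ?thesis by (simp add: ft_fejer)
      qed
    qed
  qed
  then show "square_integrable ?q" using qm by (simp add: square_integrable_def)
qed

text \<open>With \<open>S n (w n) \<ge> (w n)\<^sup>2\<close> the stochastic error is of order \<open>1 / w n\<close>.\<close>

lemma consistency_of_slow_bandwidth:
  fixes w :: "nat \<Rightarrow> real"
  assumes fe: "\<And>n j. j \<in> {1..n} \<Longrightarrow> pdf (fe n j)"
    and w: "\<And>n. w n > 0" "filterlim w at_top sequentially"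
    and S: "eventually (\<lambda>n. \<forall>t. \<bar>t\<bar> \<le> w n \<longrightarrow> (w n)\<^sup>2 \<le> (\<Sum>k=1..n. (cmod (ft (fe n k) t))\<^sup>2)) sequentially"
    and f: "pdf f" "square_integrable f"
  shows "(\<lambda>n. mise n f (fe n) (fhat fejer (w n) n (fe n))) \<longlonglongrightarrow> 0"
proof (rule tendsto_sandwich[OF _ _ tendsto_const])
  let ?b = "\<lambda>n. ennreal (4 / w n) + 2 * (\<integral>\<^sup>+x. ennreal ((fejer_mean f (w n) x - f x)\<^sup>2) \<partial>lborel)"
  show "eventually (\<lambda>n. mise n f (fe n) (fhat fejer (w n) n (fe n)) \<le> ?b n) sequentially"
    using S
  proof eventually_elim
    case (elim n)
    have "mise n f (fe n) (fhat fejer (w n) n (fe n)) \<le> ennreal (4 * w n / (w n)\<^sup>2) +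
        2 * (\<integral>\<^sup>+x. ennreal ((fejer_mean f (w n) x - f x)\<^sup>2) \<partial>lborel)"
      using w(1)[of n] elim by (intro mise_upper_bound f(1) fe) auto
    also have "4 * w n / (w n)\<^sup>2 = 4 / w n" using w(1)[of n] by (simp add: power2_eq_square)
    finally show ?case .
  qed
  have "(\<lambda>n. 4 / w n) \<longlonglongrightarrow> 0"
    by (rule tendsto_divide_0[OF tendsto_const filterlim_at_top_imp_at_infinity[OF w(2)]])
  then have "(\<lambda>n. ennreal (4 / w n)) \<longlonglongrightarrow> 0" using tendsto_ennrealI by fastforce
  moreover have "(\<lambda>n. 2 * (\<integral>\<^sup>+x. ennreal ((fejer_mean f (w n) x - f x)\<^sup>2) \<partial>lborel)) \<longlonglongrightarrow> 2 * 0"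
    by (intro ennreal_tendsto_cmult fejer_mean_L2 f w) simp
  ultimately show "?b \<longlonglongrightarrow> 0" using tendsto_add by fastforce
qed auto

section \<open>A perturbation that strong noise conceals\<close>

text \<open>Modulation by \<open>cos (b * x)\<close> moves the transform of the Fejer kernel to the frequencies \<open>\<plusminus>b\<close>.
The factor \<open>1 / 2\<close> bounds the perturbation by half the kernel, so it costs at most \<open>1 / 2\<close> in
\<open>L\<^sup>1\<close> under any noise.\<close>

definition perturbation :: "real \<Rightarrow> real \<Rightarrow> real" where
  "perturbation b x = fejer x * cos (b * x) / 2"

definition perturbed_fejer :: "real \<Rightarrow> real \<Rightarrow> real" where
  "perturbed_fejer b x = fejer x + perturbation b x"

definition conv :: "(real \<Rightarrow> real) \<Rightarrow> (real \<Rightarrow> real) \<Rightarrow> real \<Rightarrow> real" where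
  "conv f g x = (\<integral>y. f (x - y) * g y \<partial>lborel)"

lemma perturbation_measurable [measurable]: "perturbation b \<in> borel_measurable borel"
  unfolding perturbation_def[abs_def] by measurable

lemma abs_perturbation_le: "\<bar>perturbation b x\<bar> \<le> fejer x / 2"
  using fejer_nonneg[of x] abs_cos_le_one[of "b * x"]
  by (simp add: perturbation_def abs_mult mult_left_le)

lemma integrable_perturbation: "integrable lborel (perturbation b)"
  by (rule Bochner_Integration.integrable_bound[OF integrable_fejer])
     (use abs_perturbation_le fejer_nonneg in \<open>auto intro!: AE_I2 intro: order_trans[OF
         abs_perturbation_le]\<close>)

lemma of_real_cos: "complex_of_real (cos x) = (iexp x + iexp (- x)) / 2"
  using cos_exp_eq[of "complex_of_real x"] by (simp add: cos_of_real)

lemma ft_perturbation: "ft (perturbation b) t = of_real ((tri (t + b) + tri (t - b)) / 4)"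
proof -
  have i: "integrable lborel (\<lambda>x. iexp (s * x) * complex_of_real (fejer x))" for s
    using integrable_fejer by (intro integrable_iexp_mult) auto
  have "ft (perturbation b) t = (CLINT x|lborel. (1 / 4) * (iexp ((t + b) * x) * of_real (fejer x) +
      iexp ((t - b) * x) * of_real (fejer x)))"
    unfolding ft_def perturbation_def of_real_divide of_real_mult of_real_cos
    by (intro Bochner_Integration.integral_cong refl) (simp add: field_simps exp_add[symmetric]
        mult_exp_exp)
  also have "\<dots> = (1 / 4) * (ft fejer (t + b) + ft fejer (t - b))"
    unfolding ft_def by (subst integral_mult_right_zero, subst Bochner_Integration.integral_add[OF i
        i]) simp
  finally show ?thesis by (simp add: ft_fejer)
qed

lemma integrable_tri_shift: "integrable lborel (\<lambda>t. tri (t + c))"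
  by (rule integrable_shift[OF integrable_tri])

lemma integral_tri_shift: "(\<integral>t. tri (t + c) \<partial>lborel) = 1"
  unfolding integral_shift by (rule integral_tri)

lemma fourier_tri_shift: "fourier (\<lambda>t. complex_of_real (tri (t + c))) u =
    iexp (- (c * u)) * of_real (2 * pi * fejer u)"
proof -
  have "fourier (\<lambda>t. complex_of_real (tri (t + c))) u = (CLINT t|lborel. (\<lambda>t. iexp (- (c * u)) *
      (iexp (t * u) * complex_of_real (tri t))) (t + c))"
    unfolding fourier_def
    by (intro Bochner_Integration.integral_cong refl) (simp add: algebra_simps exp_add[symmetric]
        mult_exp_exp)
  also have "\<dots> = iexp (- (c * u)) * fourier (\<lambda>t. complex_of_real (tri t)) u"
    unfolding integral_shift[of "\<lambda>t. iexp (- (c * u)) * (iexp (t * u) * complex_of_real (tri t))" c]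
        fourier_def
    by (rule integral_mult_right_zero)
  finally show ?thesis by (simp add: fourier_tri)
qed

lemma fourier_ft_perturbation: "fourier (\<lambda>t. complex_of_real ((tri (t + b) + tri (t +
    - b)) / 4)) u = of_real (2 * pi * perturbation b u)"
proof -
  have i: "integrable lborel (\<lambda>t. iexp (t * u) * complex_of_real (tri (t + c)))" for c
    using integrable_tri_shift by (intro integrable_iexp_mult) auto
  have "fourier (\<lambda>t. complex_of_real ((tri (t + b) + tri (t + - b)) / 4)) u = 
     (CLINT t|lborel. (1 / 4) * (iexp (t * u) * complex_of_real (tri (t + b)) +
         iexp (t * u) * complex_of_real (tri (t + - b))))"
    unfolding fourier_def by (intro Bochner_Integration.integral_cong refl) (simp add: field_simps)
  also have "\<dots> = (1 / 4) * (fourier (\<lambda>t. complex_of_real (tri (t + b))) u +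
      fourier (\<lambda>t. complex_of_real (tri (t + - b))) u)"
    unfolding fourier_def by (subst integral_mult_right_zero,
        subst Bochner_Integration.integral_add[OF i i]) simp
  also have "\<dots> = of_real (2 * pi * perturbation b u)"
    unfolding fourier_tri_shift perturbation_def of_real_divide of_real_mult of_real_cos by (simp
        add: algebra_simps)
  finally show ?thesis .
qed

text \<open>The transform of the perturbation lives at frequencies of modulus at least \<open>b - 1\<close> and has
total mass \<open>1 / 2\<close>; the noise multiplies it by \<open>ft g\<close>.\<close>

lemma abs_conv_perturbation_le_sup:
  assumes g: "pdf g" and e: "\<And>t. \<bar>t\<bar> \<ge> b - 1 \<Longrightarrow> cmod (ft g t) \<le> e"
  shows "\<bar>conv (perturbation b) g x\<bar> \<le> e / (4 * pi)"
proof -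
  note [measurable] = pdf_measurable[OF g]
  let ?G = "\<lambda>t. (tri (t + b) + tri (t + - b)) / 4"
  have G: "integrable lborel ?G" using integrable_tri_shift[of b] integrable_tri_shift[of "-b"] by auto
  have G0: "?G t \<ge> 0" for t using tri_nonneg[of "t + b"] tri_nonneg[of "t + - b"] by simp
  have "integral\<^sup>L lborel ?G = 1 / 2"
    using integrable_tri_shift[of b] integrable_tri_shift[of "-b"] integral_tri_shift[of b]
        integral_tri_shift[of "-b"]
    by simp
  have pe: "perturbation b (x - y) = perturbation b (y - x)" for y
    unfolding perturbation_def using fejer_minus[of "y - x"] cos_minus[of "b * (y - x)"] by (simp
        add: algebra_simps)
  have "complex_of_real (2 * pi * conv (perturbation b) g x) = complex_of_real (\<integral>y. g y * (2 * pi *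
      perturbation b (y - x)) \<partial>lborel)"
    unfolding conv_def pe integral_mult_right_zero[symmetric] by (simp add: mult_ac)
  also have "\<dots> = (CLINT y|lborel. of_real (g y) * fourier (\<lambda>t. complex_of_real (?G t)) (y - x))"
    unfolding fourier_ft_perturbation by (simp only: integral_complex_of_real[symmetric] of_real_mult)
  also have "\<dots> = (CLINT t|lborel. iexp (- (t * x)) * of_real (?G t) * ft g t)"
    by (intro convolution_inverse_fourier g integrable_of_real G)
  finally have eq: "complex_of_real (2 * pi * conv (perturbation b) g x) =
      (CLINT t|lborel. iexp (- (t * x)) * of_real (?G t) * ft g t)" .
  have "cmod (complex_of_real (2 * pi * conv (perturbation b) g x)) =
      cmod (CLINT t|lborel. iexp (- (t * x)) * of_real (?G t) * ft g t)"
    by (simp only: eq)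
  also have "\<dots> \<le> (\<integral>t. cmod (iexp (- (t * x)) * of_real (?G t) * ft g t) \<partial>lborel)"
    by (rule integral_norm_bound)
  also have "\<dots> \<le> (\<integral>t. e * ?G t \<partial>lborel)"
  proof (rule integral_mono_AE')
    show "integrable lborel (\<lambda>t. e * ?G t)" using G by (intro integrable_mult_right)
    show "AE t in lborel. cmod (iexp (- (t * x)) * of_real (?G t) * ft g t) \<le> e * ?G t"
    proof (rule AE_I2)
      fix t
      have "?G t * cmod (ft g t) \<le> ?G t * e"
      proof (cases "\<bar>t\<bar> \<ge> b - 1")
        case True then show ?thesis by (intro mult_left_mono e G0)
      next
        case False
        then have "tri (t + b) = 0" "tri (t + - b) = 0" by (auto intro!: tri_eq_0)
        then show ?thesis by simp
      qed
      then show "cmod (iexp (- (t * x)) * of_real (?G t) * ft g t) \<le> e * ?G t"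
        using G0[of t] unfolding norm_mult norm_iexp norm_of_real by (simp add: mult.commute)
    qed
    have "e \<ge> 0" using order_trans[OF norm_ge_zero e[of b]] by simp
    then show "AE t in lborel. 0 \<le> e * ?G t" using G0 by (intro AE_I2 mult_nonneg_nonneg)
  qed
  also have "\<dots> = e / 2"
    using \<open>integral\<^sup>L lborel ?G = 1 / 2\<close> unfolding integral_mult_right_zero by simp
  finally have "2 * pi * \<bar>conv (perturbation b) g x\<bar> \<le>
      e / 2" unfolding norm_of_real by (simp add: abs_mult)
  then show ?thesis by (simp add: field_simps)
qed

text \<open>The classical estimate of a tail by the behaviour of the characteristic function at 0, with
the triangle as weight: averaging \<open>1 - Re (ft p t)\<close> against \<open>tri (t / u) / u\<close> gives the mean of \<open>1
- 2 * pi * fejer (u * x)\<close>, which is nonnegative and at least \<open>1 / 2\<close> for \<open>\<bar>x\<bar> \<ge> 3 / u\<close>.\<close>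

lemma truncation_inequality:
  assumes p: "pdf p" and u: "u > 0" and d: "\<And>t. \<bar>t\<bar> \<le> u \<Longrightarrow> 1 - Re (ft p t) \<le> d"
  shows "(\<integral>x. p x * indicator {x. \<bar>x\<bar> \<ge> 3 / u} x \<partial>lborel) \<le> 2 * d"
proof -
  note [measurable] = pdf_measurable[OF p]
  have ip: "integrable lborel p" by (rule pdf_integrable[OF p])
  have if1: "integrable lborel (\<lambda>x. p x * fejer (u * x))"
  proof (rule Bochner_Integration.integrable_bound[OF integrable_mult_left[OF ip, of "1 / (2 * pi)"]])
    show "AE x in lborel. norm (p x * fejer (u * x)) \<le> norm (p x * (1 / (2 * pi)))"
      unfolding real_norm_def abs_mult by (intro AE_I2 mult_left_mono) (auto simp: fejer_nonneg
          fejer_le)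
  qed measurable
  have itri: "integrable lborel (\<lambda>t. tri (t / u))"
    using lborel_integrable_real_affine[OF integrable_tri, of "1/u" 0] u by simp
  have vtri: "(\<integral>t. tri (t / u) \<partial>lborel) = u"
    using lborel_integral_real_affine[of "1/u" tri 0] u by (simp add: integral_tri field_simps)
  have itf: "integrable lborel (\<lambda>t. of_real (tri (t / u)) * ft p t)"
  proof (rule Bochner_Integration.integrable_bound[OF itri])
    show "AE t in lborel. norm (of_real (tri (t / u)) * ft p t) \<le> norm (tri (t / u))"
      unfolding norm_mult by (auto intro!: AE_I2 mult_right_le_one_le norm_ft_pdf p)
  qed measurable
  have "2 * pi * fejer_mean p u 0 = Re (CLINT t|lborel. of_real (tri (t / u)) * ft p t)"
    using arg_cong[OF fejer_mean_fourier[OF p u, of 0], of "\<lambda>z. Re (2 * pi * z)"] by simp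
  also have "\<dots> = (\<integral>t. tri (t / u) * Re (ft p t) \<partial>lborel)"
    using integral_Re[OF itf] by simp
  finally have sm: "2 * pi * fejer_mean p u 0 = (\<integral>t. tri (t / u) * Re (ft p t) \<partial>lborel)" .
  have irt: "integrable lborel (\<lambda>t. tri (t / u) * Re (ft p t))"
    using integrable_Re[OF itf] by simp
  have "fejer_mean p u 0 = u * (\<integral>x. p x * fejer (u * x) \<partial>lborel)"
    unfolding fejer_mean_def using lborel_integral_real_affine[of u "\<lambda>z. p (0 +
        z / u) * fejer z" 0] u by simp
  then have "u * (1 - 2 * pi * (\<integral>x. p x * fejer (u * x) \<partial>lborel)) = u - 2 * pi * fejer_mean p u 0"
    by (simp add: algebra_simps)
  also have "\<dots> = (\<integral>t. tri (t / u) \<partial>lborel) - (\<integral>t. tri (t / u) * Re (ft p t) \<partial>lborel)"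
    unfolding sm vtri ..
  also have "\<dots> = (\<integral>t. tri (t / u) * (1 - Re (ft p t)) \<partial>lborel)"
    using itri irt by (simp add: right_diff_distrib)
  also have "\<dots> \<le> (\<integral>t. tri (t / u) * d \<partial>lborel)"
  proof (intro integral_mono)
    show "integrable lborel (\<lambda>t. tri (t / u) * (1 - Re (ft p t)))" using itri irt by (simp add:
        right_diff_distrib)
    show "integrable lborel (\<lambda>t. tri (t / u) * d)" using itri by auto
    fix t
    show "tri (t / u) * (1 - Re (ft p t)) \<le> tri (t / u) * d"
    proof (cases "\<bar>t\<bar> \<le> u")
      case True then show ?thesis by (intro mult_left_mono d tri_nonneg)
    next
      case False
      then have "tri (t / u) = 0" using u by (intro tri_eq_0) (simp add: field_simps)
      then show ?thesis by simp
    qed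
  qed
  also have "\<dots> = u * d" using itri vtri by simp
  finally have A: "1 - 2 * pi * (\<integral>x. p x * fejer (u * x) \<partial>lborel) \<le> d" using u by simp
  have "(\<integral>x. p x * indicator {x. \<bar>x\<bar> \<ge> 3 / u} x \<partial>lborel) \<le>
      (\<integral>x. 2 * (p x - 2 * pi * (p x * fejer (u * x))) \<partial>lborel)"
  proof (rule integral_mono_AE')
    show "integrable lborel (\<lambda>x. 2 * (p x - 2 * pi * (p x * fejer (u * x))))" using ip if1 by auto
    show "AE x in lborel. p x * indicator {x. \<bar>x\<bar> \<ge> 3 / u} x \<le> 2 * (p x - 2 * pi * (p x * fejer (u *
        x)))"
    proof (rule AE_I2)
      fix x
      have "indicator {x. \<bar>x\<bar> \<ge> 3 / u} x \<le> 2 * (1 - 2 * pi * fejer (u * x))"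
      proof (cases "\<bar>x\<bar> \<ge> 3 / u")
        case True
        then have "3 \<le> \<bar>u * x\<bar>" using u by (simp add: field_simps abs_mult)
        then have "3\<^sup>2 \<le> \<bar>u * x\<bar>\<^sup>2" by (intro power_mono) auto
        then have "9 \<le> (u * x)\<^sup>2" by simp
        moreover have "fejer (u * x) * (pi * (u * x)\<^sup>2) \<le> 2"
          using fejer_decay[of "u * x"] \<open>3 \<le> \<bar>u * x\<bar>\<close> by (cases "u * x = 0") (auto simp: field_simps)
        moreover have "(fejer (u * x) * pi) * 9 \<le> (fejer (u * x) * pi) * (u * x)\<^sup>2"
          using \<open>9 \<le> (u * x)\<^sup>2\<close> fejer_nonneg by (intro mult_left_mono) auto
        ultimately have "(fejer (u * x) * pi) * 9 \<le> 2" unfolding mult.assoc by linarith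
        then have "4 * (pi * fejer (u * x)) \<le> 1" unfolding mult.commute[of pi] by linarith
        then show ?thesis by (simp add: indicator_def)
      next
        case False
        then show ?thesis using fejer_le[of "u * x"] by (simp add: field_simps)
      qed
      from mult_left_mono[OF this pdf_nonneg[OF p, of x]]
      show "p x * indicator {x. \<bar>x\<bar> \<ge> 3 / u} x \<le> 2 * (p x - 2 * pi * (p x * fejer (u * x)))"
        by (simp add: algebra_simps)
    qed
    show "AE x in lborel. 0 \<le> 2 * (p x - 2 * pi * (p x * fejer (u * x)))"
    proof (rule AE_I2)
      fix x
      have "p x * (2 * pi * fejer (u * x)) \<le> p x * 1"
        using fejer_le[of "u * x"] by (intro mult_left_mono pdf_nonneg[OF p]) (simp add: field_simps)
      then show "0 \<le> 2 * (p x - 2 * pi * (p x * fejer (u * x)))" by (simp add: mult_ac)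
    qed
  qed
  also have "\<dots> = 2 * (1 - 2 * pi * (\<integral>x. p x * fejer (u * x) \<partial>lborel))"
    using ip if1 pdf_integral[OF p] by simp
  also have "\<dots> \<le> 2 * d" using A by simp
  finally show ?thesis .
qed


lemma integrable_conv:
  assumes g: "pdf g" and [measurable]: "f \<in> borel_measurable borel" and B: "\<And>x. \<bar>f x\<bar> \<le> B"
  shows "integrable lborel (\<lambda>y. f (x - y) * g y)"
proof (rule Bochner_Integration.integrable_bound[OF integrable_mult_right[OF pdf_integrable[OF g],
    of B]])
  note [measurable] = pdf_measurable[OF g]
  show "(\<lambda>y. f (x - y) * g y) \<in> borel_measurable lborel" by measurable
  show "AE y in lborel. norm (f (x - y) * g y) \<le> norm (B * g y)"
    unfolding real_norm_def abs_mult 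
    by (intro AE_I2 mult_right_mono) (auto intro: order_trans[OF B])
qed

lemma conv_measurable:
  assumes g: "g \<in> borel_measurable borel" "f \<in> borel_measurable borel"
  shows "conv f g \<in> borel_measurable borel"
proof -
  note [measurable] = g
  show ?thesis unfolding conv_def[abs_def] by measurable
qed

lemma obs_law_conv:
  assumes f: "pdf f" and g: "pdf g" and B: "\<And>x. f x \<le> B"
  shows "obs_law f g = density lborel (\<lambda>x. ennreal (conv f g x))"
  unfolding obs_law_density[OF f g]
proof (rule arg_cong[of _ _ "density lborel"], rule ext)
  fix x
  have i: "integrable lborel (\<lambda>y. f (x - y) * g y)"
    using B pdf_nonneg[OF f] by (intro integrable_conv[where B=B] g pdf_measurable f) auto
  have "(\<integral>\<^sup>+y. ennreal (f (x - y)) * ennreal (g y) \<partial>lborel) = (\<integral>\<^sup>+y. ennreal (f (x - y) * g y) \<partial>lborel)"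
    by (simp add: ennreal_mult pdf_nonneg f g)
  also have "\<dots> = ennreal (conv f g x)" unfolding conv_def
    by (intro nn_integral_eq_integral i) (simp add: pdf_nonneg f g)
  finally show "(\<integral>\<^sup>+y. ennreal (f (x - y)) * ennreal (g y) \<partial>lborel) = ennreal (conv f g x)" .
qed

lemma pdf_conv:
  assumes f: "pdf f" and g: "pdf g" and B: "\<And>x. f x \<le> B"
  shows "pdf (conv f g)"
proof -
  have m: "conv f g \<in> borel_measurable borel" by (intro conv_measurable pdf_measurable f g)
  interpret prob_space "density lborel (\<lambda>x. ennreal (conv f g x))"
    using prob_space_obs_law[OF f g] unfolding obs_law_conv[OF f g B] .
  have "conv f g x \<ge> 0" for x unfolding conv_def by (simp add: pdf_nonneg f g)
  then show ?thesis using m emeasure_space_1 by (simp add: pdf_def emeasure_density)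
qed

lemma ft_conv:
  assumes f: "pdf f" and g: "pdf g" and B: "\<And>x. f x \<le> B"
  shows "ft (conv f g) t = ft f t * ft g t"
  using char_obs_law[OF f g, of t] integral_iexp_pdf[OF pdf_conv[OF f g B], of t]
  unfolding obs_law_conv[OF f g B] by simp

lemma conv_add:
  assumes g: "pdf g" and "f \<in> borel_measurable borel" "\<And>x. \<bar>f x\<bar> \<le> B"
    and "h \<in> borel_measurable borel" "\<And>x. \<bar>h x\<bar> \<le> C"
  shows "conv (\<lambda>x. f x + h x) g x = conv f g x + conv h g x"
  unfolding conv_def distrib_right
  by (intro Bochner_Integration.integral_add integrable_conv[OF g]) (use assms in auto)

lemma abs_perturbation_bounded: "\<bar>perturbation b x\<bar> \<le> 1 / (2 * pi)"
  using abs_perturbation_le[of b x] fejer_le[of x] fejer_nonneg[of x] by linarith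

lemma abs_conv_perturbation_le:
  assumes g: "pdf g"
  shows "\<bar>conv (perturbation b) g x\<bar> \<le> conv fejer g x / 2"
proof -
  have i1: "integrable lborel (\<lambda>y. perturbation b (x - y) * g y)" by (intro integrable_conv[OF g,
      where B="1/(2*pi)"] abs_perturbation_bounded) measurable
  have i2: "integrable lborel (\<lambda>y. fejer (x - y) * g y)" by (intro integrable_conv[OF g,
      where B="1/(2*pi)"]) (auto simp: fejer_nonneg fejer_le)
  have "\<bar>conv (perturbation b) g x\<bar> \<le> (\<integral>y. \<bar>perturbation b (x - y) * g y\<bar> \<partial>lborel)"
    unfolding conv_def by (rule integral_abs_bound)
  also have "\<dots> \<le> (\<integral>y. (fejer (x - y) * g y) / 2 \<partial>lborel)"
  proof (rule integral_mono)
    fix y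
    show "\<bar>perturbation b (x - y) * g y\<bar> \<le> (fejer (x - y) * g y) / 2"
      using mult_right_mono[OF abs_perturbation_le[of b "x - y"] pdf_nonneg[OF g,
          of y]] pdf_nonneg[OF g, of y]
      by (simp add: abs_mult)
  qed (use i1 i2 in auto)
  finally show ?thesis by (simp add: conv_def)
qed

lemma integrable_conv_perturbation:
  assumes g: "pdf g"
  shows "integrable lborel (conv (perturbation b) g)"
proof (rule Bochner_Integration.integrable_bound[OF pdf_integrable[OF pdf_conv[OF pdf_fejer g
    fejer_le]]])
  show "conv (perturbation b) g \<in> borel_measurable lborel" using conv_measurable[OF
      pdf_measurable[OF g] perturbation_measurable] by simp
  show "AE x in lborel. norm (conv (perturbation b) g x) \<le> norm (conv fejer g x)"
    using abs_conv_perturbation_le[OF g] pdf_nonneg[OF pdf_conv[OF pdf_fejer g fejer_le]]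
    by (intro AE_I2) (smt (verit) real_norm_def field_sum_of_halves)
qed

lemma conv_perturbation_L1_half:
  assumes g: "pdf g"
  shows "(\<integral>x. \<bar>conv (perturbation b) g x\<bar> \<partial>lborel) \<le> 1 / 2"
proof -
  note pc = pdf_conv[OF pdf_fejer g fejer_le]
  have "(\<integral>x. \<bar>conv (perturbation b) g x\<bar> \<partial>lborel) \<le> (\<integral>x. conv fejer g x / 2 \<partial>lborel)"
    using integrable_conv_perturbation[OF g] pdf_integrable[OF pc] abs_conv_perturbation_le[OF g] by
        (intro integral_mono) auto
  then show ?thesis using pdf_integral[OF pc] by simp
qed

text \<open>Split at \<open>\<bar>x\<bar> = 3 / u\<close>. On the bounded part the uniform bound is integrated; on the tail the
perturbation is dominated by half the density of an observation, whose tail is controlled by its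
characteristic function.\<close>

lemma conv_perturbation_L1_bound:
  assumes g: "pdf g" and u: "u > 0" and e: "\<And>t. \<bar>t\<bar> \<ge> b - 1 \<Longrightarrow> cmod (ft g t) \<le> e"
    and d: "\<And>t. \<bar>t\<bar> \<le> u \<Longrightarrow> 1 - Re (of_real (tri t) * ft g t) \<le> d"
  shows "(\<integral>x. \<bar>conv (perturbation b) g x\<bar> \<partial>lborel) \<le> e / (2 * u) + d"
proof -
  note pc = pdf_conv[OF pdf_fejer g fejer_le]
  let ?p = "conv fejer g" and ?A = "{x::real. \<bar>x\<bar> \<ge> 3 / u}"
  have [measurable]: "?p \<in> borel_measurable borel" by (rule pdf_measurable[OF pc])
  have e0: "e \<ge> 0" using order_trans[OF norm_ge_zero e[of b]] by simp
  have iA: "integrable lborel (\<lambda>x. ?p x * indicator ?A x)"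
    by (intro integrable_mult_indicator[of ?A lborel ?p, simplified mult.commute real_scaleR_def] )
        (use pdf_integrable[OF pc] in auto)
  have tail: "(\<integral>x. ?p x * indicator ?A x \<partial>lborel) \<le> 2 * d"
  proof (rule truncation_inequality[OF pc u])
    fix t assume "\<bar>t\<bar> \<le> u"
    from d[OF this] show "1 - Re (ft ?p t) \<le> d" unfolding ft_conv[OF pdf_fejer g fejer_le] ft_fejer .
  qed
  have iI: "integrable lborel (indicator {-(3/u)..3/u} :: real \<Rightarrow> real)"
    by (rule integrable_real_indicator) (auto simp: emeasure_lborel_Icc_eq)
  have mI: "(\<integral>x. indicator {-(3/u)..3/u} x \<partial>lborel) = 6 / u" using u by simp
  have "(\<integral>x. \<bar>conv (perturbation b) g x\<bar> \<partial>lborel) \<le> (\<integral>x. e / (4 * pi) * indicator {-(3/u)..3/u} x +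
      (1 / 2) * (?p x * indicator ?A x) \<partial>lborel)"
  proof (rule integral_mono)
    show "integrable lborel (\<lambda>x. \<bar>conv (perturbation b) g x\<bar>)" using integrable_conv_perturbation[OF
        g] by simp
    show "integrable lborel (\<lambda>x. e / (4 * pi) * indicator {-(3/u)..3/u} x + (1 / 2) * (?p x *
        indicator ?A x))"
      using iA iI by (intro Bochner_Integration.integrable_add integrable_mult_right)
    fix x
    show "\<bar>conv (perturbation b) g x\<bar> \<le> e / (4 * pi) * indicator {-(3/u)..3/u} x + (1 / 2) * (?p x *
        indicator ?A x)"
    proof (cases "x \<in> ?A")
      case True
      then show ?thesis using abs_conv_perturbation_le[OF g, of b x] e0
        by (simp add: add_increasing)
    next
      case False
      then have "x \<in> {-(3/u)..3/u}" by (auto simp: abs_le_iff)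
      then show ?thesis using abs_conv_perturbation_le_sup[OF g e, where x=x] False by simp
    qed
  qed
  also have "\<dots> = e / (4 * pi) * (6 / u) + (1 / 2) * (\<integral>x. ?p x * indicator ?A x \<partial>lborel)"
    using iA iI by (subst Bochner_Integration.integral_add) (auto simp only:
        integral_mult_right_zero mI intro!: integrable_mult_right)
  also have "e / (4 * pi) * (6 / u) \<le> e / (2 * u)"
  proof -
    have "e / (4 * pi) * (6 / u) = (e / u) * (3 / (2 * pi))" by (simp add: field_simps)
    also have "\<dots> \<le> (e / u) * (1 / 2)" using e0 u pi_gt3 by (intro mult_left_mono) (auto simp:
        field_simps)
    finally show ?thesis by simp
  qed
  finally show ?thesis using tail by simp
qed

section \<open>The two-point lower bound\<close>

text \<open>Densities turn both data laws into weights on the same Lebesgue measure, where they can be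
compared pointwise.\<close>

lemma PiM_density:
  fixes p :: "'i \<Rightarrow> 'a \<Rightarrow> ennreal"
  assumes I: "finite I" and N: "sigma_finite_measure N" and [measurable]: "\<And>i. i \<in> I \<Longrightarrow>
      p i \<in> borel_measurable N"
    and P: "\<And>i. i \<in> I \<Longrightarrow> prob_space (density N (p i))"
  shows "PiM I (\<lambda>i. density N (p i)) = density (PiM I (\<lambda>_. N)) (\<lambda>y. \<Prod>i\<in>I. p i (y i))"
proof -
  define M where "M i = (if i \<in> I then density N (p i) else N)" for i
  have "sigma_finite_measure (M i)" for i
    unfolding M_def using N P by (auto intro: finite_measure.axioms prob_space.axioms)
  then interpret M: product_sigma_finite M by (simp add: product_sigma_finite_def)
  interpret N: product_sigma_finite "\<lambda>_::'i. N" by (simp add: product_sigma_finite_def N)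
  have "density (PiM I (\<lambda>_. N)) (\<lambda>y. \<Prod>i\<in>I. p i (y i)) = PiM I M"
  proof (rule M.PiM_eqI[OF I])
    have "sets (PiM I M) = sets (PiM I (\<lambda>_. N))" by (intro sets_PiM_cong) (auto simp: M_def)
    then show "sets (density (PiM I (\<lambda>_. N)) (\<lambda>y. \<Prod>i\<in>I. p i (y i))) = sets (PiM I M)" by simp
    fix A assume A': "\<And>i. i \<in> I \<Longrightarrow> A i \<in> sets (M i)"
    have A[measurable]: "A i \<in> sets N" if "i \<in> I" for i using A'[OF that] that by (simp add: M_def)
    have [measurable]: "(\<lambda>y. \<Prod>i\<in>I. p i (y i)) \<in> borel_measurable (PiM I (\<lambda>_. N))"
      by (intro borel_measurable_prod_ennreal measurable_compose[OF measurable_component_singleton])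
          auto
    have ind: "(\<Prod>i\<in>I. indicator (A i) (y i)) = (indicator (Pi\<^sub>E I A) y :: ennreal)" if "y \<in> space
        (PiM I (\<lambda>_. N))" for y
      using that I by (auto simp: indicator_def PiE_iff space_PiM intro!: prod_zero)
    have "emeasure (density (PiM I (\<lambda>_. N)) (\<lambda>y. \<Prod>i\<in>I. p i (y i))) (Pi\<^sub>E I A) =
        (\<integral>\<^sup>+y. (\<Prod>i\<in>I. p i (y i)) * indicator (Pi\<^sub>E I A) y \<partial>PiM I (\<lambda>_. N))"
      by (rule emeasure_density) (auto intro: sets_PiM_I_finite[OF I])
    also have "\<dots> = (\<integral>\<^sup>+y. (\<Prod>i\<in>I. p i (y i) * indicator (A i) (y i)) \<partial>PiM I (\<lambda>_. N))"
      by (intro nn_integral_cong) (simp add: prod.distrib ind)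
    also have "\<dots> = (\<Prod>i\<in>I. \<integral>\<^sup>+y. p i y * indicator (A i) y \<partial>N)"
      by (rule N.product_nn_integral_prod[OF I]) auto
    also have "\<dots> = (\<Prod>i\<in>I. emeasure (M i) (A i))"
      by (intro prod.cong refl) (simp add: M_def emeasure_density)
    finally show "emeasure (density (PiM I (\<lambda>_. N)) (\<lambda>y. \<Prod>i\<in>I. p i (y i))) (Pi\<^sub>E I A) =
        (\<Prod>i\<in>I. emeasure (M i) (A i))" .
  qed
  moreover have "PiM I M = PiM I (\<lambda>i. density N (p i))" by (intro PiM_cong) (auto simp: M_def)
  ultimately show ?thesis by simp
qed

lemma data_law_density:
  assumes f: "pdf f" and fe: "\<And>j. j \<in> {1..n} \<Longrightarrow> pdf (fe j)" and B: "\<And>x. f x \<le> B"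
  shows "data_law n f fe = density (PiM {1..n} (\<lambda>_. lborel)) (\<lambda>y. \<Prod>j\<in>{1..n}. ennreal (conv f (fe j)
      (y j)))"
proof -
  have "data_law n f fe = PiM {1..n} (\<lambda>j. density lborel (\<lambda>x. ennreal (conv f (fe j) x)))"
    by (subst data_law_eq_PiM[OF f fe], assumption) (intro PiM_cong refl obs_law_conv[OF f fe B])
  also have "\<dots> = density (PiM {1..n} (\<lambda>_. lborel)) (\<lambda>y. \<Prod>j\<in>{1..n}. ennreal (conv f (fe j) (y j)))"
  proof (rule PiM_density)
    fix j assume "j \<in> {1..n}"
    then have pc: "pdf (conv f (fe j))" by (intro pdf_conv[OF f fe B])
    then show "prob_space (density lborel (\<lambda>x. ennreal (conv f (fe j) x)))" by (rule prob_space_pdf)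
    show "(\<lambda>x. ennreal (conv f (fe j) x)) \<in> borel_measurable lborel" using pdf_measurable[OF pc] by simp
  qed (auto intro: lborel.sigma_finite_measure_axioms)
  finally show ?thesis .
qed

text \<open>The product of the minima of the marginal densities lies below both joint densities, and
under this common measure the squared errors for \<open>f\<close> and \<open>g\<close> add up to at least half the squared
distance of \<open>f\<close> and \<open>g\<close>. The common measure is a product, so its mass is the product of the
overlaps.\<close>

lemma two_point_lower_bound:
  assumes f: "pdf f" and fB: "\<And>x. f x \<le> B" and g: "pdf g" and gB: "\<And>x. g x \<le> B"
    and fe: "\<And>j. j \<in> {1..n} \<Longrightarrow> pdf (fe j)" and est: "estimator n est"
    and x: "\<And>j. j \<in> {1..n} \<Longrightarrow> (\<integral>z. \<bar>conv g (fe j) z - conv f (fe j) z\<bar> \<partial>lborel) \<le>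
        x j" and x1: "\<And>j. j \<in> {1..n} \<Longrightarrow> x j \<le> 1"
  shows "(\<integral>\<^sup>+z. ennreal ((g z - f z)\<^sup>2) \<partial>lborel) * ennreal (\<Prod>j=1..n. 1 - x j) \<le>
      2 * (mise n f fe est + mise n g fe est)"
proof -
  note [measurable] = pdf_measurable[OF f] pdf_measurable[OF g]
  let ?L = "PiM {1..n} (\<lambda>_. lborel :: real measure)"
  have sL: "sets ?L = sets (\<Pi>\<^sub>M j\<in>{1..n}. (borel :: real measure))" by (intro sets_PiM_cong) auto
  interpret L: product_sigma_finite "\<lambda>_::nat. lborel :: real measure" by standard
  define p q m where "p j = conv f (fe j)" and "q j = conv g (fe j)" and "m j z =
      min (p j z) (q j z)" for j z
  have pp: "pdf (p j)" "pdf (q j)" if "j \<in> {1..n}" for j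
    unfolding p_def q_def using that by (auto intro!: pdf_conv[OF f fe fB] pdf_conv[OF g fe gB])
  define F where "F h y = (\<integral>\<^sup>+z. ennreal ((cmod (est y z - complex_of_real (h z)))\<^sup>2) \<partial>lborel)" for
      h :: "real \<Rightarrow> real" and y
  have em: "(\<lambda>(y, z). est y z) \<in> borel_measurable (?L \<Otimes>\<^sub>M lborel)"
  proof -
    have "sets (?L \<Otimes>\<^sub>M (lborel :: real measure)) = sets ((\<Pi>\<^sub>M j\<in>{1..n}. (borel :: real measure)) \<Otimes>\<^sub>M
        (borel :: real measure))"
      by (intro sets_pair_measure_cong sL) auto
    from measurable_cong_sets[OF this refl] show ?thesis using est unfolding estimator_def by blast
  qed
  have Fm: "F h \<in> borel_measurable ?L" if [measurable]: "h \<in> borel_measurable borel" for h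
  proof -
    have "(\<lambda>p. ennreal ((cmod (est (fst p) (snd p) - complex_of_real (h (snd p))))\<^sup>2)) \<in>
        borel_measurable (?L \<Otimes>\<^sub>M lborel)"
    proof -
      have "(\<lambda>p. est (fst p) (snd p)) \<in> borel_measurable (?L \<Otimes>\<^sub>M lborel)"
        using em by (simp add: case_prod_unfold)
      moreover have "(\<lambda>p. h (snd p)) \<in> borel_measurable (?L \<Otimes>\<^sub>M lborel)"
        by (intro measurable_compose[OF measurable_snd]) auto
      ultimately show ?thesis by measurable
    qed
    from lborel.borel_measurable_nn_integral_fst[OF this] show ?thesis unfolding F_def[abs_def] by simp
  qed
  have prodm: "(\<lambda>y. \<Prod>j\<in>{1..n}. ennreal (k j (y j))) \<in> borel_measurable ?L" if "\<And>j. j \<in> {1..n} \<Longrightarrow>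
      k j \<in> borel_measurable borel" for k :: "nat \<Rightarrow> real \<Rightarrow> real"
    using that by (intro borel_measurable_prod_ennreal measurable_compose[OF
        measurable_component_singleton]) auto
  have mm: "m j \<in> borel_measurable borel" if "j \<in> {1..n}" for j
    unfolding m_def[abs_def] using pp[OF that] by (intro borel_measurable_min pdf_measurable)
  have mise: "mise n h fe est = (\<integral>\<^sup>+y. (\<Prod>j\<in>{1..n}. ennreal (conv h (fe j) (y j))) * F h y \<partial>?L)"
    if h: "pdf h" and hB: "\<And>x. h x \<le> B" for h
    unfolding mise_def F_def[symmetric]
    by (subst data_law_density[OF h fe hB], assumption, rule nn_integral_density[OF prodm Fm])
       (auto intro!: pdf_measurable pdf_conv[OF h fe hB] h)
  have split: "(\<integral>\<^sup>+z. ennreal ((g z - f z)\<^sup>2) \<partial>lborel) \<le> 2 * (F f y + F g y)" if y: "y \<in> space ?L" for y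
  proof -
    have ym: "(\<lambda>z. est y z) \<in> borel_measurable lborel"
      using measurable_compose[OF measurable_Pair1'[OF y] em] by simp
    have "(\<integral>\<^sup>+z. ennreal ((g z - f z)\<^sup>2) \<partial>lborel) \<le>
        (\<integral>\<^sup>+z. 2 * (ennreal ((cmod (est y z - complex_of_real (f z)))\<^sup>2) + ennreal ((cmod (est y z -
        complex_of_real (g z)))\<^sup>2)) \<partial>lborel)"
    proof (intro nn_integral_mono)
      fix z
      let ?a = "cmod (est y z - complex_of_real (f z))" and ?b =
          "cmod (est y z - complex_of_real (g z))"
      have "\<bar>g z - f z\<bar> = cmod ((est y z - complex_of_real (f z)) - (est y z - complex_of_real (g z)))"
        by (simp flip: of_real_diff)
      also have "\<dots> \<le> ?a + ?b" by (rule norm_triangle_ineq4)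
      finally have "\<bar>g z - f z\<bar>\<^sup>2 \<le> (?a + ?b)\<^sup>2" by (intro power_mono) auto
      also have "\<dots> \<le> 2 * (?a\<^sup>2 + ?b\<^sup>2)" using sum_squares_bound[of ?a ?b] by (simp add: power2_sum)
      finally have "ennreal ((g z - f z)\<^sup>2) \<le> ennreal (2 * (?a\<^sup>2 + ?b\<^sup>2))" by (intro ennreal_leI) simp
      then show "ennreal ((g z - f z)\<^sup>2) \<le> 2 * (ennreal (?a\<^sup>2) + ennreal (?b\<^sup>2))"
        by (simp add: ennreal_mult')
    qed
    also have "\<dots> = 2 * (F f y + F g y)"
      unfolding F_def using ym by (subst nn_integral_cmult) (auto simp: nn_integral_add)
    finally show ?thesis .
  qed
  have mass: "ennreal (1 - x j) \<le> (\<integral>\<^sup>+z. ennreal (m j z) \<partial>lborel)" if j: "j \<in> {1..n}" for j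
  proof -
    have ip: "integrable lborel (p j)" "integrable lborel (q j)" using pp[OF j] by (auto intro:
        pdf_integrable)
    have im: "integrable lborel (m j)" unfolding m_def[abs_def] using ip by (intro integrable_min)
    have "1 - x j \<le> 1 - (\<integral>z. \<bar>q j z - p j z\<bar> \<partial>lborel)" using x[OF j] by (simp add: p_def q_def)
    also have "\<dots> = (\<integral>z. p j z - \<bar>q j z - p j z\<bar> \<partial>lborel)"
      using ip pdf_integral[OF pp(1)[OF j]] by simp
    also have "\<dots> \<le> (\<integral>z. m j z \<partial>lborel)" using ip im by (intro integral_mono) (auto simp: m_def)
    finally have "ennreal (1 - x j) \<le> ennreal (\<integral>z. m j z \<partial>lborel)" by (rule ennreal_leI)
    also have "\<dots> = (\<integral>\<^sup>+z. ennreal (m j z) \<partial>lborel)"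
      using pp[OF j] by (intro nn_integral_eq_integral[symmetric] im) (auto simp: m_def pdf_nonneg)
    finally show ?thesis .
  qed
  let ?c = "(\<integral>\<^sup>+z. ennreal ((g z - f z)\<^sup>2) \<partial>lborel)"
  have "?c * ennreal (\<Prod>j=1..n. 1 - x j) = ?c * (\<Prod>j\<in>{1..n}. ennreal (1 - x j))"
    using x1 by (subst prod_ennreal) auto
  also have "\<dots> \<le> ?c * (\<Prod>j\<in>{1..n}. \<integral>\<^sup>+z. ennreal (m j z) \<partial>lborel)"
    by (intro mult_left_mono prod_mono_ennreal mass) auto
  also have "\<dots> = ?c * (\<integral>\<^sup>+y. (\<Prod>j\<in>{1..n}. ennreal (m j (y j))) \<partial>?L)"
    using mm by (subst L.product_nn_integral_prod) auto
  also have "\<dots> = (\<integral>\<^sup>+y. ?c * (\<Prod>j\<in>{1..n}. ennreal (m j (y j))) \<partial>?L)"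
    by (rule nn_integral_cmult[symmetric, OF prodm[OF mm]])
  also have "\<dots> \<le> (\<integral>\<^sup>+y. 2 * ((\<Prod>j\<in>{1..n}. ennreal (p j (y j))) * F f y + (\<Prod>j\<in>{1..n}. ennreal (q j (y
      j))) * F g y) \<partial>?L)"
  proof (intro nn_integral_mono)
    fix y assume y: "y \<in> space ?L"
    have "?c * (\<Prod>j\<in>{1..n}. ennreal (m j (y j))) \<le> (2 * (F f y + F g y)) * (\<Prod>j\<in>{1..n}. ennreal (m j
        (y j)))"
      by (intro mult_right_mono split[OF y]) simp
    also have "\<dots> = 2 * ((\<Prod>j\<in>{1..n}. ennreal (m j (y j))) * F f y + (\<Prod>j\<in>{1..n}. ennreal (m j (y j)))
        * F g y)"
      by (simp add: algebra_simps)
    also have "\<dots> \<le> 2 * ((\<Prod>j\<in>{1..n}. ennreal (p j (y j))) * F f y + (\<Prod>j\<in>{1..n}. ennreal (q j (y j)))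
        * F g y)"
      by (intro mult_left_mono add_mono mult_right_mono prod_mono_ennreal) (auto simp: m_def intro!:
          ennreal_leI)
    finally show "?c * (\<Prod>j\<in>{1..n}. ennreal (m j (y j))) \<le> 2 * ((\<Prod>j\<in>{1..n}. ennreal (p j (y j))) *
        F f y + (\<Prod>j\<in>{1..n}. ennreal (q j (y j))) * F g y)" .
  qed
  also have "\<dots> = 2 * (mise n f fe est + mise n g fe est)"
  proof -
    have a: "(\<lambda>y. (\<Prod>j\<in>{1..n}. ennreal (p j (y j))) * F f y) \<in> borel_measurable ?L" "(\<lambda>y. (\<Prod>j\<in>{1..n}.
        ennreal (q j (y j))) * F g y) \<in> borel_measurable ?L"
      by (intro borel_measurable_times_ennreal prodm Fm pdf_measurable pp f g; assumption)+
    show ?thesis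
      unfolding mise[OF f fB] mise[OF g gB] p_def[symmetric] q_def[symmetric]
      using a by (subst nn_integral_cmult) (auto simp: nn_integral_add)
  qed
  finally show ?thesis .
qed

lemma ft_perturbed_fejer: "ft (perturbed_fejer b) t = of_real (tri t + (tri (t + b) + tri (t - b)) / 4)"
proof -
  have i: "integrable lborel (\<lambda>x. iexp (t * x) * complex_of_real (h x))" if "integrable lborel h" for h
    using that by (intro integrable_iexp_mult) auto
  have "ft (perturbed_fejer b) t = ft fejer t + ft (perturbation b) t"
    unfolding ft_def perturbed_fejer_def of_real_add distrib_left
    by (rule Bochner_Integration.integral_add[OF i[OF integrable_fejer] i[OF integrable_perturbation]])
  then show ?thesis by (simp add: ft_fejer ft_perturbation)
qed

lemma pdf_perturbed_fejer:
  assumes "b \<ge> 1"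
  shows "pdf (perturbed_fejer b)"
proof (rule pdfI)
  show i: "integrable lborel (perturbed_fejer b)" unfolding perturbed_fejer_def[abs_def] using
      integrable_fejer integrable_perturbation by auto
  show "0 \<le> perturbed_fejer b x" for x using abs_perturbation_le[of b x] fejer_nonneg[of x]
      unfolding perturbed_fejer_def by linarith
  have "complex_of_real (integral\<^sup>L lborel (perturbed_fejer b)) =
      ft (perturbed_fejer b) 0" by (simp add: ft_def)
  also have "\<dots> = 1" using assms by (simp add: ft_perturbed_fejer tri_eq_0)
  finally show "integral\<^sup>L lborel (perturbed_fejer b) = 1" by simp
qed

lemma perturbed_fejer_le: "perturbed_fejer b x \<le> 1 / pi"
proof -
  have "perturbed_fejer b x \<le> 2 * fejer x" using abs_perturbation_le[of b x] fejer_nonneg[of x]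
      unfolding perturbed_fejer_def by linarith
  also have "\<dots> \<le> 1 / pi" using fejer_le[of x] by (simp add: field_simps)
  finally show ?thesis .
qed

lemma sobolev_bandlimited:
  assumes f: "pdf f" and c: "\<And>t. \<bar>t\<bar> > c \<Longrightarrow> ft f t = 0" "c \<ge> 0" and \<beta>: "\<beta> > 0"
    and C: "2 * c * (1 + c\<^sup>2) powr \<beta> \<le> C"
  shows "f \<in> sobolev_class \<beta> C"
proof -
  have "(\<integral>\<^sup>+t. ennreal ((cmod (ft f t))\<^sup>2 * (1 + t\<^sup>2) powr \<beta>) \<partial>lborel) \<le> (\<integral>\<^sup>+t. ennreal ((1 +
      c\<^sup>2) powr \<beta>) * indicator {-c..c} t \<partial>lborel)"
  proof (intro nn_integral_mono)
    fix t
    show "ennreal ((cmod (ft f t))\<^sup>2 * (1 + t\<^sup>2) powr \<beta>) \<le>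
        ennreal ((1 + c\<^sup>2) powr \<beta>) * indicator {-c..c} t"
    proof (cases "t \<in> {-c..c}")
      case True
      then have "t\<^sup>2 \<le> c\<^sup>2" by (intro abs_le_square_iff[THEN iffD1]) (auto simp: abs_le_iff)
      then have "(1 + t\<^sup>2) powr \<beta> \<le> (1 + c\<^sup>2) powr \<beta>" using \<beta> by (intro powr_mono2) (auto simp:
          add_nonneg_nonneg)
      moreover have "(cmod (ft f t))\<^sup>2 \<le> 1" using norm_ft_pdf[OF f, of t] by (simp add: power_le_one)
      ultimately have "(cmod (ft f t))\<^sup>2 * (1 + t\<^sup>2) powr \<beta> \<le>
          1 * (1 + c\<^sup>2) powr \<beta>" by (intro mult_mono) auto
      then show ?thesis using True by (simp add: ennreal_leI)
    next
      case False
      then have "\<bar>t\<bar> > c" by auto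
      then show ?thesis by (simp add: c)
    qed
  qed
  also have "\<dots> = ennreal ((1 + c\<^sup>2) powr \<beta> * (2 * c))"
    using c(2) by (subst nn_integral_cmult_indicator) (auto simp: ennreal_mult'[symmetric])
  also have "\<dots> \<le> ennreal C" using C by (intro ennreal_leI) (simp add: mult_ac)
  finally show ?thesis using f by (simp add: sobolev_class_def)
qed

text \<open>A function vanishing almost everywhere has a vanishing transform, but the transform of the
perturbation equals \<open>1 / 4\<close> at the frequency \<open>b\<close>.\<close>

lemma perturbation_energy_pos: 
  assumes "b \<ge> 1"
  shows "(\<integral>\<^sup>+z. ennreal ((perturbation b z)\<^sup>2) \<partial>lborel) > 0"
proof (rule ccontr)
  assume "\<not> ?thesis"
  then have "(\<integral>\<^sup>+z. ennreal ((perturbation b z)\<^sup>2) \<partial>lborel) = 0" by simp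
  then have "AE z in lborel. ennreal ((perturbation b z)\<^sup>2) =
      0" by (subst (asm) nn_integral_0_iff_AE) auto
  then have "AE z in lborel. iexp (b * z) * of_real (perturbation b z) = 0" by eventually_elim simp
  then have "ft (perturbation b) b = (CLINT z|(lborel :: real measure). 0)" unfolding ft_def by
      (intro integral_cong_AE) auto
  moreover have "ft (perturbation b) b = of_real (1 / 4)" using assms by (simp add: ft_perturbation
      tri_eq_0)
  ultimately show False by simp
qed

text \<open>Choose the truncation frequency \<open>u = exp (- 2 * v)\<close> with \<open>v = s * \<omega> powr \<gamma>\<close>. Frequencies
above \<open>6 * \<omega>\<close> are damped by a factor of at most \<open>exp (- 3 * v)\<close>, because \<open>6 powr \<gamma> \<ge> 6\<close>; this pays
for the factor \<open>1 / u\<close> and leaves \<open>exp (- v)\<close>. The tail is of order \<open>u * (1 + s)\<close>, and half of the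
exponential decay of \<open>u\<close> absorbs the factor \<open>s\<close>.\<close>

lemma conv_perturbation_L1_stretched:
  assumes g: "pdf g" and \<gamma>: "\<gamma> \<ge> 1" and s: "s \<ge> 0" and \<omega>: "\<omega> > 0"
    and ft: "\<And>t. ft g t = complex_of_real (exp (- (s * \<bar>t\<bar> powr \<gamma> / 2)))"
  shows "(\<integral>x. \<bar>conv (perturbation (6 * \<omega> + 1)) g x\<bar> \<partial>lborel) \<le>
      (2 + 1 / (2 * \<omega> powr \<gamma>)) * exp (- (s * \<omega> powr \<gamma>))"
proof -
  define v where "v = s * \<omega> powr \<gamma>"
  have v: "v \<ge> 0" using s by (simp add: v_def)
  define u where "u = exp (- 2 * v)"
  have u: "u > 0" "u \<le> 1" using v by (auto simp: u_def)
  have "(\<integral>x. \<bar>conv (perturbation (6 * \<omega> + 1)) g x\<bar> \<partial>lborel) \<le> exp (- 3 * v) / (2 * u) + (u + s * u / 2)"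
  proof (rule conv_perturbation_L1_bound[OF g u(1)])
    fix t :: real assume "\<bar>t\<bar> \<ge> 6 * \<omega> + 1 - 1"
    then have "(6 * \<omega>) powr \<gamma> \<le> \<bar>t\<bar> powr \<gamma>" using \<omega> \<gamma> by (intro powr_mono2) auto
    moreover have "6 * \<omega> powr \<gamma> \<le> (6 * \<omega>) powr \<gamma>"
    proof -
      have "6 powr 1 \<le> (6::real) powr \<gamma>" using \<gamma> by (intro powr_mono) auto
      then show ?thesis using \<omega> by (simp add: powr_mult mult_right_mono)
    qed
    ultimately have "6 * \<omega> powr \<gamma> \<le> \<bar>t\<bar> powr \<gamma>" by linarith
    then have "s * (6 * \<omega> powr \<gamma>) \<le> s * \<bar>t\<bar> powr \<gamma>" using s by (intro mult_left_mono) auto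
    then have "3 * v \<le> s * \<bar>t\<bar> powr \<gamma> / 2" by (simp add: v_def)
    then show "cmod (ft g t) \<le> exp (- 3 * v)" unfolding ft norm_of_real by simp
  next
    fix t assume t: "\<bar>t\<bar> \<le> u"
    define e where "e = exp (- (s * \<bar>t\<bar> powr \<gamma> / 2))"
    have tg: "\<bar>t\<bar> powr \<gamma> \<le> u"
    proof (cases "t = 0")
      case False
      \<comment> \<open>Near 0 the exponent is at most linear in \<open>\<bar>t\<bar>\<close>, because \<open>\<gamma> \<ge> 1\<close>.\<close>
      have "\<bar>t\<bar> powr \<gamma> \<le> \<bar>t\<bar> powr 1" using False t u \<gamma> by (intro powr_mono') auto
      then show ?thesis using t by simp
    qed (use u in simp)
    have "1 - tri t \<le> u" using t by (simp add: tri_def)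
    moreover have "1 - e \<le> s * u / 2"
    proof -
      have "1 + (- (s * \<bar>t\<bar> powr \<gamma> / 2)) \<le> e" unfolding e_def by (rule exp_ge_add_one_self)
      moreover have "s * \<bar>t\<bar> powr \<gamma> \<le> s * u" using s tg by (intro mult_left_mono)
      ultimately show ?thesis by simp
    qed
    moreover have "1 - tri t * e \<le> (1 - tri t) + (1 - e)"
    proof -
      have "e \<le> 1" using s by (simp add: e_def)
      then have "0 \<le> (1 - tri t) * (1 - e)" using tri_le_1[of t] by simp
      then show ?thesis by (simp add: algebra_simps)
    qed
    ultimately show "1 - Re (of_real (tri t) * ft g t) \<le>
        u + s * u / 2" by (simp add: ft e_def[symmetric])
  qed
  also have "exp (- 3 * v) / (2 * u) = exp (- v) / 2"
    by (simp add: u_def exp_minus exp_add[symmetric] field_simps)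
  also have "exp (- v) / 2 + (u + s * u / 2) \<le> (2 + 1 / (2 * \<omega> powr \<gamma>)) * exp (- v)"
  proof -
    have uv: "u = exp (- v) * exp (- v)" by (simp add: u_def exp_add[symmetric])
    have e1: "exp (- v) \<le> 1" using v by simp
    have "v \<le> exp v" using exp_ge_add_one_self[of v] by linarith
    then have "v * exp (- v) \<le> 1" by (simp add: exp_minus field_simps)
    then have "v * exp (- v) * exp (- v) \<le> 1 * exp (- v)" by (intro mult_right_mono) auto
    then have "(v * u) / (2 * \<omega> powr \<gamma>) \<le> exp (- v) / (2 * \<omega> powr \<gamma>)" unfolding uv using \<omega> by (intro
        divide_right_mono) (auto simp: mult_ac)
    moreover have "s * u / 2 = (v * u) / (2 * \<omega> powr \<gamma>)" using \<omega> by (simp add: v_def field_simps)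
    moreover have "u \<le> 1 * exp (- v)" unfolding uv using e1 by (intro mult_right_mono) auto
    moreover have "(2 + 1 / (2 * \<omega> powr \<gamma>)) * exp (- v) =
        2 * exp (- v) + exp (- v) / (2 * \<omega> powr \<gamma>)" by (simp add: algebra_simps)
    ultimately show ?thesis using exp_ge_zero[of "- v"] by linarith
  qed
  finally show ?thesis by (simp add: v_def)
qed

lemma exp_le_one_minus:
  assumes "0 \<le> x" "x \<le> 1 / (2::real)"
  shows "exp (- 2 * x) \<le> 1 - x"
proof -
  have "2 * x\<^sup>2 \<le> x" using assms mult_left_mono[of x "1/2" x] by (simp add: power2_eq_square)
  then have "- 2 * x \<le> ln (1 - x)" using ln_one_minus_pos_lower_bound[OF assms] by linarith
  then have "exp (- 2 * x) \<le> exp (ln (1 - x))" by simp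
  then show ?thesis using assms by simp
qed

section \<open>Consistency and inconsistency\<close>

theorem theorem3p3:
  fixes \<gamma> :: real
    and \<sigma> :: "nat \<Rightarrow> nat \<Rightarrow> real"
    and fe :: "nat \<Rightarrow> nat \<Rightarrow> real \<Rightarrow> real"
  assumes "\<gamma> \<ge> 1"
    and "\<And>n j. j \<in> {1..n} \<Longrightarrow> \<sigma> n j > 0"
    and "\<not> bdd_above {\<sigma> n j | n j. j \<in> {1..n}}"
    and "\<And>n j. j \<in> {1..n} \<Longrightarrow> pdf (fe n j)"
    and "\<And>n j x. j \<in> {1..n} \<Longrightarrow> fe n j (- x) = fe n j x"
    and "\<And>n j t. j \<in> {1..n} \<Longrightarrow>
           ft (fe n j) t = complex_of_real (exp (- (\<sigma> n j powr \<gamma> * \<bar>t\<bar> powr \<gamma> / 2)))"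
  defines "star \<equiv> (\<forall>\<omega>>0. filterlim (\<lambda>n. \<Sum>j=1..n. exp (- (\<sigma> n j powr \<gamma> * \<omega> powr \<gamma>))) at_top sequentially)"
  shows "(star \<longrightarrow>
            (\<exists>(w :: nat \<Rightarrow> real) (K :: real \<Rightarrow> real).
               (\<forall>n. w n > 0) \<and> square_integrable K \<and>
               compact (closure {t. ft K t \<noteq> 0}) \<and>
               (\<forall>n\<ge>1. condition_A K (w n) n (fe n)) \<and>
               (\<forall>fX. pdf fX \<and> square_integrable fX \<longrightarrow>
                  (\<lambda>n. mise n fX (fe n) (fhat K (w n) n (fe n))) \<longlonglongrightarrow> 0)))
       \<and> (\<not> star \<longrightarrow>
            (\<forall>\<beta>>1/2. \<exists>C\<^sub>0>0. \<forall>C\<ge>C\<^sub>0.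
               \<not> (\<exists>est :: nat \<Rightarrow> (nat \<Rightarrow> real) \<Rightarrow> real \<Rightarrow> complex.
                    (\<forall>n. estimator n (est n)) \<and>
                    (\<forall>fX \<in> sobolev_class \<beta> C. (\<lambda>n. mise n fX (fe n) (est n)) \<longlonglongrightarrow> 0))))"
proof (intro conjI impI allI)
  note fe = assms(4) and ft = assms(6)
  define S where "S n \<omega> = (\<Sum>j=1..n. exp (- (\<sigma> n j powr \<gamma> * \<omega> powr \<gamma>)))" for n and \<omega> :: real
  have Sle: "S n \<omega> \<le> (\<Sum>k=1..n. (cmod (ft (fe n k) t))\<^sup>2)" if "\<bar>t\<bar> \<le> \<omega>" for n \<omega> t
    unfolding S_def
  proof (rule sum_mono)
    fix k assume k: "k \<in> {1..n}"
    have "\<bar>t\<bar> powr \<gamma> \<le> \<omega> powr \<gamma>" using that assms(1) by (intro powr_mono2) auto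
    then have "\<sigma> n k powr \<gamma> * \<bar>t\<bar> powr \<gamma> \<le> \<sigma> n k powr \<gamma> * \<omega> powr \<gamma>" by (intro mult_left_mono) auto
    then show "exp (- (\<sigma> n k powr \<gamma> * \<omega> powr \<gamma>)) \<le> (cmod (ft (fe n k) t))\<^sup>2"
      by (simp add: ft[OF k] exp_double[symmetric])
  qed
  {
    assume star
    then have lim: "filterlim (\<lambda>n. S n \<omega>) at_top sequentially" if "\<omega> > 0" for \<omega>
      using that by (simp add: star_def S_def)
    obtain w where w: "\<And>n. w n > 0" "filterlim w at_top sequentially"
      "eventually (\<lambda>n. S n (w n) \<ge> (w n)\<^sup>2) sequentially"
      using slow_bandwidth[of S, OF lim] by metis
    show "\<exists>(w :: nat \<Rightarrow> real) (K :: real \<Rightarrow> real).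
               (\<forall>n. w n > 0) \<and> square_integrable K \<and>
               compact (closure {t. ft K t \<noteq> 0}) \<and>
               (\<forall>n\<ge>1. condition_A K (w n) n (fe n)) \<and>
               (\<forall>fX. pdf fX \<and> square_integrable fX \<longrightarrow>
                  (\<lambda>n. mise n fX (fe n) (fhat K (w n) n (fe n))) \<longlonglongrightarrow> 0)"
    proof (intro exI[of _ w] exI[of _ fejer] conjI allI impI square_integrable_fejer
        compact_support_ft_fejer w(1))
      fix n :: nat assume n: "n \<ge> 1"
      then have "S n (w n) > 0" unfolding S_def by (intro sum_pos) auto
      then show "condition_A fejer (w n) n (fe n)"
      proof (rule condition_A_fejer[OF n fe _ w(1), rotated 2])
        show "ft (fe n j) t \<noteq> 0" if "j \<in> {1..n}" for j t using ft[OF that] by simp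
        show "S n (w n) \<le> (\<Sum>k=1..n. (cmod (ft (fe n k) t))\<^sup>2)" if "\<bar>t\<bar> \<le> w n" for t
          by (rule Sle[OF that])
      qed
    next
      fix fX assume "pdf fX \<and> square_integrable fX"
      moreover have "eventually (\<lambda>n. \<forall>t. \<bar>t\<bar> \<le> w n \<longrightarrow> (w n)\<^sup>2 \<le>
          (\<Sum>k=1..n. (cmod (ft (fe n k) t))\<^sup>2)) sequentially"
        using w(3)
      proof eventually_elim
        case (elim n)
        then show ?case using Sle order_trans by blast
      qed
      ultimately show "(\<lambda>n. mise n fX (fe n) (fhat fejer (w n) n (fe n))) \<longlonglongrightarrow> 0"
        by (intro consistency_of_slow_bandwidth fe w(1,2)) auto
    qed
  }
  {
    fix \<beta> :: real
    assume "\<not> star" and \<beta>: "\<beta> > 1 / 2"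
    then obtain \<omega> where \<omega>: "\<omega> > 0" and "\<not> filterlim (\<lambda>n. S n \<omega>) at_top sequentially"
      by (auto simp: star_def S_def)
    then obtain Z where "\<not> eventually (\<lambda>n. Z \<le> S n \<omega>) sequentially" by (auto simp: filterlim_at_top)
    then have freq: "\<exists>\<^sub>F n in sequentially. S n \<omega> < Z" by (simp add: not_eventually not_le)
    \<comment> \<open>The perturbation then occupies frequencies of modulus in \<open>[6 * \<omega>, b + 1]\<close>.\<close>
    define b where "b = 6 * \<omega> + 1"
    have b: "b \<ge> 1" using \<omega> by (simp add: b_def)
    define c where "c = b + 1"
    have c: "c \<ge> 1" using b by (simp add: c_def)
    show "\<exists>C\<^sub>0>0. \<forall>C\<ge>C\<^sub>0.
               \<not> (\<exists>est :: nat \<Rightarrow> (nat \<Rightarrow> real) \<Rightarrow> real \<Rightarrow> complex.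
                    (\<forall>n. estimator n (est n)) \<and>
                    (\<forall>fX \<in> sobolev_class \<beta> C. (\<lambda>n. mise n fX (fe n) (est n)) \<longlonglongrightarrow> 0))"
    proof (intro exI[of _ "2 * c * (1 + c\<^sup>2) powr \<beta>"] conjI allI impI notI)
      have "1 + c\<^sup>2 > 0" by (simp add: add_pos_nonneg)
      then show "2 * c * (1 + c\<^sup>2) powr \<beta> > 0" using c by simp
      fix C assume C: "2 * c * (1 + c\<^sup>2) powr \<beta> \<le> C"
      assume "\<exists>est :: nat \<Rightarrow> (nat \<Rightarrow> real) \<Rightarrow> real \<Rightarrow> complex.
                    (\<forall>n. estimator n (est n)) \<and>
                    (\<forall>fX \<in> sobolev_class \<beta> C. (\<lambda>n. mise n fX (fe n) (est n)) \<longlonglongrightarrow> 0)"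
      then obtain est :: "nat \<Rightarrow> (nat \<Rightarrow> real) \<Rightarrow> real \<Rightarrow> complex" where est: "\<And>n. estimator n (est n)"
        and cons: "\<And>fX. fX \<in> sobolev_class \<beta> C \<Longrightarrow> (\<lambda>n. mise n fX (fe n) (est n)) \<longlonglongrightarrow> 0" by blast
      have f0: "fejer \<in> sobolev_class \<beta> C"
        using c \<beta> C by (intro sobolev_bandlimited[where c=c] pdf_fejer) (auto simp: ft_fejer intro!:
            tri_eq_0)
      have f1: "perturbed_fejer b \<in> sobolev_class \<beta> C"
        using c b \<beta> C by (intro sobolev_bandlimited[where c=c] pdf_perturbed_fejer) (auto simp:
            ft_perturbed_fejer tri_eq_0 c_def)
      define k where "k = 2 + 1 / (2 * \<omega> powr \<gamma>)"
      have k: "k > 0" using \<omega> by (simp add: k_def add_pos_nonneg)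
      define e where "e = (\<integral>\<^sup>+z. ennreal ((perturbation b z)\<^sup>2) \<partial>lborel)"
      have e: "e > 0" unfolding e_def by (rule perturbation_energy_pos[OF b])
      define \<kappa> where "\<kappa> = e * ennreal (exp (- 2 * (k * Z)))"
      have \<kappa>: "\<kappa> > 0" using e by (simp add: \<kappa>_def ennreal_zero_less_mult_iff)
      have lower: "\<kappa> \<le> 2 * (mise n fejer (fe n) (est n) + mise n (perturbed_fejer b) (fe n) (est
          n))" if n: "S n \<omega> < Z" for n
      proof -
        define x where "x j = (\<integral>z. \<bar>conv (perturbation b) (fe n j) z\<bar> \<partial>lborel)" for j
        have x0: "0 \<le> x j" for j by (simp add: x_def)
        have xh: "x j \<le> 1 / 2" if "j \<in> {1..n}" for j unfolding x_def by (intro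
            conv_perturbation_L1_half fe that)
        have xe: "x j \<le> k * exp (- (\<sigma> n j powr \<gamma> * \<omega> powr \<gamma>))" if "j \<in> {1..n}" for j
          unfolding x_def k_def b_def
          by (intro conv_perturbation_L1_stretched fe that assms(1) \<omega> ft) auto
        have "(\<Sum>j=1..n. x j) \<le> k * S n \<omega>" unfolding S_def sum_distrib_left by (intro sum_mono xe)
        also have "\<dots> \<le> k * Z" using n k by (intro mult_left_mono) auto
        finally have "exp (- 2 * (k * Z)) \<le> exp (- 2 * (\<Sum>j=1..n. x j))" by simp
        also have "\<dots> = (\<Prod>j=1..n. exp (- 2 * x j))" by (simp add: sum_distrib_left exp_sum[symmetric])
        also have "\<dots> \<le> (\<Prod>j=1..n. 1 - x j)"
          using x0 xh by (intro prod_mono conjI exp_le_one_minus) auto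
        finally have "\<kappa> \<le> e * ennreal (\<Prod>j=1..n. 1 - x j)"
          unfolding \<kappa>_def by (intro mult_left_mono ennreal_leI) auto
        also have "e = (\<integral>\<^sup>+z. ennreal ((perturbed_fejer b z - fejer z)\<^sup>2) \<partial>lborel)" by (simp add:
            e_def perturbed_fejer_def)
        also have "(\<integral>\<^sup>+z. ennreal ((perturbed_fejer b z - fejer z)\<^sup>2) \<partial>lborel) * ennreal (\<Prod>j=1..n. 1
            - x j)
            \<le> 2 * (mise n fejer (fe n) (est n) + mise n (perturbed_fejer b) (fe n) (est n))"
        proof (rule two_point_lower_bound[where B="1 / pi"])
          show "fejer x \<le> 1 / pi" for x using fejer_le[of x] by (rule order_trans) (simp add:
              field_simps)
          show "(\<integral>z. \<bar>conv (perturbed_fejer b) (fe n j) z - conv fejer (fe n j) z\<bar> \<partial>lborel) \<le>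
              x j" if "j \<in> {1..n}" for j
          proof -
            have "conv (perturbed_fejer b) (fe n j) z = conv fejer (fe n j) z +
                conv (perturbation b) (fe n j) z" for z
              unfolding perturbed_fejer_def[abs_def]
              by (intro conv_add[where B="1/(2*pi)" and C="1/(2*pi)"] fe that
                  abs_perturbation_bounded) (auto simp: fejer_nonneg fejer_le)
            then show ?thesis by (simp add: x_def)
          qed
          show "x j \<le> 1" if "j \<in> {1..n}" for j using xh[OF that] by simp
        qed (auto intro: pdf_fejer pdf_perturbed_fejer[OF b] perturbed_fejer_le fe est)
        finally show ?thesis .
      qed
      have "(\<lambda>n. 2 * (mise n fejer (fe n) (est n) + mise n (perturbed_fejer b) (fe n) (est n))) \<longlonglongrightarrow>
          2 * (0 + 0)"
        by (intro ennreal_tendsto_cmult tendsto_add cons f0 f1) simp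
      then have "eventually (\<lambda>n. 2 * (mise n fejer (fe n) (est n) + mise n (perturbed_fejer b) (fe
          n) (est n)) < \<kappa>) sequentially"
        using \<kappa> by (intro order_tendstoD(2)[where y="2 * (0 + 0)"]) auto
      then have "eventually (\<lambda>n. \<not> S n \<omega> < Z) sequentially"
      proof eventually_elim
        case (elim n)
        then show ?case using lower[of n] by (auto simp: not_less[symmetric])
      qed
      then show False using freq by (simp add: frequently_def)
    qed
  }
qed

end
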